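(* Let $P$ be a Delzant polytope and let $M_P$ be the smooth toric variety defined by the monomial embedding with all weights $c_\alpha=1$. Then for every $N\ge1$ the Szeg\"o kernel of $M_P$ factors as $$\Pi_N^{M_P}=\mathcal M_N\circ\Pi_1^N,$$ where $\Pi_1^N$ is the operator with kernel $\Pi_1^N(x,y)=\langle\iota_P(x),\overline{\iota_P(y)}\rangle^N$ and $\mathcal M_N$ is the operator on $\mathcal H^2_N(X_P)$ with $\mathcal M_N\hat\chi^P_\alpha=\mathcal P_N(\alpha)^{-1}\mathcal Q_N(\alpha)^{-1}\hat\chi^P_\alpha$ for all $\alpha\in NP\cap\mathbb Z^m$.
   Context: $P\subset[0,\infty)^m$ is an $m$-dimensional convex polytope with integer vertices which is Delzant (at each vertex exactly $m$ edges meet, and their primitive integer direction vectors form a $\mathbb Z$-basis of $\mathbb Z^m$). Write $P\cap\mathbb Z^m=\{\alpha(1),\dots,\alpha(d+1)\}$. $M_P\subset\mathbb{CP}^d$ is the closure of the image of $z\in(\mathbb C^* )^m\mapsto[z^{\alpha(1)},\dots,z^{\alpha(d+1)}]$. $L_P$ is the restriction of $\mathcal O(1)$ to $M_P$ with metric $h_P$ restricted from the Fubini-Study metric $|\lambda_j|_{FS}([\zeta])=|\zeta_j|/\|\zeta\|$ ($\lambda_j$ the $j$-th coordinate); $\omega_P$ is the restriction of $\omega_{FS}=\frac{i}{2\pi}\partial\bar\partial\log\|\zeta\|^2$; $d\mathrm{Vol}_{M_P}=\omega_P^m/m!$. $X_P$ is the unit circle bundle in $L_P^{-1}$, identified with $\{\zeta\in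 S^{2d+1}\subset\mathbb C^{d+1}:[\zeta]\in M_P\}$, and $\iota_P:X_P\to S^{2d+1}$ is the inclusion; $\langle\zeta,\bar\eta\rangle=\sum_j\zeta_j\bar\eta_j$. $X_P$ has the volume form giving mass 1 to each circle fiber and pushing forward to $d\mathrm{Vol}_{M_P}$. A section $s$ of $L_P^N$ lifts to $\hat s(\lambda)=(\lambda^{\otimes N},s(z))$ for $\lambda\in X_P$ over $z$; $\mathcal H^2_N(X_P)$ is the space of lifts of $H^0(M_P,L_P^N)$, and $\Pi_N^{M_P}:\mathcal L^2(X_P)\to\mathcal H^2_N(X_P)$ is the orthogonal projection. For $\alpha\in NP\cap\mathbb Z^m$, $\chi^P_\alpha\in H^0(M_P,L_P^N)$ is the section whose lift is $\hat\chi_\alpha^P=e^{iN\theta}z^\alpha\big(\sum_{\beta\in P\cap\mathbb Z^m}|z^\beta|^2\big)^{-N/2}$ at the point $e^{i\theta}(z^\beta)_\beta/\|(z^\beta)_\beta\|$, $z\in(\mathbb C^* )^m$. These form an orthogonal basis of $\mathcal H^2_N(X_P)$. For $\alpha\in NP\cap\mathbb Z^m$ define $$\mathcal P_N(\alpha)=\#\{(\beta_1,\dots,\beta_N):\beta_j\in P\cap\mathbb Z^m,\ \beta_1+\dots+\beta_N=\alpha\},\qquad \mathcal Q_N(\alpha)=\int_{M_P}\|\chi^P_\alpha(z)\|^2_{h_P^N}\,d\mathrm{Vol}_{M_P}(z)=\int_{X_P}|\hat\chi^P_\alpha|^2\,d\mathrm{Vol}_{X_P}.$$ The paper takes as known that,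 $P$ being Delzant, $\mathcal P_N(\alpha)\ge1$ for every $\alpha\in NP\cap\mathbb Z^m$, so that $\mathcal M_N$ is well defined. *)

theory Defs
  imports "HOL-Analysis.Analysis"
begin

section \<open>Lattice points and Delzant polytopes\<close>

definition of_ivec :: "int^'m \<Rightarrow> real^'m" where
  "of_ivec a = (\<chi> i. real_of_int (a $ i))"

definition lattice_points :: "(real^'m) set \<Rightarrow> (int^'m) set" where
  "lattice_points K = {a. of_ivec a \<in> K}"

definition dilate :: "nat \<Rightarrow> (real^'m) set \<Rightarrow> (real^'m) set" where
  "dilate N K = (\<lambda>x. real N *\<^sub>R x) ` K"

definition is_Z_basis :: "(int^'m) set \<Rightarrow> bool" where
  "is_Z_basis B \<longleftrightarrow> \<not> module.dependent (*s) B \<and> module.span (*s) B = UNIV"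

definition edges_at :: "(real^'m) set \<Rightarrow> real^'m \<Rightarrow> (real^'m) set set" where
  "edges_at P v = {e. e edge_of P \<and> v \<in> e}"

definition edge_directions :: "(real^'m) set \<Rightarrow> real^'m \<Rightarrow> (int^'m) set" where
  "edge_directions P v =
     {u. Gcd (range (\<lambda>i. u $ i)) = 1 \<and>
         (\<exists>e\<in>edges_at P v. \<exists>l>0. e = closed_segment v (v + l *\<^sub>R of_ivec u))}"

definition delzant_polytope :: "(real^'m) set \<Rightarrow> bool" where
  "delzant_polytope P \<longleftrightarrow>
     polytope P \<and> aff_dim P = int CARD('m) \<and>
     P \<subseteq> {x. \<forall>i. 0 \<le> x $ i} \<and>
     (\<forall>v. v extreme_point_of P \<longrightarrow>
        v \<in> range of_ivec \<and>
        card (edges_at P v) = CARD('m) \<and>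
        is_Z_basis (edge_directions P v))"

text \<open>The number of ways of writing \<open>a\<close> as an ordered sum of \<open>N\<close> lattice points of \<open>P\<close>.\<close>

definition partition_count :: "(real^'m) set \<Rightarrow> nat \<Rightarrow> int^'m \<Rightarrow> nat" where
  "partition_count P N a =
     card {bs. length bs = N \<and> set bs \<subseteq> lattice_points P \<and> sum_list bs = a}"


section \<open>Complex projective space\<close>

text \<open>Points are the complex lines through the origin; the topology is the quotient topology.
  The homogeneous coordinates are indexed by a finite type \<open>'k\<close>, so that the dimension
  is \<open>CARD('k) - 1\<close>.\<close>

typedef ('k::finite) cproj = "{l :: (complex^'k) set. \<exists>v. v \<noteq> 0 \<and> l = range (\<lambda>c. c *s v)}"
  morphisms line Abs_cproj
proof -
  have "(axis undefined 1 :: complex^'k) \<noteq> 0"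
    by (simp add: axis_eq_0_iff)
  then show ?thesis by blast
qed

definition proj :: "complex^'k::finite \<Rightarrow> 'k cproj" where
  "proj v = Abs_cproj (range (\<lambda>c. c *s v))"

instantiation cproj :: (finite) topological_space
begin

definition open_cproj :: "'a cproj set \<Rightarrow> bool" where
  "open_cproj U \<longleftrightarrow> open {v. v \<noteq> 0 \<and> proj v \<in> U}"

instance
proof
  have "{v :: complex^'a. v \<noteq> 0 \<and> proj v \<in> UNIV} = - {0}" by auto
  then show "open (UNIV :: 'a cproj set)"
    by (simp add: open_cproj_def open_Compl)
next
  fix S T :: "'a cproj set"
  assume "open S" "open T"
  then have "open ({v. v \<noteq> 0 \<and> proj v \<in> S} \<inter> {v. v \<noteq> 0 \<and> proj v \<in> T})"
    unfolding open_cproj_def by (rule open_Int)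
  moreover have "{v. v \<noteq> 0 \<and> proj v \<in> S} \<inter> {v. v \<noteq> 0 \<and> proj v \<in> T} =
      {v. v \<noteq> 0 \<and> proj v \<in> S \<inter> T}" by auto
  ultimately show "open (S \<inter> T)"
    by (simp only: open_cproj_def)
next
  fix K :: "'a cproj set set"
  assume "\<forall>S\<in>K. open S"
  then have "open (\<Union>S\<in>K. {v. v \<noteq> 0 \<and> proj v \<in> S})"
    unfolding open_cproj_def by (rule open_UN)
  moreover have "(\<Union>S\<in>K. {v. v \<noteq> 0 \<and> proj v \<in> S}) = {v. v \<noteq> 0 \<and> proj v \<in> \<Union>K}" by auto
  ultimately show "open (\<Union>K)"
    by (simp only: open_cproj_def)
qed

end


section \<open>The toric variety and its local holomorphic parametrizations\<close>

text \<open>In what follows \<open>\<alpha> :: 'k \<Rightarrow> int^'m\<close> enumerates the lattice points of the polytope.\<close>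

definition torus :: "(complex^'m) set" where
  "torus = {z. \<forall>i. z $ i \<noteq> 0}"

definition cmonom :: "complex^'m \<Rightarrow> int^'m \<Rightarrow> complex" where
  "cmonom z a = (\<Prod>i\<in>UNIV. (z $ i) powi (a $ i))"

definition monomials :: "('k::finite \<Rightarrow> int^'m) \<Rightarrow> complex^'m \<Rightarrow> complex^'k" where
  "monomials \<alpha> z = (\<chi> k. cmonom z (\<alpha> k))"

definition toric_variety :: "('k::finite \<Rightarrow> int^'m) \<Rightarrow> 'k cproj set" where
  "toric_variety \<alpha> = closure ((\<lambda>z. proj (monomials \<alpha> z)) ` torus)"

text \<open>Holomorphy of a function of several complex variables: real differentiability with
  complex-linear derivative.\<close>

definition holo_on :: "(complex^'m \<Rightarrow> complex) \<Rightarrow> (complex^'m) set \<Rightarrow> bool" where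
  "holo_on f U \<longleftrightarrow>
     (\<forall>w\<in>U. \<exists>D. (f has_derivative D) (at w) \<and> (\<forall>c v. D (c *s v) = c * D v))"

text \<open>Inverse holomorphic charts of the complex submanifold \<open>toric_variety \<alpha>\<close>, presented
  by a holomorphic lift \<open>\<Phi>\<close> to the punctured vector space of homogeneous coordinates:
  the map sending \<open>w\<close> to \<open>[\<Phi> w]\<close> is a homeomorphism of \<open>U\<close> onto a relatively open subset and
  an immersion (the kernel of the differential of \<open>proj\<close> at \<open>\<zeta>\<close> is the complex line of
  \<open>\<zeta>\<close>).\<close>

definition hol_param ::
    "('k::finite \<Rightarrow> int^'m) \<Rightarrow> (complex^'m) set \<Rightarrow> (complex^'m \<Rightarrow> complex^'k) \<Rightarrow> bool" where
  "hol_param \<alpha> U \<Phi> \<longleftrightarrow>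
     open U \<and> (\<forall>k. holo_on (\<lambda>w. \<Phi> w $ k) U) \<and> (\<forall>w\<in>U. \<Phi> w \<noteq> 0) \<and>
     openin (top_of_set (toric_variety \<alpha>)) ((\<lambda>w. proj (\<Phi> w)) ` U) \<and>
     (\<exists>g. homeomorphism U ((\<lambda>w. proj (\<Phi> w)) ` U) (\<lambda>w. proj (\<Phi> w)) g) \<and>
     (\<forall>w\<in>U. \<forall>v. (\<exists>c. frechet_derivative \<Phi> (at w) v = c *s \<Phi> w) \<longrightarrow> v = 0)"


section \<open>The Fubini-Study volume\<close>

definition wirtinger :: "'m \<Rightarrow> (complex^'m \<Rightarrow> complex) \<Rightarrow> complex^'m \<Rightarrow> complex" where
  "wirtinger j f w =
     (frechet_derivative f (at w) (axis j 1) - \<i> * frechet_derivative f (at w) (axis j \<i>)) / 2"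

definition wirtinger_bar :: "'m \<Rightarrow> (complex^'m \<Rightarrow> complex) \<Rightarrow> complex^'m \<Rightarrow> complex" where
  "wirtinger_bar j f w =
     (frechet_derivative f (at w) (axis j 1) + \<i> * frechet_derivative f (at w) (axis j \<i>)) / 2"

text \<open>The Fubini-Study form \<open>(\<i>/2\<pi>) \<partial>\<partial>bar log \<parallel>\<zeta>\<parallel>\<^sup>2\<close> pulls back under \<open>\<Phi>\<close> to
  \<open>(\<i>/2\<pi>) \<Sum> g\<^bsub>jl\<^esub> dw\<^bsub>j\<^esub> \<and> dwbar\<^bsub>l\<^esub>\<close> with the coefficients \<open>g\<^bsub>jl\<^esub>\<close> below.\<close>

definition fs_coeffs :: "(complex^'m \<Rightarrow> complex^'k) \<Rightarrow> complex^'m \<Rightarrow> complex^'m^'m" where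
  "fs_coeffs \<Phi> w =
     (\<chi> j l. wirtinger j (wirtinger_bar l (\<lambda>u. of_real (ln ((norm (\<Phi> u))\<^sup>2)))) w)"

text \<open>The top power of that form divided by \<open>m!\<close> is \<open>det g\<close> times the product over \<open>j\<close> of
  \<open>(\<i>/2\<pi>) dw\<^bsub>j\<^esub> \<and> dwbar\<^bsub>j\<^esub> = (1/\<pi>) dx\<^bsub>j\<^esub> \<and> dy\<^bsub>j\<^esub>\<close>; its density with respect to Lebesgue measure
  is therefore \<open>det g / \<pi>\<^sup>m\<close>.\<close>

definition fs_density :: "(complex^'m \<Rightarrow> complex^'k) \<Rightarrow> complex^'m \<Rightarrow> real" where
  "fs_density \<Phi> w = Re (det (fs_coeffs \<Phi> w)) / pi ^ CARD('m)"

text \<open>\<open>V\<close> is the Borel measure on the toric variety given by this volume form, that is, in every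
  local holomorphic parametrization \<open>V\<close> is Lebesgue measure with the above density. As the
  volume form is globally defined, there is exactly one such measure when the polytope is
  Delzant.\<close>

definition is_fs_volume :: "('k::finite \<Rightarrow> int^'m) \<Rightarrow> 'k cproj measure \<Rightarrow> bool" where
  "is_fs_volume \<alpha> V \<longleftrightarrow>
     sets V = sets (restrict_space borel (toric_variety \<alpha>)) \<and>
     (\<forall>U \<Phi>. hol_param \<alpha> U \<Phi> \<longrightarrow>
        (\<forall>B\<in>sets borel. B \<subseteq> (\<lambda>w. proj (\<Phi> w)) ` U \<longrightarrow>
           emeasure V B =
             (\<integral>\<^sup>+ w. ennreal (fs_density \<Phi> w) * indicator {w\<in>U. proj (\<Phi> w) \<in> B} w \<partial>lborel)))"


section \<open>The circle bundle\<close>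

definition circle_bundle :: "('k::finite \<Rightarrow> int^'m) \<Rightarrow> (complex^'k) set" where
  "circle_bundle \<alpha> = {\<zeta>. norm \<zeta> = 1 \<and> proj \<zeta> \<in> toric_variety \<alpha>}"

text \<open>Normalized arc length on the unit circle of the line \<open>l\<close>; it does not depend on the base
  point chosen on the circle.\<close>

definition fiber_measure :: "'k::finite cproj \<Rightarrow> (complex^'k) set \<Rightarrow> ennreal" where
  "fiber_measure l A =
     emeasure lborel
       {t \<in> {0..<1::real}. cis (2 * pi * t) *s (SOME \<zeta>. \<zeta> \<in> line l \<and> norm \<zeta> = 1) \<in> A}"

definition circle_volume ::
    "('k::finite \<Rightarrow> int^'m) \<Rightarrow> 'k cproj measure \<Rightarrow> (complex^'k) measure" where
  "circle_volume \<alpha> V =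
     measure_of (circle_bundle \<alpha>) (sets (restrict_space borel (circle_bundle \<alpha>)))
       (\<lambda>A. \<integral>\<^sup>+ l. fiber_measure l A \<partial>V)"

definition square_integrable :: "'a measure \<Rightarrow> ('a \<Rightarrow> complex) \<Rightarrow> bool" where
  "square_integrable \<mu> f \<longleftrightarrow> f \<in> borel_measurable \<mu> \<and> integrable \<mu> (\<lambda>x. (cmod (f x))\<^sup>2)"

definition l2_inner :: "'a measure \<Rightarrow> ('a \<Rightarrow> complex) \<Rightarrow> ('a \<Rightarrow> complex) \<Rightarrow> complex" where
  "l2_inner \<mu> f g = (\<integral>x. f x * cnj (g x) \<partial>\<mu>)"


section \<open>Holomorphic sections and their lifts\<close>

text \<open>The fiber of \<open>O(N)\<close> over the line \<open>l\<close> is the \<open>N\<close>-th tensor power of the dual of \<open>l\<close>, realized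
  as the functions on \<open>l\<close> that are homogeneous of degree \<open>N\<close>; the functional attached to \<open>\<phi>\<close> takes
  the \<open>N\<close>-th tensor power of \<open>\<zeta>\<close> to \<open>\<phi> \<zeta>\<close>. A section is holomorphic if its pairings with the
  local holomorphic frames of \<open>O(-N)\<close> are; the lift \<open>\<Phi>\<close> of a parametrization is such a frame of
  \<open>O(-1)\<close>.\<close>

definition hol_sections ::
    "('k::finite \<Rightarrow> int^'m) \<Rightarrow> nat \<Rightarrow> ('k cproj \<Rightarrow> complex^'k \<Rightarrow> complex) set" where
  "hol_sections \<alpha> N =
     {s. (\<forall>l\<in>toric_variety \<alpha>. \<forall>\<zeta>\<in>line l. \<forall>c. s l (c *s \<zeta>) = c ^ N * s l \<zeta>) \<and>
         (\<forall>U \<Phi>. hol_param \<alpha> U \<Phi> \<longrightarrow> holo_on (\<lambda>w. s (proj (\<Phi> w)) (\<Phi> w)) U)}"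

text \<open>The norm of \<open>s l\<close> in the \<open>N\<close>-th power of the Fubini-Study metric.\<close>

definition fs_norm ::
    "nat \<Rightarrow> ('k::finite cproj \<Rightarrow> complex^'k \<Rightarrow> complex) \<Rightarrow> 'k cproj \<Rightarrow> real" where
  "fs_norm N s l = (THE r. \<forall>\<zeta>\<in>line l - {0}. r = cmod (s l \<zeta>) / norm \<zeta> ^ N)"

text \<open>Functions on the circle bundle are represented by functions that vanish off it.\<close>

definition lift ::
    "('k::finite \<Rightarrow> int^'m) \<Rightarrow> ('k cproj \<Rightarrow> complex^'k \<Rightarrow> complex) \<Rightarrow> complex^'k \<Rightarrow> complex" where
  "lift \<alpha> s \<zeta> = (if \<zeta> \<in> circle_bundle \<alpha> then s (proj \<zeta>) \<zeta> else 0)"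

definition hardy_space :: "('k::finite \<Rightarrow> int^'m) \<Rightarrow> nat \<Rightarrow> (complex^'k \<Rightarrow> complex) set" where
  "hardy_space \<alpha> N = lift \<alpha> ` hol_sections \<alpha> N"

text \<open>The lift formula determines the section over the open torus orbit, hence everywhere on the
  toric variety by density.\<close>

definition chi_section ::
    "('k::finite \<Rightarrow> int^'m) \<Rightarrow> nat \<Rightarrow> int^'m \<Rightarrow> 'k cproj \<Rightarrow> complex^'k \<Rightarrow> complex" where
  "chi_section \<alpha> N a =
     (SOME s. s \<in> hol_sections \<alpha> N \<and>
        (\<forall>z\<in>torus. \<forall>\<theta>.
           lift \<alpha> s (cis \<theta> *s ((1 / norm (monomials \<alpha> z)) *\<^sub>R monomials \<alpha> z)) =
             cis (real N * \<theta>) * cmonom z a *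
               of_real ((\<Sum>k\<in>UNIV. (cmod (cmonom z (\<alpha> k)))\<^sup>2) powr (- real N / 2))))"

definition chi_hat ::
    "('k::finite \<Rightarrow> int^'m) \<Rightarrow> nat \<Rightarrow> int^'m \<Rightarrow> complex^'k \<Rightarrow> complex" where
  "chi_hat \<alpha> N a = lift \<alpha> (chi_section \<alpha> N a)"

definition chi_norm_sq ::
    "('k::finite \<Rightarrow> int^'m) \<Rightarrow> 'k cproj measure \<Rightarrow> nat \<Rightarrow> int^'m \<Rightarrow> real" where
  "chi_norm_sq \<alpha> V N a = (\<integral>l. (fs_norm N (chi_section \<alpha> N a) l)\<^sup>2 \<partial>V)"


section \<open>The operators\<close>

definition szego_projection ::
    "('k::finite \<Rightarrow> int^'m) \<Rightarrow> 'k cproj measure \<Rightarrow> nat \<Rightarrow>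
     (complex^'k \<Rightarrow> complex) \<Rightarrow> complex^'k \<Rightarrow> complex" where
  "szego_projection \<alpha> V N f =
     (THE h. h \<in> hardy_space \<alpha> N \<and>
        (\<forall>g\<in>hardy_space \<alpha> N. l2_inner (circle_volume \<alpha> V) (\<lambda>x. f x - h x) g = 0))"

definition kernel_power :: "nat \<Rightarrow> complex^'k::finite \<Rightarrow> complex^'k \<Rightarrow> complex" where
  "kernel_power N x y = (\<Sum>k\<in>UNIV. x $ k * cnj (y $ k)) ^ N"

definition kernel_power_op ::
    "('k::finite \<Rightarrow> int^'m) \<Rightarrow> 'k cproj measure \<Rightarrow> nat \<Rightarrow>
     (complex^'k \<Rightarrow> complex) \<Rightarrow> complex^'k \<Rightarrow> complex" where
  "kernel_power_op \<alpha> V N f x =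
     (if x \<in> circle_bundle \<alpha> then \<integral>y. kernel_power N x y * f y \<partial>circle_volume \<alpha> V else 0)"

text \<open>\<open>M\<close> is a linear operator on the Hardy space with the prescribed eigenvalues on the
  monomial sections. Its values off the Hardy space are irrelevant.\<close>

definition is_multiplier ::
    "(real^'m) set \<Rightarrow> ('k::finite \<Rightarrow> int^'m) \<Rightarrow> 'k cproj measure \<Rightarrow> nat \<Rightarrow>
     ((complex^'k \<Rightarrow> complex) \<Rightarrow> complex^'k \<Rightarrow> complex) \<Rightarrow> bool" where
  "is_multiplier P \<alpha> V N M \<longleftrightarrow>
     (\<forall>f\<in>hardy_space \<alpha> N. M f \<in> hardy_space \<alpha> N) \<and>
     (\<forall>f\<in>hardy_space \<alpha> N. \<forall>g\<in>hardy_space \<alpha> N. M (\<lambda>x. f x + g x) = (\<lambda>x. M f x + M g x)) \<and>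
     (\<forall>f\<in>hardy_space \<alpha> N. \<forall>c. M (\<lambda>x. c * f x) = (\<lambda>x. c * M f x)) \<and>
     (\<forall>a\<in>lattice_points (dilate N P).
        M (chi_hat \<alpha> N a) =
          (\<lambda>x. of_real (inverse (real (partition_count P N a)) * inverse (chi_norm_sq \<alpha> V N a))
               * chi_hat \<alpha> N a x))"

end

theory Submission
  imports Defs "HOL-Complex_Analysis.Cauchy_Integral_Formula"
begin

text \<open>
  Over the circle bundle the homogeneous coordinates are monomials up to a common factor, so that a
  product of \<open>N\<close> coordinates depends only on the sum \<open>a\<close> of the exponents and equals the lift of the
  monomial section \<open>\<chi>\<^sub>a\<close>. Expanding \<open>\<langle>x, y\<rangle>\<^sup>N\<close> into products of coordinates and collecting the terms
  with the same sum, the kernel becomes \<open>\<Sum>\<^sub>a p(a) \<chi>\<^sub>a(x) cnj \<chi>\<^sub>a(y)\<close>, where \<open>p(a)\<close> is the number of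
  ways to write \<open>a\<close> as an ordered sum of \<open>N\<close> lattice points (\<open>kernel_power_expansion\<close>). The
  operator with this kernel sends \<open>f\<close> to \<open>\<Sum>\<^sub>a p(a) \<langle>f, \<chi>\<^sub>a\<rangle> \<chi>\<^sub>a\<close>, whereas the orthogonal projection
  sends it to \<open>\<Sum>\<^sub>a q(a)\<^sup>-\<^sup>1 \<langle>f, \<chi>\<^sub>a\<rangle> \<chi>\<^sub>a\<close> with \<open>q(a) = \<parallel>\<chi>\<^sub>a\<parallel>\<^sup>2\<close>
  (\<open>szego_projection_eq\<close>). The factor between the coefficients is the eigenvalue
  of the multiplier. What has to be proved is that the \<open>\<chi>\<^sub>a\<close> form an orthogonal basis of the Hardy
  space with positive norms.

  All of this is done in the affine charts at the vertices of the polytope. The convex geometry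
  behind them is that a polytope lies in the cone of its edges at a vertex
  (\<open>polytope_edge_cone\<close>). For a Delzant vertex the primitive edge vectors therefore give lattice
  coordinates in which all lattice points of the polytope have nonnegative entries
  (\<open>delzant_vertex_frame\<close>), and the homogeneous coordinates divided by that of the vertex become
  monomials on \<open>\<complex>\<^sup>m\<close> (\<open>hol_param_dchart\<close>). At every point of the toric variety the coordinate of some
  vertex has maximal modulus (\<open>dominating_vertex\<close>), so that the charts cover it, even by their closed
  unit polydiscs.

  Spanning (\<open>torus_value_expansion\<close>, \<open>hardy_space_eq\<close>): a holomorphic section is a holomorphic
  function on the torus that is entire with polynomial growth in each variable, as one sees in
  the charts at the vertices with extremal coordinate. By Liouville's theorem it is polynomial in each
  variable separately, hence a finite sum of monomials. Its terms are isolated by averaging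
  over roots of unity, and holomorphy of the section in the chart at a vertex forces every
  exponent into the dilated cone of that vertex. The intersection of these cones is the dilated
  polytope.

  Orthogonality (\<open>inner_chi_orthogonal\<close>): the Fubini-Study density depends on a parametrization only
  through its norm, so that a chart composed with a rotation of the coordinates has the same
  density. As the volume is given by this density in both charts, it is invariant under the rotation,
  and two different characters integrate to zero against each other.

  Positive norms (\<open>Q_pos\<close>): the volume is finite by the covering by polydiscs, the boundary of the
  torus orbit is a null set since it consists of coordinate hyperplanes in the charts, and the orbit
  has positive volume since the density is explicitly known (\<open>fs_coeffs_chart\<close>) and positive at a
  vertex.
\<close>

section \<open>Projective space\<close>

lemma line_proj:
  fixes v :: "complex^'k::finite"
  assumes "v \<noteq> 0"
  shows "line (proj v) = range (\<lambda>c. c *s v)"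
  unfolding proj_def by (rule Abs_cproj_inverse) (use assms in blast)

lemma mem_line_proj: "v \<noteq> 0 \<Longrightarrow> v \<in> line (proj v)"
  by (subst line_proj) (auto intro!: range_eqI[of _ _ 1])

lemma proj_scale:
  fixes v :: "complex^'k::finite"
  assumes "c \<noteq> 0" shows "proj (c *s v) = proj v"
proof -
  have "range (\<lambda>d. d *s (c *s v)) = range (\<lambda>d. d *s v)" (is "?L = ?R")
  proof
    show "?L \<subseteq> ?R" by auto
    show "?R \<subseteq> ?L"
    proof
      fix x assume "x \<in> ?R"
      then obtain d where "x = d *s v" by auto
      then have "x = (d / c) *s (c *s v)" using assms by simp
      then show "x \<in> ?L" by blast
    qed
  qed
  then show ?thesis by (simp only: proj_def)
qed

lemma proj_of_mem_line:
  fixes \<zeta> :: "complex^'k::finite"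
  assumes "\<zeta> \<in> line l" "\<zeta> \<noteq> 0" shows "proj \<zeta> = l"
proof -
  obtain v where v: "v \<noteq> 0" "line l = range (\<lambda>c. c *s v)"
    using line[of l] by auto
  then obtain c where c: "\<zeta> = c *s v" using assms by auto
  then have "c \<noteq> 0" using assms by auto
  have "line (proj v) = line l" using v line_proj by auto
  then have "proj v = l" by (simp add: line_inject)
  then show ?thesis using proj_scale[OF \<open>c \<noteq> 0\<close>] c by auto
qed

lemma proj_eq_iff:
  fixes v w :: "complex^'k::finite"
  assumes "v \<noteq> 0" "w \<noteq> 0"
  shows "proj v = proj w \<longleftrightarrow> (\<exists>c. c \<noteq> 0 \<and> w = c *s v)"
proof
  assume "proj v = proj w"
  then have "w \<in> range (\<lambda>c. c *s v)" using assms mem_line_proj[of w] line_proj[of v] by simp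
  then obtain c where "w = c *s v" by auto
  with assms show "\<exists>c. c \<noteq> 0 \<and> w = c *s v" by auto
next
  assume "\<exists>c. c \<noteq> 0 \<and> w = c *s v"
  then show "proj v = proj w" using proj_scale by metis
qed

lemma norm_vec_scale: "norm (c *s v) = cmod c * norm (v :: complex^'k::finite)"
  by (simp add: norm_vec_def norm_mult L2_set_right_distrib)

lemma exists_unit_vector:
  fixes l :: "'k::finite cproj"
  shows "\<exists>\<zeta>. \<zeta> \<in> line l \<and> norm \<zeta> = 1"
proof -
  obtain v where v: "v \<noteq> 0" "line l = range (\<lambda>c. c *s v)"
    using line[of l] by auto
  have "norm (of_real (1 / norm v) *s v) = 1"
    using v by (simp add: norm_vec_scale norm_divide)
  then show ?thesis using v by blast
qed

lemma unit_vector_nonzero: "norm \<zeta> = 1 \<Longrightarrow> \<zeta> \<noteq> (0 :: complex^'k::finite)"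
  by auto

text \<open>A representative of a line by homogeneous coordinates. It is the base point chosen in
  \<open>fiber_measure\<close>, and depends on the line in no regular way; homogeneous statements about it
  transfer to every other representative.\<close>

definition unit_rep :: "'k::finite cproj \<Rightarrow> complex^'k" where
  "unit_rep l = (SOME \<zeta>. \<zeta> \<in> line l \<and> norm \<zeta> = 1)"

lemma unit_rep: "norm (unit_rep l) = 1" "proj (unit_rep l) = l" "unit_rep l \<noteq> 0"
proof -
  have *: "unit_rep l \<in> line l \<and> norm (unit_rep l) = 1"
    unfolding unit_rep_def by (rule someI_ex, rule exists_unit_vector)
  then show "norm (unit_rep l) = 1" "unit_rep l \<noteq> 0" by auto
  then show "proj (unit_rep l) = l" using * proj_of_mem_line by blast
qed

lemma proj_same:
  assumes "\<zeta> \<noteq> 0" "\<eta> \<noteq> 0" "proj \<zeta> = proj \<eta>"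
  obtains c where "c \<noteq> 0" "\<zeta> = c *s \<eta>"
  using proj_eq_iff[OF assms(2,1)] assms(3) by auto

lemma continuous_on_proj: "continuous_on (- {0}) proj"
proof (subst continuous_on_open_vimage)
  show "open (- {0} :: (complex^'k) set)" by (simp add: open_Compl)
  show "\<forall>B. open B \<longrightarrow> open (proj -` B \<inter> - {0 :: complex^'k})"
  proof (intro allI impI)
    fix B :: "'k cproj set" assume "open B"
    then have "open {v. v \<noteq> 0 \<and> proj v \<in> B}" by (simp add: open_cproj_def)
    moreover have "{v. v \<noteq> 0 \<and> proj v \<in> B} = proj -` B \<inter> - {0}" by auto
    ultimately show "open (proj -` B \<inter> - {0})" by simp
  qed
qed

text \<open>The universal property of the quotient topology.\<close>

lemma continuous_on_cproj:
  fixes f :: "'k::finite cproj \<Rightarrow> 'b::topological_space"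
  assumes "open S" and "continuous_on {\<zeta>. \<zeta> \<noteq> 0 \<and> proj \<zeta> \<in> S} (\<lambda>\<zeta>. f (proj \<zeta>))"
  shows "continuous_on S f"
proof (subst continuous_on_open_vimage[OF assms(1)], intro allI impI)
  fix B :: "'b set" assume "open B"
  have o: "open {\<zeta>. \<zeta> \<noteq> 0 \<and> proj \<zeta> \<in> S}" using assms(1) by (simp add: open_cproj_def)
  then have "open ((\<lambda>\<zeta>. f (proj \<zeta>)) -` B \<inter> {\<zeta>. \<zeta> \<noteq> 0 \<and> proj \<zeta> \<in> S})"
    using assms(2) \<open>open B\<close> by (subst (asm) continuous_on_open_vimage) auto
  moreover have "(\<lambda>\<zeta>. f (proj \<zeta>)) -` B \<inter> {\<zeta>. \<zeta> \<noteq> 0 \<and> proj \<zeta> \<in> S}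
      = {\<zeta>. \<zeta> \<noteq> 0 \<and> proj \<zeta> \<in> f -` B \<inter> S}" by auto
  ultimately show "open (f -` B \<inter> S)" by (simp add: open_cproj_def)
qed

text \<open>Conditions on homogeneous coordinates that are stable under scaling may be tested on the chosen
  representative, and closedness upstairs gives closedness in the quotient topology.\<close>

lemma closed_cproj:
  assumes "closed {\<zeta>. Q \<zeta>}" and inv: "\<And>c \<zeta>. c \<noteq> 0 \<Longrightarrow> Q \<zeta> \<Longrightarrow> Q (c *s \<zeta>)"
  shows "closed {l. Q (unit_rep l)}" and "\<And>\<zeta>. \<zeta> \<noteq> 0 \<Longrightarrow> Q (unit_rep (proj \<zeta>)) \<longleftrightarrow> Q \<zeta>"
proof -
  show *: "Q (unit_rep (proj \<zeta>)) \<longleftrightarrow> Q \<zeta>" if nz: "\<zeta> \<noteq> 0" for \<zeta>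
  proof -
    obtain c where c: "c \<noteq> 0" "\<zeta> = c *s unit_rep (proj \<zeta>)"
      using proj_same[OF nz unit_rep(3) unit_rep(2)[symmetric]] by blast
    then have c': "unit_rep (proj \<zeta>) = (1/c) *s \<zeta>"
      by (simp add: vec_eq_iff)
    show ?thesis
    proof
      show "Q (unit_rep (proj \<zeta>)) \<Longrightarrow> Q \<zeta>" using inv[OF c(1), of "unit_rep (proj \<zeta>)"] c(2) by simp
      show "Q \<zeta> \<Longrightarrow> Q (unit_rep (proj \<zeta>))" using inv[of "1/c" \<zeta>] c(1) c' by simp
    qed
  qed
  have "{\<zeta>. \<zeta> \<noteq> 0 \<and> proj \<zeta> \<in> - {l. Q (unit_rep l)}} = - {0} \<inter> - {\<zeta>. Q \<zeta>}"
    using * by auto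
  then have "open {\<zeta>. \<zeta> \<noteq> 0 \<and> proj \<zeta> \<in> - {l. Q (unit_rep l)}}"
    using assms(1) by (simp add: open_Compl open_Int)
  then show "closed {l. Q (unit_rep l)}" by (simp add: closed_def open_cproj_def)
qed

lemma open_coord_nonzero: "open {l :: 'k::finite cproj. unit_rep l $ k \<noteq> 0}"
proof -
  have "closed {l :: 'k cproj. unit_rep l $ k = 0}"
    by (rule closed_cproj(1)) (auto intro!: closed_Collect_eq continuous_intros)
  moreover have "- {l :: 'k cproj. unit_rep l $ k = 0} = {l. unit_rep l $ k \<noteq> 0}" by auto
  ultimately show ?thesis using open_Compl by metis
qed

lemma unit_rep_proj_nonzero: "\<zeta> \<noteq> 0 \<Longrightarrow> unit_rep (proj \<zeta>) $ k \<noteq> 0 \<longleftrightarrow> \<zeta> $ k \<noteq> 0"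
  by (subst closed_cproj(2)[where Q="\<lambda>\<zeta>. \<zeta> $ k = 0"])
    (auto intro!: closed_Collect_eq continuous_intros)

section \<open>Monomials on the torus\<close>

lemma cmonom_nonzero: "z \<in> torus \<Longrightarrow> cmonom z a \<noteq> 0"
  by (simp add: cmonom_def torus_def)

lemma cmonom_add: "z \<in> torus \<Longrightarrow> cmonom z (a + b) = cmonom z a * cmonom z b"
  by (simp add: cmonom_def torus_def power_int_add prod.distrib)

lemma cmonom_0 [simp]: "cmonom z 0 = 1"
  by (simp add: cmonom_def)

lemma cmonom_minus: "z \<in> torus \<Longrightarrow> cmonom z (- a) = inverse (cmonom z a)"
  by (simp add: cmonom_def power_int_minus prod_inversef[symmetric] o_def)

lemma cmonom_diff: "z \<in> torus \<Longrightarrow> cmonom z (a - b) = cmonom z a / cmonom z b"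
  using cmonom_add[of z a "- b"] by (simp add: cmonom_minus divide_inverse)

lemma prod_power_int: "(\<Prod>i\<in>A. (f i :: complex) powi c) = (\<Prod>i\<in>A. f i) powi c"
  by (induction A rule: infinite_finite_induct) (auto simp: power_int_mult_distrib)

lemma cmonom_scale: "z \<in> torus \<Longrightarrow> cmonom z (c *s a) = cmonom z a powi c"
  by (simp add: cmonom_def power_int_mult mult.commute[of c] prod_power_int)

lemma cmonom_sum: "z \<in> torus \<Longrightarrow> cmonom z (\<Sum>i\<in>A. f i) = (\<Prod>i\<in>A. cmonom z (f i))"
  by (induction A rule: infinite_finite_induct) (auto simp: cmonom_add)

lemma cmonom_sum_list: "z \<in> torus \<Longrightarrow> cmonom z (sum_list as) = prod_list (map (cmonom z) as)"
  by (induction as) (auto simp: cmonom_add)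

lemma cmonom_mult: "cmonom (\<chi> i. x $ i * y $ i) a = cmonom x a * cmonom y a"
  by (simp add: cmonom_def power_int_mult_distrib prod.distrib)

text \<open>The logarithm of the modulus of a monomial is linear in the exponent, so that comparing moduli of
  monomials amounts to comparing values of a linear functional on the polytope.\<close>

lemma cmod_cmonom:
  assumes "z \<in> torus"
  shows "cmod (cmonom z a) = exp ((\<chi> i. ln (cmod (z $ i))) \<bullet> of_ivec a)"
proof -
  have "cmod (cmonom z a) = (\<Prod>i\<in>UNIV. exp (ln (cmod (z $ i)) * real_of_int (a $ i)))"
    unfolding cmonom_def prod_norm[symmetric]
  proof (rule prod.cong)
    fix i
    have "cmod (z $ i powi a $ i) = cmod (z $ i) powi (a $ i)" by (simp add: norm_power_int)
    also have "\<dots> = cmod (z $ i) powr of_int (a $ i)"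
      using assms by (subst powr_real_of_int') (auto simp: torus_def)
    also have "\<dots> = exp (ln (cmod (z $ i)) * of_int (a $ i))"
      using assms by (simp add: powr_def torus_def mult.commute)
    finally show "cmod (z $ i powi a $ i) = exp (ln (cmod (z $ i)) * real_of_int (a $ i))" .
  qed auto
  then show ?thesis by (simp add: exp_sum inner_vec_def of_ivec_def)
qed

lemma monomials_nonzero:
  fixes \<alpha> :: "'k::finite \<Rightarrow> int^'m"
  assumes "z \<in> torus" shows "monomials \<alpha> z \<noteq> 0"
proof
  assume "monomials \<alpha> z = 0"
  then have "monomials \<alpha> z $ undefined = 0" by simp
  then show False using cmonom_nonzero[OF assms] by (simp add: monomials_def)
qed

lemma proj_monomials_in_toric: "z \<in> torus \<Longrightarrow> proj (monomials \<alpha> z) \<in> toric_variety \<alpha>"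
  unfolding toric_variety_def by (intro subsetD[OF closure_subset] imageI)

text \<open>The device that carries identities and inequalities between monomials from the torus to the
  boundary points of the toric variety: the lines satisfying a closed scaling-invariant
  condition form a closed set, so that it contains the closure of the torus orbit.\<close>

lemma toric_variety_closed_relation:
  fixes \<alpha> :: "'k::finite \<Rightarrow> int^'m"
  assumes "closed {\<zeta>. Q \<zeta>}" and inv: "\<And>c \<zeta>. c \<noteq> 0 \<Longrightarrow> Q \<zeta> \<Longrightarrow> Q (c *s \<zeta>)"
    and torus: "\<And>z. z \<in> torus \<Longrightarrow> Q (monomials \<alpha> z)"
    and "\<zeta> \<noteq> 0" "proj \<zeta> \<in> toric_variety \<alpha>"
  shows "Q \<zeta>"
proof -
  have "(\<lambda>z. proj (monomials \<alpha> z)) ` torus \<subseteq> {l. Q (unit_rep l)}"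
    using closed_cproj(2)[OF assms(1) inv] torus monomials_nonzero by blast
  then have "toric_variety \<alpha> \<subseteq> {l. Q (unit_rep l)}"
    unfolding toric_variety_def by (rule closure_minimal) (rule closed_cproj(1)[OF assms(1) inv])
  then show ?thesis using assms closed_cproj(2)[OF assms(1) inv] by blast
qed

section \<open>Polytopes at a vertex\<close>

lemma polytope_linear_max:
  fixes P :: "(real^'m) set"
  assumes "polytope P" "P \<noteq> {}"
  obtains v where "v extreme_point_of P" "\<And>x. x \<in> P \<Longrightarrow> c \<bullet> x \<le> c \<bullet> v"
proof -
  have comp: "compact P" "convex P"
    using assms polytope_imp_compact polytope_imp_convex by auto
  obtain y where y: "y \<in> P" "\<And>x. x \<in> P \<Longrightarrow> c \<bullet> x \<le> c \<bullet> y"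
    using continuous_attains_sup[OF comp(1) assms(2), of "\<lambda>x. c \<bullet> x"]
      continuous_on_inner[OF continuous_on_const continuous_on_id, of P c]
    by auto
  let ?F = "P \<inter> {x. c \<bullet> x = c \<bullet> y}"
  have F: "?F face_of P"
    by (rule face_of_Int_supporting_hyperplane_le) (use comp y in auto)
  have "compact ?F"
    using comp(1) by (intro compact_Int_closed closed_hyperplane)
  then obtain v where v: "v extreme_point_of ?F"
    using extreme_point_exists_convex[of ?F] y(1) F face_of_imp_convex by blast
  then have "v extreme_point_of P" "v \<in> ?F"
    using extreme_point_of_face[OF F] by auto
  then show thesis using y(2) that by fastforce
qed

text \<open>The convex cone generated by a finite set.\<close>

definition cone_of :: "(real^'m) set \<Rightarrow> (real^'m) set" where
  "cone_of T = {y. \<exists>c. (\<forall>w\<in>T. 0 \<le> c w) \<and> y = (\<Sum>w\<in>T. c w *\<^sub>R w)}"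

lemma cone_of_add:
  assumes "x \<in> cone_of T" "y \<in> cone_of T"
  shows "x + y \<in> cone_of T"
proof -
  obtain c d where "\<forall>w\<in>T. 0 \<le> c w" "x = (\<Sum>w\<in>T. c w *\<^sub>R w)"
      "\<forall>w\<in>T. 0 \<le> d w" "y = (\<Sum>w\<in>T. d w *\<^sub>R w)"
    using assms by (auto simp: cone_of_def)
  then show ?thesis unfolding cone_of_def
    by (intro CollectI exI[of _ "\<lambda>w. c w + d w"]) (auto simp: scaleR_add_left sum.distrib)
qed

lemma cone_of_scale:
  assumes "x \<in> cone_of T" "0 \<le> r"
  shows "r *\<^sub>R x \<in> cone_of T"
proof -
  obtain c where "\<forall>w\<in>T. 0 \<le> c w" "x = (\<Sum>w\<in>T. c w *\<^sub>R w)"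
    using assms by (auto simp: cone_of_def)
  then show ?thesis unfolding cone_of_def using assms(2)
    by (intro CollectI exI[of _ "\<lambda>w. r * c w"]) (auto simp: scaleR_sum_right)
qed

lemma cone_of_zero: "0 \<in> cone_of T"
  unfolding cone_of_def by (intro CollectI exI[of _ "\<lambda>w. 0"]) auto

lemma cone_of_sum:
  assumes "\<And>i. i \<in> A \<Longrightarrow> f i \<in> cone_of T"
  shows "sum f A \<in> cone_of T"
  using assms
  by (induction A rule: infinite_finite_induct)
    (auto intro: cone_of_add cone_of_zero)

lemma cone_of_trans:
  assumes "x \<in> cone_of S" "S \<subseteq> cone_of T"
  shows "x \<in> cone_of T"
proof -
  obtain c where "\<forall>w\<in>S. 0 \<le> c w" "x = (\<Sum>w\<in>S. c w *\<^sub>R w)"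
    using assms by (auto simp: cone_of_def)
  then show ?thesis
    using assms(2) by (auto intro!: cone_of_sum cone_of_scale)
qed

lemma cone_of_base:
  assumes "finite T" "x \<in> T" shows "x \<in> cone_of T"
  unfolding cone_of_def
  using assms by (intro CollectI exI[of _ "\<lambda>w. if w = x then 1 else 0"])
    (auto simp: if_distrib[of "\<lambda>r. r *\<^sub>R _"] sum.delta cong: if_cong)

text \<open>A polytope lies in the cone spanned by its edges at a vertex \<open>v\<close>. If \<open>P\<close> is the
  convex hull of a finite set, the differences of its points to \<open>v\<close> generate a cone containing
  \<open>P - v\<close>; let \<open>T\<close> be a generating subset of minimal
  cardinality. A functional \<open>g\<close> exposing \<open>v\<close> is negative on all generators. If two elements of the
  cone add up to a multiple of \<open>w \<in> T\<close>, then writing both in terms of \<open>T\<close> and isolating the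
  coefficient of \<open>w\<close> leaves two cases: either \<open>w\<close> is a combination of the other generators, against
  minimality, or a nonpositive multiple of \<open>w\<close> is such a combination and applying \<open>g\<close> kills all
  the other coefficients. Hence the ray of \<open>w\<close> is extreme, it cuts out a face of \<open>P\<close>, and this face
  is an edge.\<close>

lemma polytope_edge_cone:
  fixes P :: "(real^'m) set"
  assumes "polytope P" and v: "v extreme_point_of P"
  obtains T s where "finite T" "\<And>w. w \<in> T \<Longrightarrow> 0 < s w"
    "\<And>w. w \<in> T \<Longrightarrow> closed_segment v (v + s w *\<^sub>R w) edge_of P"
    "\<And>x. x \<in> P \<Longrightarrow> x - v \<in> cone_of T"
proof -
  have comp: "compact P" "convex P"
    using assms polytope_imp_compact polytope_imp_convex by auto
  obtain S where S: "finite S" "P = convex hull S"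
    using assms(1) by (auto simp: polytope_def)
  have vP: "v \<in> P" using v by (simp add: extreme_point_of_def)
  have "{v} face_of P" using v by (simp add: face_of_singleton)
  then have "{v} exposed_face_of P"
    using exposed_face_of_polyhedron assms(1) polytope_imp_polyhedron by blast
  then obtain g b where g: "P \<subseteq> {x. g \<bullet> x \<le> b}" "{v} = P \<inter> {x. g \<bullet> x = b}"
    by (auto simp: exposed_face_of_def)
  have gneg: "g \<bullet> (x - v) < 0" if "x \<in> P" "x \<noteq> v" for x
  proof -
    have "g \<bullet> v = b" "g \<bullet> x \<le> b" "g \<bullet> x \<noteq> b" using g that by blast+
    then show ?thesis by (simp add: inner_diff_right)
  qed
  define W where "W = (\<lambda>s. s - v) ` (S - {v})"
  have finW: "finite W" using S by (simp add: W_def)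
  have WP: "v + w \<in> P" "g \<bullet> w < 0" "w \<noteq> 0" if "w \<in> W" for w
    using that gneg S hull_inc[of _ S convex] by (auto simp: W_def)
  have PW: "x - v \<in> cone_of W" if xP: "x \<in> P" for x
  proof -
    obtain u where u: "\<forall>s\<in>S. 0 \<le> u s" "sum u S = 1" "(\<Sum>s\<in>S. u s *\<^sub>R s) = x"
      using xP S convex_hull_finite[OF S(1)] by auto
    have "x - v = (\<Sum>s\<in>S. u s *\<^sub>R s) - (\<Sum>s\<in>S. u s) *\<^sub>R v" using u by simp
    also have "\<dots> = (\<Sum>s\<in>S. u s *\<^sub>R (s - v))"
      by (simp add: scaleR_sum_left sum_subtractf scaleR_diff_right)
    also have "\<dots> \<in> cone_of W"
    proof (rule cone_of_sum)
      fix s assume "s \<in> S"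
      show "u s *\<^sub>R (s - v) \<in> cone_of W"
      proof (cases "s = v")
        case False
        then have "s - v \<in> cone_of W"
          using \<open>s \<in> S\<close> finW by (intro cone_of_base) (auto simp: W_def)
        then show ?thesis using u \<open>s \<in> S\<close> by (auto intro: cone_of_scale)
      qed (simp add: cone_of_zero)
    qed
    finally show ?thesis .
  qed
  define good where "good T \<longleftrightarrow> T \<subseteq> W \<and> W \<subseteq> cone_of T" for T
  have "good W" using finW cone_of_base by (auto simp: good_def)
  then obtain T where T: "good T" and min: "\<And>T'. good T' \<Longrightarrow> card T \<le> card T'"
    using ex_has_least_nat[of good W card] by blast
  have TW: "T \<subseteq> W" and finT: "finite T" using T finW finite_subset by (auto simp: good_def)
  have PT: "x - v \<in> cone_of T" if "x \<in> P" for x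
    using cone_of_trans[OF PW[OF that]] T by (auto simp: good_def)
  have extreme_ray: "\<exists>m\<ge>0. y = m *\<^sub>R w"
    if w: "w \<in> T" and y: "y \<in> cone_of T" "y' \<in> cone_of T"
      and sum: "y + y' = l *\<^sub>R w" for w y y' l
  proof -
    obtain a where a: "\<forall>w\<in>T. 0 \<le> a w" "y = (\<Sum>w\<in>T. a w *\<^sub>R w)"
      using y(1) by (auto simp: cone_of_def)
    obtain a' where a': "\<forall>w\<in>T. 0 \<le> a' w" "y' = (\<Sum>w\<in>T. a' w *\<^sub>R w)"
      using y(2) by (auto simp: cone_of_def)
    define d where "d = l - a w - a' w"
    have yw: "y = a w *\<^sub>R w + (\<Sum>i\<in>T-{w}. a i *\<^sub>R i)"
      unfolding a(2) using w finT by (simp add: sum.remove)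
    have yw': "y' = a' w *\<^sub>R w + (\<Sum>i\<in>T-{w}. a' i *\<^sub>R i)"
      unfolding a'(2) using w finT by (simp add: sum.remove)
    have d: "d *\<^sub>R w = (\<Sum>i\<in>T-{w}. (a i + a' i) *\<^sub>R i)"
      using sum unfolding yw yw' d_def
      by (simp add: algebra_simps sum.distrib)
    have "d \<le> 0"
    proof (rule ccontr)
      assume "\<not> d \<le> 0"
      then have dp: "0 < d" by simp
      let ?T = "T - {w}"
      have "d *\<^sub>R w \<in> cone_of ?T"
        unfolding d cone_of_def using a(1) a'(1)
        by (intro CollectI exI[of _ "\<lambda>i. a i + a' i"]) auto
      from cone_of_scale[OF this, of "1/d"]
      have "(1/d) *\<^sub>R (d *\<^sub>R w) \<in> cone_of ?T" using dp by simp
      moreover have "(1/d) *\<^sub>R (d *\<^sub>R w) = w" using dp by simp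
      ultimately have "w \<in> cone_of ?T" by metis
      then have "T \<subseteq> cone_of ?T"
        using cone_of_base[of ?T] finT by auto
      then have "good ?T"
        using T cone_of_trans unfolding good_def by blast
      then have "card T \<le> card ?T" by (rule min)
      moreover have "card ?T < card T" using w finT by (intro card_Diff1_less)
      ultimately show False by simp
    qed
    have "d * (g \<bullet> w) = (\<Sum>i\<in>T-{w}. (a i + a' i) * (g \<bullet> i))"
      using arg_cong[OF d, of "\<lambda>x. g \<bullet> x"] by (simp add: inner_sum_right)
    moreover have "0 \<le> d * (g \<bullet> w)"
      using \<open>d \<le> 0\<close> WP(2) w TW by (intro mult_nonpos_nonpos) (auto simp: less_imp_le)
    moreover have nonpos: "(a i + a' i) * (g \<bullet> i) \<le> 0" if "i \<in> T - {w}" for i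
      using that a a' WP(2) TW by (intro mult_nonneg_nonpos) (auto simp: less_imp_le subset_eq)
    moreover have "(\<Sum>i\<in>T-{w}. (a i + a' i) * (g \<bullet> i)) \<le> 0"
      using nonpos by (rule sum_nonpos)
    ultimately have "(\<Sum>i\<in>T-{w}. - ((a i + a' i) * (g \<bullet> i))) = 0"
      by (simp add: sum_negf)
    then have "\<forall>i\<in>T-{w}. - ((a i + a' i) * (g \<bullet> i)) = 0"
      using finT nonpos by (subst (asm) sum_nonneg_eq_0_iff) auto
    then have "\<forall>i\<in>T-{w}. a i + a' i = 0"
      using WP(2) TW by fastforce
    then have "\<forall>i\<in>T-{w}. a i = 0"
      using a a' by (metis DiffD1 add_nonneg_eq_0_iff)
    then have "y = a w *\<^sub>R w" unfolding yw by simp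
    then show ?thesis using a w by auto
  qed
  have "\<exists>s>0. closed_segment v (v + s *\<^sub>R w) edge_of P" if w: "w \<in> T" for w
  proof -
    have wW: "w \<in> W" using w TW by auto
    \<comment> \<open>the far end of the edge is the last point of the ray that belongs to \<open>P\<close>\<close>
    define J where "J = {t. 0 \<le> t \<and> v + t *\<^sub>R w \<in> P}"
    have "1 \<in> J" using WP(1)[OF wW] by (simp add: J_def)
    have "closed J"
    proof -
      have "closed ((\<lambda>t. v + t *\<^sub>R w) -` P)"
        using comp(1) compact_imp_closed by (intro continuous_closed_vimage) (auto intro!: continuous_intros)
      moreover have "J = {0..} \<inter> (\<lambda>t. v + t *\<^sub>R w) -` P" by (auto simp: J_def)
      ultimately show ?thesis by auto
    qed
    moreover have "bounded J"
    proof -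
      obtain B where B: "\<And>x. x \<in> P \<Longrightarrow> norm x \<le> B"
        using compact_imp_bounded[OF comp(1)] by (auto simp: bounded_iff)
      have "norm t \<le> (B + norm v) / norm w" if "t \<in> J" for t
      proof -
        have "norm (t *\<^sub>R w) \<le> norm (v + t *\<^sub>R w) + norm v"
          by (metis add_diff_cancel_left' norm_triangle_ineq4)
        also have "\<dots> \<le> B + norm v" using B that by (auto simp: J_def)
        finally show ?thesis using WP(3)[OF wW] by (simp add: field_simps)
      qed
      then show ?thesis by (auto simp: bounded_iff)
    qed
    ultimately have "compact J" by (simp add: compact_eq_bounded_closed)
    then obtain s where s: "s \<in> J" "\<And>t. t \<in> J \<Longrightarrow> t \<le> s"
      using compact_attains_sup[of J] \<open>1 \<in> J\<close> by auto
    have "1 \<le> s" using s(2) \<open>1 \<in> J\<close> by auto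
    let ?e = "closed_segment v (v + s *\<^sub>R w)"
    have eP: "?e \<subseteq> P"
      using s(1) vP comp(2) by (intro closed_segment_subset) (auto simp: J_def)
    have mem_e: "v + t *\<^sub>R w \<in> ?e" if "t \<in> J" for t
    proof -
      have "v + t *\<^sub>R w = (1 - t/s) *\<^sub>R v + (t/s) *\<^sub>R (v + s *\<^sub>R w)"
        using \<open>1 \<le> s\<close> by (simp add: algebra_simps)
      moreover have "0 \<le> t/s" "t/s \<le> 1" using s(2)[OF that] that \<open>1 \<le> s\<close> by (auto simp: J_def)
      ultimately show ?thesis unfolding closed_segment_def by blast
    qed
    have face: "?e face_of P"
      unfolding face_of_def
    proof (intro conjI ballI impI)
      fix x y z assume xy: "x \<in> P" "y \<in> P" and z: "z \<in> ?e" and "z \<in> open_segment x y"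
      then obtain t where t: "0 < t" "t < 1" "z = (1 - t) *\<^sub>R x + t *\<^sub>R y"
        by (auto simp: in_segment)
      obtain r where r: "0 \<le> r" "z = v + (r * s) *\<^sub>R w"
        using z by (auto simp: in_segment algebra_simps)
      have eq: "(1 - t) *\<^sub>R (x - v) + t *\<^sub>R (y - v) = (r * s) *\<^sub>R w"
        using t(3) r(2) by (simp add: algebra_simps)
      have nx: "(1 - t) *\<^sub>R (x - v) \<in> cone_of T"
        using cone_of_scale[OF PT[OF xy(1)], of "1 - t"] t by simp
      have ny: "t *\<^sub>R (y - v) \<in> cone_of T"
        using cone_of_scale[OF PT[OF xy(2)], of t] t by simp
      obtain m where m: "0 \<le> m" "(1 - t) *\<^sub>R (x - v) = m *\<^sub>R w"
        using extreme_ray[OF w nx ny eq] by auto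
      obtain m' where m': "0 \<le> m'" "t *\<^sub>R (y - v) = m' *\<^sub>R w"
        using extreme_ray[OF w ny nx] eq by (metis add.commute)
      have "x - v = (1/(1-t)) *\<^sub>R ((1 - t) *\<^sub>R (x - v))" using t by simp
      then have x: "x = v + (m/(1-t)) *\<^sub>R w" unfolding m(2) by (simp add: algebra_simps)
      have "y - v = (1/t) *\<^sub>R (t *\<^sub>R (y - v))" using t by simp
      then have y: "y = v + (m'/t) *\<^sub>R w" unfolding m'(2) by (simp add: algebra_simps)
      show "x \<in> ?e" using xy(1) t m(1) unfolding x by (intro mem_e) (simp add: J_def)
      show "y \<in> ?e" using xy(2) t m'(1) unfolding y by (intro mem_e) (simp add: J_def)
    qed (use eP in auto)
    have "aff_dim ?e = 1"
      using WP(3)[OF wW] \<open>1 \<le> s\<close> by (simp add: segment_convex_hull aff_dim_convex_hull aff_dim_2)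
    then have "?e edge_of P" using face by (simp add: edge_of_def)
    then show ?thesis using \<open>1 \<le> s\<close> by (intro exI[of _ s]) auto
  qed
  then obtain s where "\<forall>w\<in>T. 0 < s w \<and> closed_segment v (v + s w *\<^sub>R w) edge_of P"
    by metis
  then show thesis using that[of T s] finT PT by auto
qed


section \<open>The lattice frame at a vertex of a Delzant polytope\<close>

lemma of_ivec_add: "of_ivec (a + b) = of_ivec a + of_ivec b"
  by (simp add: of_ivec_def vec_eq_iff)

lemma of_ivec_diff: "of_ivec (a - b) = of_ivec a - of_ivec b"
  by (simp add: of_ivec_def vec_eq_iff)

lemma of_ivec_scale: "of_ivec (c *s a) = real_of_int c *\<^sub>R of_ivec a"
  by (simp add: of_ivec_def vec_eq_iff)

lemma of_ivec_sum: "of_ivec (\<Sum>i\<in>A. f i) = (\<Sum>i\<in>A. of_ivec (f i))"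
  by (induction A rule: infinite_finite_induct)
    (auto simp: of_ivec_add, auto simp: of_ivec_def vec_eq_iff)

lemma of_ivec_inject [simp]: "of_ivec a = of_ivec b \<longleftrightarrow> a = b"
  by (simp add: of_ivec_def vec_eq_iff)

text \<open>The factor is rational; its denominator divides every entry of \<open>u\<close>, hence is \<open>1\<close>.\<close>

lemma primitive_multiple_integral:
  fixes u t :: "int^'m"
  assumes "Gcd (range (\<lambda>i. u $ i)) = 1" "0 < l" "l *\<^sub>R of_ivec u = of_ivec t"
  obtains n :: nat where "1 \<le> n" "l = real n"
proof -
  have lu: "l * of_int (u $ i) = of_int (t $ i)" for i
    using arg_cong[OF assms(3), of "\<lambda>x. x $ i"] by (simp add: of_ivec_def)
  have "\<exists>i. u $ i \<noteq> 0"
  proof (rule ccontr)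
    assume "\<not> ?thesis"
    then have "range (\<lambda>i. u $ i) = {0}" by auto
    then show False using assms(1) by simp
  qed
  then obtain i where "u $ i \<noteq> 0" by auto
  then have "l = of_int (t $ i) / of_int (u $ i)" using lu[of i] by (simp add: field_simps)
  then have "l \<in> \<rat>" by simp
  then obtain p q where pq: "0 < q" "coprime p q" "l = of_int p / of_int q"
    by (rule Rats_cases')
  have "q dvd u $ i" for i
  proof -
    have "of_int (p * u $ i) = (of_int (q * t $ i) :: real)"
      using lu[of i] pq by (simp add: field_simps)
    then have "p * u $ i = q * t $ i" by (simp only: of_int_eq_iff)
    then have "q dvd p * u $ i" by simp
    then show ?thesis using pq(2) by (simp add: coprime_dvd_mult_right_iff coprime_commute)
  qed
  then have "q dvd Gcd (range (\<lambda>i. u $ i))" by (auto intro: Gcd_greatest)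
  then have "q = 1" using assms(1) pq(1) by simp
  then have "l = of_int p" "0 < p" using pq assms(2) by auto
  then show thesis using that[of "nat p"] by simp
qed

text \<open>A Delzant vertex \<open>\<alpha> kv\<close> as seen by the lattice: \<open>u\<close> are the primitive edge directions, and
  \<open>n a\<close> are the coordinates of \<open>a\<close> in the basis \<open>u\<close>. That the exponents have nonnegative
  coordinates relative to the vertex makes the affine chart at the vertex polynomial; that each edge
  carries an exponent at lattice distance one from the vertex makes the chart coordinates ratios of
  homogeneous coordinates.\<close>

locale vertex_frame =
  fixes \<alpha> :: "'k::finite \<Rightarrow> int^'m" and kv :: 'k
    and u :: "'m \<Rightarrow> int^'m" and n :: "int^'m \<Rightarrow> int^'m"
  assumes inj_\<alpha>: "inj \<alpha>"
    and n_add: "n (a + b) = n a + n b"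
    and n_coordinates: "a = (\<Sum>j\<in>UNIV. n a $ j *s u j)"
    and n_basis: "n (u j) = axis j 1"
    and n_nonneg: "0 \<le> n (\<alpha> k - \<alpha> kv) $ j"
    and edge_neighbour: "\<exists>k. \<alpha> k = \<alpha> kv + u j"

text \<open>The edge directions number exactly \<open>CARD('m)\<close>: they inject into the edges at \<open>v\<close>, and they span.
  An edge has integral ends, so its lattice length is a positive integer and \<open>v + u\<close> is on it.
  For the sign of the coordinates, the coordinate functional \<open>c j\<close> is nonnegative on every edge, hence
  on the cone of edges, which contains the polytope.\<close>

lemma delzant_vertex_frame:
  fixes P :: "(real^'m) set" and \<alpha> :: "'k::finite \<Rightarrow> int^'m"
  assumes delzant: "delzant_polytope P" and enum: "bij_betw \<alpha> UNIV (lattice_points P)"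
    and v: "v extreme_point_of P"
  obtains kv u n where "v = of_ivec (\<alpha> kv)" "vertex_frame \<alpha> kv u n"
proof -
  have poly: "polytope P" and cardE: "card (edges_at P v) = CARD('m)"
    and basis: "is_Z_basis (edge_directions P v)"
    and vint: "\<And>x. x extreme_point_of P \<Longrightarrow> x \<in> range of_ivec"
    using delzant v by (auto simp: delzant_polytope_def)
  interpret Z: module "(*s) :: int \<Rightarrow> int^'m \<Rightarrow> int^'m"
    by unfold_locales (auto simp: vec_eq_iff algebra_simps)
  let ?B = "edge_directions P v"
  have ind: "Z.independent ?B" and span: "Z.span ?B = UNIV"
    using basis by (auto simp: is_Z_basis_def)
  have vP: "v \<in> P" using v by (simp add: extreme_point_of_def)
  obtain v0 where v0: "v = of_ivec v0" using vint[OF v] by auto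
  have \<alpha>P: "of_ivec (\<alpha> k) \<in> P" for k
  proof -
    have "\<alpha> k \<in> lattice_points P" using enum by (metis bij_betw_def rangeI)
    then show ?thesis by (simp add: lattice_points_def)
  qed
  have \<alpha>ex: "\<exists>k. \<alpha> k = a" if "of_ivec a \<in> P" for a
  proof -
    have "a \<in> range \<alpha>" using that enum by (simp add: bij_betw_def lattice_points_def)
    then show ?thesis by blast
  qed
  obtain kv where kv: "\<alpha> kv = v0" using \<alpha>ex[of v0] v0 vP by auto
  have edge_end: "w \<in> range of_ivec" if "closed_segment v w edge_of P" for w
  proof -
    have "closed_segment v w face_of P" using that by (simp add: edge_of_def)
    moreover have "w extreme_point_of closed_segment v w"
      by (simp add: extreme_point_of_segment)
    ultimately have "w extreme_point_of P" using extreme_point_of_face by blast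
    then show ?thesis by (rule vint)
  qed
  have dir: "\<exists>l\<ge>1::nat. closed_segment v (v + real l *\<^sub>R of_ivec u) \<in> edges_at P v"
    if uB: "u \<in> ?B" for u
  proof -
    obtain e l where e: "Gcd (range (\<lambda>i. u $ i)) = 1" "e \<in> edges_at P v" "0 < l"
        "e = closed_segment v (v + l *\<^sub>R of_ivec u)"
      using uB by (auto simp: edge_directions_def)
    then have "closed_segment v (v + l *\<^sub>R of_ivec u) edge_of P" by (simp add: edges_at_def)
    then obtain t where "v + l *\<^sub>R of_ivec u = of_ivec t" using edge_end by blast
    then have "l *\<^sub>R of_ivec u = of_ivec (t - v0)"
      unfolding of_ivec_diff v0 by (simp add: algebra_simps)
    then obtain m :: nat where "1 \<le> m" "l = real m"
      using primitive_multiple_integral[OF e(1) e(3)] by metis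
    then show ?thesis using e by blast
  qed
  then obtain l :: "int^'m \<Rightarrow> nat" where l: "\<And>u. u \<in> ?B \<Longrightarrow> 1 \<le> l u"
      "\<And>u. u \<in> ?B \<Longrightarrow> closed_segment v (v + real (l u) *\<^sub>R of_ivec u) \<in> edges_at P v"
    by metis
  have uP: "v + of_ivec u \<in> P" if "u \<in> ?B" for u
  proof -
    have "closed_segment v (v + real (l u) *\<^sub>R of_ivec u) \<subseteq> P"
      using l(2)[OF that] by (auto simp: edges_at_def edge_of_def dest: face_of_imp_subset)
    moreover have "v + of_ivec u \<in> closed_segment v (v + real (l u) *\<^sub>R of_ivec u)"
      unfolding closed_segment_def using l(1)[OF that]
      by (intro CollectI exI[of _ "1 / real (l u)"]) (auto simp: algebra_simps)
    ultimately show ?thesis by blast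
  qed
  have inj: "inj_on (\<lambda>u. closed_segment v (v + real (l u) *\<^sub>R of_ivec u)) ?B"
  proof (rule inj_onI)
    fix a b assume ab: "a \<in> ?B" "b \<in> ?B"
      and "closed_segment v (v + real (l a) *\<^sub>R of_ivec a) = closed_segment v (v + real (l b) *\<^sub>R of_ivec b)"
    then have "v + real (l a) *\<^sub>R of_ivec a = v + real (l b) *\<^sub>R of_ivec b"
      by (auto simp: closed_segment_eq doubleton_eq_iff)
    then have "of_ivec (int (l a) *s a) = of_ivec (int (l b) *s b)"
      by (simp add: of_ivec_scale)
    then have eq: "int (l a) *s a = int (l b) *s b" by (simp only: of_ivec_inject)
    have G: "Gcd (range (\<lambda>i. (int (l c) *s c) $ i)) = int (l c)" if "c \<in> ?B" for c
    proof -
      have "range (\<lambda>i. (int (l c) *s c) $ i) = (*) (int (l c)) ` range (\<lambda>i. c $ i)" by auto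
      moreover have "Gcd (range (\<lambda>i. c $ i)) = 1" using that by (simp add: edge_directions_def)
      ultimately show ?thesis by (simp only: Gcd_mult) simp
    qed
    have "l a = l b" using G[OF ab(1)] G[OF ab(2)] eq by simp
    then show "a = b" using eq l(1)[OF ab(1)] by (simp add: vec_eq_iff)
  qed
  have finE: "finite (edges_at P v)" using cardE by (intro card_ge_0_finite) simp
  have im: "(\<lambda>u. closed_segment v (v + real (l u) *\<^sub>R of_ivec u)) ` ?B \<subseteq> edges_at P v"
    using l(2) by blast
  have finB: "finite ?B" using inj im finE by (meson finite_imageD finite_subset)
  have le: "card ?B \<le> CARD('m)"
    using card_inj_on_le[OF inj im finE] cardE by simp
  have "CARD('m) \<le> card ?B"
  proof -
    have in_span: "of_ivec a \<in> Real_Vector_Spaces.span (of_ivec ` ?B)" for a :: "int^'m"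
    proof -
      have "a = (\<Sum>b\<in>?B. Z.representation ?B a b *s b)"
        using Z.sum_representation_eq[OF ind, of a ?B] span finB by simp
      then have "of_ivec a = (\<Sum>b\<in>?B. real_of_int (Z.representation ?B a b) *\<^sub>R of_ivec b)"
        by (metis (no_types, lifting) of_ivec_scale of_ivec_sum sum.cong)
      moreover have "\<dots> \<in> Real_Vector_Spaces.span (of_ivec ` ?B)"
        by (intro span_sum span_scale) (auto intro: span_base)
      ultimately show ?thesis by simp
    qed
    have "x \<in> Real_Vector_Spaces.span (of_ivec ` ?B)" for x :: "real^'m"
    proof -
      have "x = (\<Sum>i\<in>UNIV. (x $ i) *\<^sub>R of_ivec (axis i 1))"
        by (simp add: vec_eq_iff of_ivec_def axis_def if_distrib[of real_of_int]
            if_distrib[of "\<lambda>y. _ * y"] sum.delta cong: if_cong)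
      then show ?thesis using in_span by (metis (no_types, lifting) span_scale span_sum)
    qed
    then have "UNIV \<subseteq> Real_Vector_Spaces.span (of_ivec ` ?B)" by auto
    then have "dim (UNIV :: (real^'m) set) \<le> card (of_ivec ` ?B)"
      using finB by (intro dim_le_card) auto
    also have "\<dots> \<le> card ?B" using finB by (rule card_image_le)
    finally show ?thesis by simp
  qed
  then have "card ?B = CARD('m)" using le by simp
  then obtain u :: "'m \<Rightarrow> int^'m" where u: "bij_betw u UNIV ?B"
    using finite_same_card_bij[of "UNIV :: 'm set" ?B] finB by auto
  then have uB: "u j \<in> ?B" for j by (auto simp: bij_betw_def)
  define n where "n a = (\<chi> j. Z.representation ?B a (u j))" for a
  have n_add: "n (a + b) = n a + n b" for a b
    by (simp add: n_def vec_eq_iff Z.representation_add[OF ind] span)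
  have n_coord: "a = (\<Sum>j\<in>UNIV. n a $ j *s u j)" for a
  proof -
    have "(\<Sum>j\<in>UNIV. n a $ j *s u j) = (\<Sum>b\<in>?B. Z.representation ?B a b *s b)"
      unfolding n_def by (simp add: sum.reindex_bij_betw[OF u, of "\<lambda>b. Z.representation ?B a b *s b"])
    then show ?thesis
      using Z.sum_representation_eq[OF ind, of a ?B] span finB by simp
  qed
  have n_basis: "n (u j) = axis j 1" for j
    using u by (auto simp: n_def vec_eq_iff Z.representation_basis[OF ind uB] axis_def bij_betw_def inj_def)
  have n_zero: "n 0 = 0" using n_add[of 0 0] by simp
  have n_scale: "n (c *s a) = c *s n a" for c a
    by (simp add: n_def vec_eq_iff Z.representation_scale[OF ind] span)
  have n_sum: "n (sum f A) = (\<Sum>i\<in>A. n (f i))" for f :: "'m \<Rightarrow> int^'m" and A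
    by (induction A rule: infinite_finite_induct) (auto simp: n_zero n_add)
  \<comment> \<open>the real-linear extension of the coordinates, as an inner product\<close>
  define c where "c j = (\<chi> i. real_of_int (n (axis i 1) $ j))" for j
  have c: "c j \<bullet> of_ivec a = real_of_int (n a $ j)" for j a
  proof -
    have "a = (\<Sum>i\<in>UNIV. a $ i *s axis i 1)"
      by (simp add: vec_eq_iff axis_def if_distrib[of "\<lambda>y. _ * y"] sum.delta cong: if_cong)
    then have "n a = (\<Sum>i\<in>UNIV. a $ i *s n (axis i 1))"
      by (metis (no_types, lifting) n_scale n_sum sum.cong)
    then show ?thesis
      by (simp add: c_def of_ivec_def inner_vec_def mult.commute)
  qed
  obtain T s where T: "finite T" "\<And>w. w \<in> T \<Longrightarrow> 0 < s w"
      "\<And>w. w \<in> T \<Longrightarrow> closed_segment v (v + s w *\<^sub>R w) edge_of P"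
      "\<And>x. x \<in> P \<Longrightarrow> x - v \<in> cone_of T"
    using polytope_edge_cone[OF poly v] by blast
  have cT: "0 \<le> c j \<bullet> w" if w: "w \<in> T" for w j
  proof -
    obtain t0 where t0: "v + s w *\<^sub>R w = of_ivec t0" using edge_end[OF T(3)[OF w]] by auto
    define t where "t = t0 - v0"
    have t: "s w *\<^sub>R w = of_ivec t"
      using t0 unfolding t_def of_ivec_diff v0 by (simp add: algebra_simps)
    define d where "d = Gcd (range (\<lambda>i. t $ i))"
    have "\<exists>i. t $ i \<noteq> 0"
    proof (rule ccontr)
      assume "\<not> ?thesis"
      then have "of_ivec t = 0" by (simp add: of_ivec_def vec_eq_iff)
      then have "s w *\<^sub>R w = 0" using t by (simp only:)
      then have "closed_segment v (v + s w *\<^sub>R w) = {v}" by (simp only: add_0_right closed_segment_idem)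
      then show False using T(3)[OF w] by (simp add: edge_of_def)
    qed
    then have "d \<noteq> 0" unfolding d_def by (auto simp: Gcd_0_iff)
    then have dpos: "0 < d" unfolding d_def by (metis Gcd_int_greater_eq_0 order_le_less)
    have dt: "d dvd t $ i" for i unfolding d_def by (auto intro: Gcd_dvd)
    define p where "p = (\<chi> i. t $ i div d)"
    have tp: "t = d *s p" using dt by (simp add: p_def vec_eq_iff)
    have "Gcd (range (\<lambda>i. p $ i)) = 1"
    proof -
      have "range (\<lambda>i. t $ i) = (*) d ` range (\<lambda>i. p $ i)" unfolding tp by auto
      then have "d = normalize (d * Gcd (range (\<lambda>i. p $ i)))"
        by (metis Gcd_mult d_def)
      then have "d = d * Gcd (range (\<lambda>i. p $ i))"
        using dpos by (simp add: abs_mult Gcd_int_greater_eq_0)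
      then show ?thesis using dpos by simp
    qed
    moreover have "closed_segment v (v + s w *\<^sub>R w) \<in> edges_at P v"
      using T(3)[OF w] by (simp add: edges_at_def)
    moreover have "s w *\<^sub>R w = real_of_int d *\<^sub>R of_ivec p" using t tp of_ivec_scale by metis
    ultimately have "p \<in> ?B" unfolding edge_directions_def using dpos
      by (intro CollectI conjI bexI[of _ "closed_segment v (v + s w *\<^sub>R w)"] exI[of _ "real_of_int d"]) auto
    then obtain i where i: "p = u i" using u by (auto simp: bij_betw_def)
    have "s w * (c j \<bullet> w) = c j \<bullet> (s w *\<^sub>R w)" by simp
    also have "\<dots> = d * n p $ j" unfolding t by (simp add: c tp n_scale)
    also have "\<dots> \<ge> 0" unfolding i n_basis using dpos by (simp add: axis_def)
    finally show ?thesis using T(2)[OF w] by (simp add: zero_le_mult_iff)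
  qed
  have n_nonneg: "0 \<le> n (\<alpha> k - \<alpha> kv) $ j" for k j
  proof -
    have "of_ivec (\<alpha> k) - v \<in> cone_of T" by (rule T(4)[OF \<alpha>P])
    then obtain r where r: "\<forall>w\<in>T. 0 \<le> r w" "of_ivec (\<alpha> k) - v = (\<Sum>w\<in>T. r w *\<^sub>R w)"
      by (auto simp: cone_of_def)
    have "real_of_int (n (\<alpha> k - \<alpha> kv) $ j) = c j \<bullet> (of_ivec (\<alpha> k) - v)"
      unfolding c[symmetric] kv v0 of_ivec_diff by simp
    also have "\<dots> = (\<Sum>w\<in>T. r w * (c j \<bullet> w))" unfolding r(2) by (simp add: inner_sum_right)
    also have "\<dots> \<ge> 0" using r(1) cT by (auto intro!: sum_nonneg)
    finally show ?thesis by simp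
  qed
  have "vertex_frame \<alpha> kv u n"
  proof
    show "\<exists>k. \<alpha> k = \<alpha> kv + u j" for j
      using \<alpha>ex[of "\<alpha> kv + u j"] uP[OF uB] kv v0 by (simp add: of_ivec_add)
    show "inj \<alpha>" using enum by (simp add: bij_betw_def)
  qed (fact n_add n_coord n_basis n_nonneg)+
  then show thesis by (rule that[rotated]) (simp only: v0 kv)
qed

section \<open>Holomorphic functions of several variables\<close>

lemma has_derivative_vec_lambda:
  fixes f :: "'k::finite \<Rightarrow> 'a::real_normed_vector \<Rightarrow> 'b::euclidean_space"
  assumes "\<And>k. (f k has_derivative D k) (at x)"
  shows "((\<lambda>x. \<chi> k. f k x) has_derivative (\<lambda>h. \<chi> k. D k h)) (at x)"
  using assms by (subst has_derivative_componentwise_within)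
    (auto simp: Basis_vec_def inner_axis intro: has_derivative_inner_left)

lemma has_derivative_vec_nth:
  "(f has_derivative D) F \<Longrightarrow> ((\<lambda>x. f x $ k) has_derivative (\<lambda>h. D h $ k)) F"
  by (rule bounded_linear.has_derivative[OF bounded_linear_vec_nth])

lemma holo_onI:
  assumes "\<And>w. w \<in> U \<Longrightarrow> (f has_derivative D w) (at w)"
    and "\<And>w c v. w \<in> U \<Longrightarrow> D w (c *s v) = c * D w v"
  shows "holo_on f U"
  unfolding holo_on_def using assms by blast

lemma holo_on_const: "holo_on (\<lambda>w. c) U"
  by (rule holo_onI[where D="\<lambda>w h. 0"]) auto

lemma holo_on_coord: "holo_on (\<lambda>w. w $ j) U"
  by (rule holo_onI[where D="\<lambda>w h. h $ j"])
    (auto intro!: has_derivative_vec_nth derivative_eq_intros)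

lemma holo_on_add:
  assumes "holo_on f U" "holo_on g U" shows "holo_on (\<lambda>w. f w + g w) U"
  unfolding holo_on_def
proof
  fix w assume "w \<in> U"
  then obtain D E where "(f has_derivative D) (at w)" "\<forall>c v. D (c *s v) = c * D v"
      "(g has_derivative E) (at w)" "\<forall>c v. E (c *s v) = c * E v"
    using assms unfolding holo_on_def by meson
  then show "\<exists>D. ((\<lambda>w. f w + g w) has_derivative D) (at w) \<and> (\<forall>c v. D (c *s v) = c * D v)"
    by (intro exI[of _ "\<lambda>h. D h + E h"] conjI) (auto intro: has_derivative_add simp: algebra_simps)
qed

lemma holo_on_mult:
  assumes "holo_on f U" "holo_on g U" shows "holo_on (\<lambda>w. f w * g w) U"
  unfolding holo_on_def
proof
  fix w assume "w \<in> U"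
  then obtain D E where "(f has_derivative D) (at w)" "\<forall>c v. D (c *s v) = c * D v"
      "(g has_derivative E) (at w)" "\<forall>c v. E (c *s v) = c * E v"
    using assms unfolding holo_on_def by meson
  then show "\<exists>D. ((\<lambda>w. f w * g w) has_derivative D) (at w) \<and> (\<forall>c v. D (c *s v) = c * D v)"
    by (intro exI[of _ "\<lambda>h. f w * E h + D h * g w"] conjI)
      (rule has_derivative_mult, assumption+, simp add: algebra_simps)
qed

lemma holo_on_power: "holo_on f U \<Longrightarrow> holo_on (\<lambda>w. f w ^ p) U"
  by (induction p) (auto intro: holo_on_const holo_on_mult)

lemma holo_on_prod: "(\<And>i. i \<in> A \<Longrightarrow> holo_on (f i) U) \<Longrightarrow> holo_on (\<lambda>w. \<Prod>i\<in>A. f i w) U"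
  by (induction A rule: infinite_finite_induct) (auto intro: holo_on_const holo_on_mult)

lemma holo_on_sum: "(\<And>i. i \<in> A \<Longrightarrow> holo_on (f i) U) \<Longrightarrow> holo_on (\<lambda>w. \<Sum>i\<in>A. f i w) U"
  by (induction A rule: infinite_finite_induct) (auto intro: holo_on_const holo_on_add)

lemma holo_on_prod_list: "(\<And>i. i \<in> set is \<Longrightarrow> holo_on (f i) U) \<Longrightarrow> holo_on (\<lambda>w. \<Prod>i\<leftarrow>is. f i w) U"
  by (induction "is") (auto intro: holo_on_const holo_on_mult)

lemma holo_on_imp_continuous_on: "holo_on f U \<Longrightarrow> continuous_on U f"
  unfolding holo_on_def
  by (meson continuous_at_imp_continuous_on has_derivative_continuous)

lemma negligible_compl_torus: "negligible (- torus :: (complex^'m) set)"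
proof -
  have "- torus \<subseteq> (\<Union>i\<in>UNIV. {w :: complex^'m. axis i 1 \<bullet> w = 0})"
    by (auto simp: torus_def inner_axis' complex_eq_iff inner_complex_def)
  moreover have "negligible (\<Union>i\<in>UNIV. {w :: complex^'m. axis i 1 \<bullet> w = 0})"
    by (rule negligible_Union) (auto simp: axis_eq_0_iff intro!: negligible_hyperplane)
  ultimately show ?thesis by (rule negligible_subset[rotated])
qed

lemma closure_torus: "closure torus = (UNIV :: (complex^'m) set)"
proof -
  have "interior (- torus) = ({} :: (complex^'m) set)"
    using open_not_negligible[OF open_interior] negligible_compl_torus negligible_subset interior_subset
    by metis
  then show ?thesis by (simp add: closure_interior)
qed

section \<open>The affine chart at a vertex\<close>

context vertex_frame
begin

lemma n_zero [simp]: "n 0 = 0" using n_add[of 0 0] by simp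

lemma n_minus: "n (- a) = - n a"
  using n_add[of a "- a"] by (simp add: eq_neg_iff_add_eq_0 add.commute)

lemma n_diff: "n (a - b) = n a - n b"
  using n_add[of a "- b"] by (simp add: n_minus)

lemma n_sum: "n (sum f A) = (\<Sum>i\<in>A. n (f i))"
  by (induction A rule: infinite_finite_induct) (auto simp: n_add)

lemma n_scale: "n (c *s a) = c *s n a"
proof -
  have *: "n (int p *s a) = int p *s n a" for p a
  proof (induction p)
    case (Suc p)
    have "int (Suc p) *s a = a + int p *s a" by (simp add: vec_eq_iff algebra_simps)
    then show ?case using Suc n_add by (simp add: vec_eq_iff algebra_simps)
  qed (simp_all add: vec_eq_iff)
  show ?thesis
  proof (cases "0 \<le> c")
    case True then show ?thesis using *[of "nat c" a] by simp
  next
    case False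
    have "(- c) *s a = - (c *s a)" for a :: "int^'m" by (simp add: vec_eq_iff)
    then show ?thesis using *[of "nat (- c)" a] False n_minus[of "c *s a"] by simp
  qed
qed

lemma n_inject: "n a = n b \<longleftrightarrow> a = b"
  using n_coordinates[of a] n_coordinates[of b] by metis

text \<open>The coordinates \<open>w j\<close> of the affine chart at the vertex are the monomials with exponents \<open>u j\<close>. In
  these coordinates the homogeneous coordinates divided by the one of the vertex are monomials with
  the exponents \<open>expo k\<close>, and the quotient belonging to \<open>nbr j\<close> is \<open>w j\<close> itself.\<close>

definition expo :: "'k \<Rightarrow> 'm \<Rightarrow> nat" where
  "expo k j = nat (n (\<alpha> k - \<alpha> kv) $ j)"

definition nbr :: "'m \<Rightarrow> 'k" where
  "nbr j = (SOME k. \<alpha> k = \<alpha> kv + u j)"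

definition chart :: "complex^'m \<Rightarrow> complex^'k" where
  "chart w = (\<chi> k. \<Prod>j\<in>UNIV. (w $ j) ^ expo k j)"

definition to_chart :: "complex^'m \<Rightarrow> complex^'m" where
  "to_chart z = (\<chi> j. cmonom z (u j))"

definition from_chart :: "complex^'m \<Rightarrow> complex^'m" where
  "from_chart w = (\<chi> i. cmonom w (n (axis i 1)))"

lemma \<alpha>_nbr: "\<alpha> (nbr j) = \<alpha> kv + u j"
  unfolding nbr_def by (rule someI_ex) (rule edge_neighbour)

lemma expo_int: "int (expo k j) = n (\<alpha> k - \<alpha> kv) $ j"
  using n_nonneg by (simp add: expo_def)

lemma expo_kv [simp]: "expo kv j = 0" by (simp add: expo_def)

lemma expo_nbr: "expo (nbr j) i = (if i = j then 1 else 0)"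
  by (simp add: expo_def \<alpha>_nbr n_basis axis_def)

lemma chart_kv [simp]: "chart w $ kv = 1" by (simp add: chart_def)

lemma chart_nbr [simp]: "chart w $ nbr j = w $ j"
  by (simp add: chart_def expo_nbr if_distrib[of "\<lambda>p. _ ^ p"] cong: if_cong)

lemma chart_nonzero: "chart w \<noteq> 0"
  using chart_kv[of w] by (metis zero_index zero_neq_one)

lemma chart_torus: "w \<in> torus \<Longrightarrow> chart w $ k = cmonom w (n (\<alpha> k - \<alpha> kv))"
  by (simp add: chart_def cmonom_def expo_int[symmetric])

lemma to_chart_torus: "z \<in> torus \<Longrightarrow> to_chart z \<in> torus"
  by (simp add: to_chart_def torus_def cmonom_nonzero[unfolded torus_def])

lemma from_chart_torus: "w \<in> torus \<Longrightarrow> from_chart w \<in> torus"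
  by (simp add: from_chart_def torus_def cmonom_nonzero[unfolded torus_def])

lemma cmonom_to_chart:
  assumes "z \<in> torus" shows "cmonom (to_chart z) (n a) = cmonom z a"
proof -
  have "cmonom z a = cmonom z (\<Sum>j\<in>UNIV. n a $ j *s u j)" using n_coordinates by simp
  also have "\<dots> = (\<Prod>j\<in>UNIV. cmonom z (u j) powi (n a $ j))"
    using assms by (simp add: cmonom_sum cmonom_scale)
  also have "\<dots> = cmonom (to_chart z) (n a)" by (simp add: cmonom_def to_chart_def)
  finally show ?thesis by simp
qed

lemma cmonom_from_chart:
  assumes "w \<in> torus" shows "cmonom (from_chart w) a = cmonom w (n a)"
proof -
  have "a = (\<Sum>i\<in>UNIV. a $ i *s axis i 1)"
    by (simp add: vec_eq_iff axis_def if_distrib[of "\<lambda>y. _ * y"] sum.delta cong: if_cong)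
  then have "n a = (\<Sum>i\<in>UNIV. a $ i *s n (axis i 1))"
    by (metis (no_types, lifting) n_scale n_sum sum.cong)
  then have "cmonom w (n a) = (\<Prod>i\<in>UNIV. cmonom w (n (axis i 1)) powi (a $ i))"
    using assms by (simp add: cmonom_sum cmonom_scale)
  also have "\<dots> = cmonom (from_chart w) a" by (simp add: cmonom_def from_chart_def)
  finally show ?thesis by simp
qed

lemma to_chart_from_chart: "w \<in> torus \<Longrightarrow> to_chart (from_chart w) = w"
  unfolding to_chart_def by (simp add: cmonom_from_chart n_basis vec_eq_iff)
    (simp add: cmonom_def axis_def if_distrib[of "\<lambda>p. _ powi p"] cong: if_cong)

lemma monomials_chart:
  assumes "z \<in> torus" shows "monomials \<alpha> z = cmonom z (\<alpha> kv) *s chart (to_chart z)"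
proof -
  have "cmonom z (\<alpha> k) = cmonom z (\<alpha> kv) * chart (to_chart z) $ k" for k
    using assms by (simp add: chart_torus to_chart_torus cmonom_to_chart cmonom_diff cmonom_nonzero)
  then show ?thesis unfolding monomials_def vec_eq_iff vec_lambda_beta vector_smult_component by blast
qed

lemma proj_monomials: "z \<in> torus \<Longrightarrow> proj (monomials \<alpha> z) = proj (chart (to_chart z))"
  by (simp add: monomials_chart proj_scale cmonom_nonzero)

lemma proj_chart_torus: "w \<in> torus \<Longrightarrow> proj (chart w) = proj (monomials \<alpha> (from_chart w))"
  by (simp add: proj_monomials from_chart_torus to_chart_from_chart)

lemma continuous_on_chart: "continuous_on S chart"
  unfolding chart_def by (intro continuous_intros)

lemma continuous_on_proj_chart: "continuous_on S (\<lambda>w. proj (chart w))"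
  by (rule continuous_on_compose2[OF continuous_on_proj continuous_on_chart])
    (use chart_nonzero in auto)

lemma proj_chart_in_toric: "proj (chart w) \<in> toric_variety \<alpha>"
proof -
  have "(\<lambda>w. proj (chart w)) ` closure torus \<subseteq> toric_variety \<alpha>"
  proof (rule image_closure_subset)
    show "continuous_on (closure torus) (\<lambda>w. proj (chart w))" by (rule continuous_on_proj_chart)
    show "closed (toric_variety \<alpha>)" by (simp add: toric_variety_def)
    show "(\<lambda>w. proj (chart w)) ` torus \<subseteq> toric_variety \<alpha>"
      using proj_chart_torus from_chart_torus proj_monomials_in_toric by auto
  qed
  then show ?thesis by (auto simp: closure_torus)
qed

text \<open>The chart is inverted by taking ratios of homogeneous coordinates. On the torus the other
  coordinates are monomials in these ratios; multiplying by a power of the vertex coordinate turns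
  this into a binomial relation that is homogeneous and therefore holds on the whole variety.\<close>

lemma toric_eq_chart:
  assumes "\<zeta> \<noteq> 0" "proj \<zeta> \<in> toric_variety \<alpha>" "\<zeta> $ kv \<noteq> 0"
  shows "\<zeta> = \<zeta> $ kv *s chart (\<chi> j. \<zeta> $ nbr j / \<zeta> $ kv)"
proof -
  define d where "d k = (\<Sum>j\<in>UNIV. expo k j)" for k
  have rel: "\<zeta> $ k * (\<zeta> $ kv) ^ d k = \<zeta> $ kv * (\<Prod>j\<in>UNIV. (\<zeta> $ nbr j) ^ expo k j)" for k
  proof (rule toric_variety_closed_relation[OF _ _ _ assms(1,2)])
    show "closed {\<zeta>::complex^'k. \<zeta> $ k * (\<zeta> $ kv) ^ d k = \<zeta> $ kv * (\<Prod>j\<in>UNIV. (\<zeta> $ nbr j) ^ expo k j)}"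
      by (intro closed_Collect_eq continuous_intros)
    show "(c *s \<zeta>) $ k * ((c *s \<zeta>) $ kv) ^ d k = (c *s \<zeta>) $ kv * (\<Prod>j\<in>UNIV. ((c *s \<zeta>) $ nbr j) ^ expo k j)"
      if "\<zeta> $ k * (\<zeta> $ kv) ^ d k = \<zeta> $ kv * (\<Prod>j\<in>UNIV. (\<zeta> $ nbr j) ^ expo k j)" for c and \<zeta> :: "complex^'k"
    proof -
      have "(c *s \<zeta>) $ k * ((c *s \<zeta>) $ kv) ^ d k = c * c ^ d k * (\<zeta> $ k * (\<zeta> $ kv) ^ d k)"
        by (simp add: power_mult_distrib)
      also have "\<dots> = (c *s \<zeta>) $ kv * (\<Prod>j\<in>UNIV. ((c *s \<zeta>) $ nbr j) ^ expo k j)"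
        unfolding that by (simp add: power_mult_distrib prod.distrib d_def power_sum)
      finally show ?thesis .
    qed
    show "monomials \<alpha> z $ k * (monomials \<alpha> z $ kv) ^ d k
        = monomials \<alpha> z $ kv * (\<Prod>j\<in>UNIV. (monomials \<alpha> z $ nbr j) ^ expo k j)" if "z \<in> torus" for z
      unfolding monomials_chart[OF that]
      by (simp add: power_mult_distrib prod.distrib d_def power_sum) (simp add: chart_def)
  qed
  have "\<zeta> $ k = \<zeta> $ kv * (\<Prod>j\<in>UNIV. (\<zeta> $ nbr j / \<zeta> $ kv) ^ expo k j)" for k
  proof -
    have p: "(\<Prod>j\<in>UNIV. (\<zeta> $ nbr j / \<zeta> $ kv) ^ expo k j)
        = (\<Prod>j\<in>UNIV. (\<zeta> $ nbr j) ^ expo k j) / (\<zeta> $ kv) ^ d k"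
      by (simp add: power_divide prod_dividef d_def power_sum)
    have "\<zeta> $ kv ^ d k \<noteq> 0" using assms(3) by simp
    then show ?thesis unfolding p using rel[of k] by (simp add: eq_divide_eq)
  qed
  then show ?thesis unfolding chart_def vec_eq_iff vec_lambda_beta vector_smult_component by blast
qed

text \<open>Precomposing the chart with a diagonal linear map gives again a parametrization; the unitary
  diagonal maps yield the torus symmetry of the volume.\<close>

definition dchart :: "complex^'m \<Rightarrow> complex^'m \<Rightarrow> complex^'k" where
  "dchart e w = chart (\<chi> j. e $ j * w $ j)"

lemma dchart_nonzero: "dchart e w \<noteq> 0" by (simp add: dchart_def chart_nonzero)

lemma range_proj_dchart:
  assumes "e \<in> torus"
  shows "range (\<lambda>w. proj (dchart e w)) = {l \<in> toric_variety \<alpha>. unit_rep l $ kv \<noteq> 0}"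
proof safe
  fix w show "proj (dchart e w) \<in> toric_variety \<alpha>"
    unfolding dchart_def by (rule proj_chart_in_toric)
next
  fix w assume "unit_rep (proj (dchart e w)) $ kv = 0"
  then show False
    using unit_rep_proj_nonzero[OF dchart_nonzero, of e w kv] by (simp add: dchart_def)
next
  fix l assume l: "l \<in> toric_variety \<alpha>" "unit_rep l $ kv \<noteq> 0"
  let ?\<zeta> = "unit_rep l"
  define w where "w = (\<chi> j. ?\<zeta> $ nbr j / ?\<zeta> $ kv / e $ j)"
  have "(\<chi> j. e $ j * w $ j) = (\<chi> j. ?\<zeta> $ nbr j / ?\<zeta> $ kv)"
    using assms by (simp add: w_def vec_eq_iff torus_def)
  then have d: "dchart e w = chart (\<chi> j. ?\<zeta> $ nbr j / ?\<zeta> $ kv)" by (simp only: dchart_def)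
  have "?\<zeta> = ?\<zeta> $ kv *s dchart e w"
    unfolding d by (rule toric_eq_chart) (simp_all add: unit_rep l)
  then have "proj ?\<zeta> = proj (?\<zeta> $ kv *s dchart e w)" by (rule arg_cong)
  also have "\<dots> = proj (dchart e w)" by (rule proj_scale[OF l(2)])
  finally have "proj ?\<zeta> = proj (dchart e w)" .
  then have "l = proj (dchart e w)" by (simp only: unit_rep(2))
  then show "l \<in> range (\<lambda>w. proj (dchart e w))" by (rule range_eqI)
qed

lemma holo_on_dchart: "holo_on (\<lambda>w. dchart e w $ k) U"
  unfolding dchart_def chart_def
  by (auto intro!: holo_on_prod holo_on_power holo_on_mult holo_on_coord holo_on_const)

text \<open>The map is an immersion into projective space because the coordinate of the vertex is constant,
  which excludes the radial direction, whereas the coordinates of the neighbours are linear in \<open>w\<close>.\<close>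

lemma hol_param_dchart:
  assumes "e \<in> torus" shows "hol_param \<alpha> UNIV (dchart e)"
  unfolding hol_param_def
proof (intro conjI allI ballI impI)
  let ?U = "{l \<in> toric_variety \<alpha>. unit_rep l $ kv \<noteq> 0}"
  show "openin (top_of_set (toric_variety \<alpha>)) (range (\<lambda>w. proj (dchart e w)))"
  proof -
    have "?U = toric_variety \<alpha> \<inter> {l. unit_rep l $ kv \<noteq> 0}" by auto
    then show ?thesis
      unfolding range_proj_dchart[OF assms] using open_coord_nonzero openin_open by blast
  qed
  define g where "g l = (\<chi> j. unit_rep l $ nbr j / unit_rep l $ kv / e $ j)" for l
  have g: "g (proj \<zeta>) = (\<chi> j. \<zeta> $ nbr j / \<zeta> $ kv / e $ j)" if nz: "\<zeta> \<noteq> 0" for \<zeta>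
  proof -
    obtain c where c: "c \<noteq> 0" "\<zeta> = c *s unit_rep (proj \<zeta>)"
      using proj_same[OF nz unit_rep(3) unit_rep(2)[symmetric]] by blast
    have "\<zeta> $ k = c * unit_rep (proj \<zeta>) $ k" for k
      using arg_cong[OF c(2), of "\<lambda>x. x $ k"] by simp
    then have "\<zeta> $ k / \<zeta> $ kv = unit_rep (proj \<zeta>) $ k / unit_rep (proj \<zeta>) $ kv" for k
      using c(1) by (metis mult_divide_mult_cancel_left)
    then show ?thesis by (simp only: g_def)
  qed
  have g_dchart: "g (proj (dchart e w)) = w" for w
    unfolding g[OF dchart_nonzero] using assms by (simp add: vec_eq_iff dchart_def torus_def)
  have "homeomorphism UNIV ?U (\<lambda>w. proj (dchart e w)) g"
  proof (rule homeomorphismI)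
    show "continuous_on UNIV (\<lambda>w. proj (dchart e w))"
      unfolding dchart_def
      by (rule continuous_on_compose2[OF continuous_on_proj_chart[of UNIV]]) (auto intro!: continuous_intros)
    have "continuous_on {l. unit_rep l $ kv \<noteq> 0} g"
    proof (rule continuous_on_cproj[OF open_coord_nonzero])
      have "continuous_on {\<zeta>. \<zeta> \<noteq> 0 \<and> proj \<zeta> \<in> {l. unit_rep l $ kv \<noteq> 0}}
          (\<lambda>\<zeta>. \<chi> j. \<zeta> $ nbr j / \<zeta> $ kv / e $ j)"
        using assms by (intro continuous_intros) (auto simp: unit_rep_proj_nonzero torus_def)
      then show "continuous_on {\<zeta>. \<zeta> \<noteq> 0 \<and> proj \<zeta> \<in> {l. unit_rep l $ kv \<noteq> 0}} (\<lambda>\<zeta>. g (proj \<zeta>))"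
        by (rule continuous_on_eq) (simp add: g)
    qed
    then show "continuous_on ?U g" by (rule continuous_on_subset) auto
    show "range (\<lambda>w. proj (dchart e w)) \<subseteq> ?U" using range_proj_dchart[OF assms] by simp
    show "g ` ?U \<subseteq> UNIV" by simp
    show "g (proj (dchart e w)) = w" for w by (rule g_dchart)
    show "proj (dchart e (g l)) = l" if "l \<in> ?U" for l
    proof -
      from that obtain w where "l = proj (dchart e w)"
        using range_proj_dchart[OF assms] by blast
      then show ?thesis using g_dchart by simp
    qed
  qed
  then show "\<exists>g. homeomorphism UNIV (range (\<lambda>w. proj (dchart e w))) (\<lambda>w. proj (dchart e w)) g"
    unfolding range_proj_dchart[OF assms] by blast
  show "v = 0" if "\<exists>c. frechet_derivative (dchart e) (at w) v = c *s dchart e w" for w v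
  proof -
    from that obtain c where c: "frechet_derivative (dchart e) (at w) v = c *s dchart e w" by blast
    define D where "D = frechet_derivative (dchart e) (at w)"
    have "\<exists>D. ((\<lambda>w. dchart e w $ k) has_derivative D) (at w)" for k
      using holo_on_dchart[of e k UNIV] unfolding holo_on_def by blast
    then obtain D' where "\<And>k. ((\<lambda>w. dchart e w $ k) has_derivative D' k) (at w)" by metis
    then have "((\<lambda>w. \<chi> k. dchart e w $ k) has_derivative (\<lambda>h. \<chi> k. D' k h)) (at w)"
      by (rule has_derivative_vec_lambda)
    then have "dchart e differentiable (at w)" by (auto simp: differentiable_def)
    then have D: "(dchart e has_derivative D) (at w)"
      unfolding D_def by (simp add: frechet_derivative_works)
    have "((\<lambda>w. dchart e w $ kv) has_derivative (\<lambda>h. D h $ kv)) (at w)"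
      by (rule has_derivative_vec_nth[OF D])
    then have "((\<lambda>w. 1::complex) has_derivative (\<lambda>h. D h $ kv)) (at w)" by (simp add: dchart_def)
    then have "(\<lambda>h. D h $ kv) = (\<lambda>h. 0)"
      by (rule has_derivative_unique) (rule has_derivative_const)
    then have "D v $ kv = 0" by metis
    then have "c = 0" using c by (simp add: D_def dchart_def)
    have "v $ j = 0" for j
    proof -
      have "((\<lambda>w. dchart e w $ nbr j) has_derivative (\<lambda>h. D h $ nbr j)) (at w)"
        by (rule has_derivative_vec_nth[OF D])
      then have "((\<lambda>w. e $ j * w $ j) has_derivative (\<lambda>h. D h $ nbr j)) (at w)" by (simp add: dchart_def)
      moreover have "((\<lambda>w. e $ j * w $ j) has_derivative (\<lambda>h. e $ j * h $ j)) (at w)"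
        by (intro has_derivative_mult_right has_derivative_vec_nth has_derivative_ident)
      ultimately have "(\<lambda>h. D h $ nbr j) = (\<lambda>h. e $ j * h $ j)" by (rule has_derivative_unique)
      then have "D v $ nbr j = e $ j * v $ j" by metis
      then show ?thesis using c \<open>c = 0\<close> assms by (simp add: D_def torus_def)
    qed
    then show ?thesis by (simp add: vec_eq_iff)
  qed
qed (use holo_on_dchart dchart_nonzero in auto)

end

section \<open>The Fubini-Study density in a chart\<close>

text \<open>\<open>A\<close> and \<open>B\<close> are the holomorphic and the antiholomorphic derivative in the \<open>j\<close>-th variable. In
  terms of the values of the real derivative in the directions \<open>1\<close> and \<open>\<i>\<close> all rules are linear.\<close>

definition has_wirtinger ::
    "'m \<Rightarrow> (complex^'m \<Rightarrow> complex) \<Rightarrow> complex \<Rightarrow> complex \<Rightarrow> complex^'m \<Rightarrow> bool" where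
  "has_wirtinger j f A B w \<longleftrightarrow> (\<exists>D. (f has_derivative D) (at w) \<and>
     D (axis j 1) = A + B \<and> D (axis j \<i>) = \<i> * (A - B))"

lemma has_wirtinger_imp:
  assumes "has_wirtinger j f A B w"
  shows "wirtinger j f w = A" "wirtinger_bar j f w = B"
proof -
  obtain D where D: "(f has_derivative D) (at w)" "D (axis j 1) = A + B" "D (axis j \<i>) = \<i> * (A - B)"
    using assms unfolding has_wirtinger_def by metis
  then show "wirtinger j f w = A" "wirtinger_bar j f w = B"
    unfolding wirtinger_def wirtinger_bar_def frechet_derivative_at[OF D(1), symmetric] D(2,3)
    by (simp_all add: algebra_simps)
qed

lemma has_wirtinger_add:
  assumes "has_wirtinger j f A B w" "has_wirtinger j g A' B' w"
  shows "has_wirtinger j (\<lambda>w. f w + g w) (A + A') (B + B') w"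
proof -
  obtain D E where DE: "(f has_derivative D) (at w)" "(g has_derivative E) (at w)"
     "D (axis j 1) = A + B" "D (axis j \<i>) = \<i> * (A - B)"
     "E (axis j 1) = A' + B'" "E (axis j \<i>) = \<i> * (A' - B')"
    using assms unfolding has_wirtinger_def by metis
  show ?thesis unfolding has_wirtinger_def
    by (intro exI[of _ "\<lambda>h. D h + E h"] conjI)
      (rule has_derivative_add[OF DE(1,2)], simp_all add: DE(3-) algebra_simps)
qed

lemma has_wirtinger_mult:
  assumes "has_wirtinger j f A B w" "has_wirtinger j g A' B' w"
  shows "has_wirtinger j (\<lambda>w. f w * g w) (A * g w + f w * A') (B * g w + f w * B') w"
proof -
  obtain D E where DE: "(f has_derivative D) (at w)" "(g has_derivative E) (at w)"
     "D (axis j 1) = A + B" "D (axis j \<i>) = \<i> * (A - B)"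
     "E (axis j 1) = A' + B'" "E (axis j \<i>) = \<i> * (A' - B')"
    using assms unfolding has_wirtinger_def by metis
  show ?thesis unfolding has_wirtinger_def
    by (intro exI[of _ "\<lambda>h. f w * E h + D h * g w"] conjI)
      (rule has_derivative_mult[OF DE(1,2)], simp_all add: DE(3-) algebra_simps)
qed

lemma has_wirtinger_const: "has_wirtinger j (\<lambda>w. c) 0 0 w"
  unfolding has_wirtinger_def by (intro exI[of _ "\<lambda>h. 0"]) auto

lemma has_wirtinger_sum:
  "(\<And>i. i \<in> I \<Longrightarrow> has_wirtinger j (f i) (A i) (B i) w) \<Longrightarrow>
    has_wirtinger j (\<lambda>w. \<Sum>i\<in>I. f i w) (\<Sum>i\<in>I. A i) (\<Sum>i\<in>I. B i) w"
  by (induction I rule: infinite_finite_induct) (auto intro: has_wirtinger_const has_wirtinger_add)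

lemma has_wirtinger_cnj:
  assumes "has_wirtinger j f A B w"
  shows "has_wirtinger j (\<lambda>w. cnj (f w)) (cnj B) (cnj A) w"
proof -
  obtain D where D: "(f has_derivative D) (at w)"
     "D (axis j 1) = A + B" "D (axis j \<i>) = \<i> * (A - B)"
    using assms unfolding has_wirtinger_def by metis
  show ?thesis unfolding has_wirtinger_def
    by (intro exI[of _ "\<lambda>h. cnj (D h)"] conjI)
      (rule bounded_linear.has_derivative[OF bounded_linear_cnj D(1)], simp_all add: D(2,3) algebra_simps)
qed

lemma has_wirtinger_inverse:
  assumes "has_wirtinger j f A B w" "f w \<noteq> 0"
  shows "has_wirtinger j (\<lambda>w. inverse (f w)) (- A / (f w)\<^sup>2) (- B / (f w)\<^sup>2) w"
proof -
  obtain D where D: "(f has_derivative D) (at w)"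
     "D (axis j 1) = A + B" "D (axis j \<i>) = \<i> * (A - B)"
    using assms unfolding has_wirtinger_def by metis
  show ?thesis unfolding has_wirtinger_def
    by (intro exI[of _ "\<lambda>h. - (inverse (f w) * D h * inverse (f w))"] conjI)
      (rule Deriv.has_derivative_inverse[OF assms(2) D(1)],
       simp_all add: D(2,3) power2_eq_square assms(2) field_simps)
qed

lemma has_wirtinger_holomorphic:
  assumes "(f has_derivative D) (at w)" "\<And>c v. D (c *s v) = c * D v"
  shows "has_wirtinger j f (D (axis j 1)) 0 w"
proof -
  have "axis j \<i> = \<i> *s axis j 1" by (simp add: vec_eq_iff axis_def)
  then have "D (axis j \<i>) = \<i> * D (axis j 1)" using assms(2) by metis
  then show ?thesis unfolding has_wirtinger_def using assms(1)
    by (intro exI[of _ D]) auto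
qed

lemma has_wirtinger_ln:
  assumes F: "has_wirtinger j F A B w" and r: "\<And>u. F u = of_real (r u)" and "0 < r w"
  shows "has_wirtinger j (\<lambda>u. of_real (ln (r u))) (A / F w) (B / F w) w"
proof -
  obtain D where D: "(F has_derivative D) (at w)"
     "D (axis j 1) = A + B" "D (axis j \<i>) = \<i> * (A - B)"
    using F unfolding has_wirtinger_def by metis
  have "((\<lambda>u. Re (F u)) has_derivative (\<lambda>h. Re (D h))) (at w)"
    by (rule bounded_linear.has_derivative[OF bounded_linear_Re D(1)])
  then have r': "(r has_derivative (\<lambda>h. Re (D h))) (at w)" by (simp add: r)
  have "((\<lambda>u. complex_of_real (r u)) has_derivative (\<lambda>h. of_real (Re (D h)))) (at w)"
    by (rule bounded_linear.has_derivative[OF bounded_linear_of_real r'])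
  moreover have "((\<lambda>u. complex_of_real (r u)) has_derivative D) (at w)"
    using D(1) r by (simp add: fun_eq_iff[symmetric] ext[of F "\<lambda>u. complex_of_real (r u)"])
  ultimately have Dre: "(\<lambda>h. of_real (Re (D h))) = D" by (rule has_derivative_unique)
  have "((\<lambda>u. ln (r u)) has_derivative (\<lambda>h. Re (D h) * inverse (r w))) (at w)"
    using r' \<open>0 < r w\<close> by (auto intro!: derivative_eq_intros simp: field_simps)
  then have "((\<lambda>u. complex_of_real (ln (r u))) has_derivative
      (\<lambda>h. of_real (Re (D h) * inverse (r w)))) (at w)"
    by (rule bounded_linear.has_derivative[OF bounded_linear_of_real])
  moreover have "(\<lambda>h. complex_of_real (Re (D h) * inverse (r w))) = (\<lambda>h. D h / F w)"
    using Dre by (simp add: fun_eq_iff r divide_inverse)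
  ultimately have "((\<lambda>u. complex_of_real (ln (r u))) has_derivative (\<lambda>h. D h / F w)) (at w)"
    by simp
  then show ?thesis unfolding has_wirtinger_def
    by (intro exI[of _ "\<lambda>h. D h / F w"] conjI, assumption)
      (simp_all add: D(2,3) add_divide_distrib diff_divide_distrib algebra_simps)
qed

lemma norm_sq_vec: "complex_of_real ((norm (v :: complex^'k::finite))\<^sup>2) = (\<Sum>k\<in>UNIV. v $ k * cnj (v $ k))"
proof -
  have "(norm v)\<^sup>2 = (\<Sum>k\<in>UNIV. (cmod (v $ k))\<^sup>2)"
    by (simp add: norm_vec_def L2_set_def sum_nonneg)
  then show ?thesis by (simp only: of_real_sum complex_norm_square)
qed

context vertex_frame
begin

definition chart_deriv :: "'k \<Rightarrow> 'm \<Rightarrow> complex^'m \<Rightarrow> complex" where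
  "chart_deriv k l w =
     of_nat (expo k l) * (w $ l) ^ (expo k l - 1) * (\<Prod>i\<in>UNIV-{l}. (w $ i) ^ expo k i)"

definition chart_sq :: "complex^'m \<Rightarrow> complex" where
  "chart_sq w = (\<Sum>k\<in>UNIV. chart w $ k * cnj (chart w $ k))"

lemma chart_sq: "chart_sq w = of_real ((norm (chart w))\<^sup>2)"
  by (simp only: chart_sq_def norm_sq_vec)

lemma chart_sq_nonzero: "chart_sq w \<noteq> 0"
  by (simp add: chart_sq chart_nonzero)

lemma has_wirtinger_chart: "has_wirtinger j (\<lambda>w. chart w $ k) (chart_deriv k j w) 0 w"
proof -
  define D where "D h = (\<Sum>l\<in>UNIV. (of_nat (expo k l) * h $ l * (w $ l) ^ (expo k l - 1)) *
      (\<Prod>i\<in>UNIV-{l}. (w $ i) ^ expo k i))" for h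
  have "((\<lambda>w. chart w $ k) has_derivative D) (at w)"
    unfolding chart_def D_def vec_lambda_beta
    by (intro has_derivative_prod has_derivative_power has_derivative_vec_nth has_derivative_ident)
  moreover have "D (c *s v) = c * D v" for c v
    by (simp add: D_def sum_distrib_left mult_ac)
  moreover have "D (axis j 1) = chart_deriv k j w"
    unfolding D_def chart_deriv_def
    by (simp add: axis_def if_distrib[of "\<lambda>x. _ * x"] if_distrib[of "\<lambda>x. x * _"] cong: if_cong)
  ultimately show ?thesis using has_wirtinger_holomorphic by metis
qed

lemma has_wirtinger_chart_deriv: "\<exists>A. has_wirtinger j (chart_deriv k l) A 0 w"
proof -
  have "holo_on (chart_deriv k l) UNIV"
    unfolding chart_deriv_def
    by (intro holo_on_mult holo_on_const holo_on_power holo_on_coord holo_on_prod)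
  then show ?thesis using has_wirtinger_holomorphic unfolding holo_on_def by blast
qed

text \<open>The product and quotient rules applied to \<open>log (\<Sum> \<bar>\<Phi> k\<bar>\<^sup>2)\<close>; the derivative \<open>\<partial>\<close> does not see the
  conjugated factors and the conjugate of \<open>\<partial>\<close> sees nothing else.\<close>

lemma fs_coeffs_chart:
  "fs_coeffs chart w $ j $ l =
     (\<Sum>k\<in>UNIV. chart_deriv k j w * cnj (chart_deriv k l w)) / chart_sq w -
     (\<Sum>k\<in>UNIV. chart w $ k * cnj (chart_deriv k l w)) *
       (\<Sum>k\<in>UNIV. chart_deriv k j w * cnj (chart w $ k)) / (chart_sq w)\<^sup>2"
proof -
  let ?N = "\<lambda>w. \<Sum>k\<in>UNIV. chart w $ k * cnj (chart_deriv k l w)"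
  have sq: "has_wirtinger i chart_sq
      (\<Sum>k\<in>UNIV. chart_deriv k i w * cnj (chart w $ k)) (\<Sum>k\<in>UNIV. chart w $ k * cnj (chart_deriv k i w)) w" for i w
  proof -
    have "has_wirtinger i (\<lambda>w. chart w $ k * cnj (chart w $ k))
      (chart_deriv k i w * cnj (chart w $ k) + chart w $ k * cnj 0) (0 * cnj (chart w $ k) + chart w $ k * cnj (chart_deriv k i w)) w" for k :: 'k
      by (intro has_wirtinger_mult has_wirtinger_cnj has_wirtinger_chart)
    then have "has_wirtinger i (\<lambda>w. chart w $ k * cnj (chart w $ k))
      (chart_deriv k i w * cnj (chart w $ k)) (chart w $ k * cnj (chart_deriv k i w)) w" for k by simp
    then show ?thesis unfolding chart_sq_def by (rule has_wirtinger_sum)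
  qed
  have bar: "wirtinger_bar l (\<lambda>u. of_real (ln ((norm (chart u))\<^sup>2))) = (\<lambda>w. ?N w * inverse (chart_sq w))"
  proof
    fix w
    have "0 < (norm (chart w))\<^sup>2" by (simp add: chart_nonzero)
    from has_wirtinger_imp(2)[OF has_wirtinger_ln[OF sq chart_sq this]]
    show "wirtinger_bar l (\<lambda>u. of_real (ln ((norm (chart u))\<^sup>2))) w = ?N w * inverse (chart_sq w)"
      by (simp add: divide_inverse)
  qed
  have cd: "has_wirtinger j (chart_deriv k l) (SOME A. has_wirtinger j (chart_deriv k l) A 0 w) 0 w" for k
    by (rule someI_ex[OF has_wirtinger_chart_deriv])
  have "has_wirtinger j (\<lambda>w. chart w $ k * cnj (chart_deriv k l w))
      (chart_deriv k j w * cnj (chart_deriv k l w))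
      (chart w $ k * cnj (SOME A. has_wirtinger j (chart_deriv k l) A 0 w)) w" for k
    using has_wirtinger_mult[OF has_wirtinger_chart has_wirtinger_cnj[OF cd]] by simp
  then have "has_wirtinger j ?N (\<Sum>k\<in>UNIV. chart_deriv k j w * cnj (chart_deriv k l w))
      (\<Sum>k\<in>UNIV. chart w $ k * cnj (SOME A. has_wirtinger j (chart_deriv k l) A 0 w)) w"
    by (rule has_wirtinger_sum)
  from has_wirtinger_imp(1)[OF has_wirtinger_mult[OF this has_wirtinger_inverse[OF sq chart_sq_nonzero]]]
  show ?thesis
    by (simp add: fs_coeffs_def bar divide_inverse mult.assoc)
qed

lemma continuous_on_fs_density_chart: "continuous_on S (fs_density chart)"
proof -
  have c: "continuous_on S (\<lambda>w. fs_coeffs chart w $ j $ l)" for j l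
    unfolding fs_coeffs_chart chart_deriv_def chart_sq_def chart_def vec_lambda_beta
    by (intro continuous_intros)
      (use chart_sq_nonzero in \<open>simp_all add: chart_sq_def chart_def\<close>)
  show ?thesis
    unfolding fs_density_def det_def
    by (intro continuous_intros c) auto
qed

lemma expo_inject:
  assumes "\<And>i. expo k i = expo k' i" shows "k = k'"
proof -
  have "n (\<alpha> k - \<alpha> kv) = n (\<alpha> k' - \<alpha> kv)"
    using assms by (simp add: vec_eq_iff expo_int[symmetric])
  then have "\<alpha> k = \<alpha> k'" by (simp add: n_inject)
  then show ?thesis using inj_\<alpha> by (simp add: inj_eq)
qed

lemma chart_deriv_zero: "chart_deriv k l 0 = (if k = nbr l then 1 else 0)"
proof (cases "k = nbr l")
  case True
  then show ?thesis by (simp add: chart_deriv_def expo_nbr)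
next
  case False
  have "chart_deriv k l 0 = 0"
  proof (rule ccontr)
    assume "chart_deriv k l 0 \<noteq> 0"
    then have nz: "expo k l \<noteq> 0" "(0::complex) ^ (expo k l - 1) \<noteq> 0"
        "\<forall>i\<in>UNIV-{l}. (0::complex) ^ expo k i \<noteq> 0"
      by (auto simp: chart_deriv_def)
    from nz(2) have "expo k l - 1 = 0" by (cases "expo k l - 1") auto
    then have "expo k l = 1" using nz(1) by simp
    moreover have "expo k i = 0" if "i \<noteq> l" for i
      using nz(3) that by (cases "expo k i") auto
    ultimately have "expo k i = expo (nbr l) i" for i by (simp add: expo_nbr)
    then show False using expo_inject False by blast
  qed
  then show ?thesis using False by simp
qed

lemma nbr_neq_kv: "nbr j \<noteq> kv"
  using expo_nbr[of j j] by auto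

lemma nbr_inject: "nbr j = nbr l \<longleftrightarrow> j = l"
  using expo_nbr[of j l] expo_nbr[of l l] by (auto split: if_splits)

lemma chart_zero: "chart 0 $ k = (if k = kv then 1 else 0)"
proof (cases "k = kv")
  case False
  then obtain i where "expo k i \<noteq> 0" using expo_inject[of k kv] by auto
  then have "\<exists>i\<in>UNIV. (0::complex) ^ expo k i = 0" by (intro bexI[of _ i]) (auto simp: power_0_left)
  then have "(\<Prod>i\<in>UNIV. (0::complex) ^ expo k i) = 0" by (intro prod_zero) auto
  then show ?thesis using False by (simp add: chart_def)
qed simp

text \<open>At the vertex the Fubini-Study form is the standard one, since to first order the chart is
  affine with orthonormal coordinate directions, orthogonal to the vertex itself. Together with continuity this shows that the volume
  of a neighbourhood is positive.\<close>

lemma fs_density_chart_zero: "fs_density chart 0 = 1 / pi ^ CARD('m)"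
proof -
  have "chart_sq 0 = 1"
    by (simp add: chart_sq_def chart_zero if_distrib[of "\<lambda>x. x * _"] cong: if_cong)
  moreover have "(\<Sum>k\<in>UNIV. chart 0 $ k * cnj (chart_deriv k l 0)) = 0" for l
    by (rule sum.neutral) (auto simp: chart_zero chart_deriv_zero nbr_neq_kv)
  moreover have "(\<Sum>k\<in>UNIV. chart_deriv k j 0 * cnj (chart_deriv k l 0)) = (if j = l then 1 else 0)" for j l
    by (simp add: chart_deriv_zero if_distrib[of "\<lambda>x. x * _"] nbr_inject cong: if_cong)
  ultimately have "fs_coeffs chart 0 = mat 1"
    by (simp add: vec_eq_iff fs_coeffs_chart mat_def)
  then show ?thesis by (simp add: fs_density_def)
qed

text \<open>The density depends on a parametrization only through its norm, and rotating the chart coordinates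
  preserves the norm.\<close>

lemma norm_dchart: "(\<And>j. cmod (e $ j) = 1) \<Longrightarrow> norm (dchart e w) = norm (chart w)"
  by (simp add: norm_vec_def dchart_def chart_def norm_mult norm_power prod_norm[symmetric])

lemma fs_density_dchart:
  "(\<And>j. cmod (e $ j) = 1) \<Longrightarrow> fs_density (dchart e) = fs_density chart"
  by (simp add: fs_density_def[abs_def] fs_coeffs_def norm_dchart)

end

section \<open>The volume\<close>

text \<open>For points of the toric variety, not having a vanishing homogeneous coordinate characterizes the
  open torus orbit.\<close>

definition orbit :: "('k::finite \<Rightarrow> int^'m) \<Rightarrow> 'k cproj set" where
  "orbit \<alpha> = {l \<in> toric_variety \<alpha>. \<forall>k. unit_rep l $ k \<noteq> 0}"

definition affine_part :: "('k::finite \<Rightarrow> int^'m) \<Rightarrow> 'k \<Rightarrow> 'k cproj set" where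
  "affine_part \<alpha> k = {l \<in> toric_variety \<alpha>. unit_rep l $ k \<noteq> 0}"

lemma toric_variety_borel [measurable]: "toric_variety \<alpha> \<in> sets borel"
  by (simp add: toric_variety_def borel_closed)

lemma coord_nonzero_borel [measurable]: "{l :: 'k::finite cproj. unit_rep l $ k \<noteq> 0} \<in> sets borel"
  by (rule borel_open[OF open_coord_nonzero])

lemma affine_part_borel [measurable]: "affine_part \<alpha> k \<in> sets borel"
proof -
  have "affine_part \<alpha> k = toric_variety \<alpha> \<inter> {l. unit_rep l $ k \<noteq> 0}"
    by (auto simp: affine_part_def)
  then show ?thesis by simp
qed

lemma orbit_borel [measurable]: "orbit \<alpha> \<in> sets borel"
proof -
  have "orbit \<alpha> = toric_variety \<alpha> \<inter> (\<Inter>k. {l. unit_rep l $ k \<noteq> 0})"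
    by (auto simp: orbit_def)
  then show ?thesis by simp
qed

lemma AE_torus: "AE w in lborel. w \<in> (torus :: (complex^'m) set)"
proof -
  have "closed (- torus :: (complex^'m) set)"
  proof -
    have "- torus = (\<Union>i\<in>UNIV. {w :: complex^'m. w $ i = 0})" by (auto simp: torus_def)
    then show ?thesis by (auto intro!: closed_Collect_eq continuous_intros)
  qed
  then have "- torus \<in> sets (lborel :: (complex^'m) measure)" by (simp add: borel_closed)
  then have "- torus \<in> null_sets (lborel :: (complex^'m) measure)"
    using negligible_compl_torus null_sets_completion_iff unfolding negligible_iff_null_sets by blast
  then have "AE w in lborel. w \<notin> (- torus :: (complex^'m) set)" by (rule AE_not_in)
  then show ?thesis by simp
qed

lemma compact_polydisc: "compact {w :: complex^'m. \<forall>j. cmod (w $ j) \<le> R}" (is "compact ?K")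
proof -
  have "closed ?K" by (intro closed_Collect_all closed_Collect_le continuous_intros)
  moreover have "bounded ?K"
  proof -
    have "norm w \<le> (\<Sum>j\<in>(UNIV::'m set). R)" if "w \<in> ?K" for w
    proof -
      have "norm w \<le> (\<Sum>j\<in>UNIV. cmod (w $ j))"
        unfolding norm_vec_def by (rule L2_set_le_sum) auto
      also have "\<dots> \<le> (\<Sum>j\<in>(UNIV::'m set). R)" using that by (intro sum_mono) simp
      finally show ?thesis .
    qed
    then show ?thesis unfolding bounded_iff by blast
  qed
  ultimately show ?thesis by (simp add: compact_eq_bounded_closed)
qed

lemma is_fs_volume_sets:
  assumes "is_fs_volume \<alpha> V"
  shows "sets V = sets (restrict_space borel (toric_variety \<alpha>))" and "space V = toric_variety \<alpha>"
proof -
  show *: "sets V = sets (restrict_space borel (toric_variety \<alpha>))"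
    using assms by (simp add: is_fs_volume_def)
  show "space V = toric_variety \<alpha>"
    using sets_eq_imp_space_eq[OF *] by (simp add: space_restrict_space)
qed

lemma sets_V_iff:
  assumes "is_fs_volume \<alpha> V"
  shows "B \<in> sets V \<longleftrightarrow> B \<in> sets borel \<and> B \<subseteq> toric_variety \<alpha>"
  unfolding is_fs_volume_sets[OF assms]
  by (subst sets_restrict_space_iff) auto

context vertex_frame
begin

lemma borel_measurable_density [measurable]: "fs_density chart \<in> borel_measurable borel"
  by (rule borel_measurable_continuous_onI[OF continuous_on_fs_density_chart])

lemma emeasure_affine_part:
  assumes vol: "is_fs_volume \<alpha> V" and e: "\<And>j. cmod (e $ j) = 1"
    and B: "B \<in> sets borel" "B \<subseteq> affine_part \<alpha> kv"
  shows "emeasure V B =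
    (\<integral>\<^sup>+ w. ennreal (fs_density chart w) * indicator {w. proj (dchart e w) \<in> B} w \<partial>lborel)"
proof -
  have et: "e \<in> torus" using e by (auto simp: torus_def) (metis norm_zero zero_neq_one)
  have "B \<subseteq> range (\<lambda>w. proj (dchart e w))"
    using B(2) unfolding range_proj_dchart[OF et] affine_part_def .
  then show ?thesis
    using vol hol_param_dchart[OF et] B(1) fs_density_dchart[OF e]
    unfolding is_fs_volume_def by simp
qed

lemma dchart_one: "dchart (\<chi> j. 1) = chart"
  by (simp add: dchart_def fun_eq_iff)

lemma emeasure_affine_part_chart:
  assumes vol: "is_fs_volume \<alpha> V" and B: "B \<in> sets borel" "B \<subseteq> affine_part \<alpha> kv"
  shows "emeasure V B =
    (\<integral>\<^sup>+ w. ennreal (fs_density chart w) * indicator {w. proj (chart w) \<in> B} w \<partial>lborel)"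
  using emeasure_affine_part[OF vol, of "\<chi> j. 1"] B by (simp add: dchart_one)

lemma proj_chart_in_orbit: "w \<in> torus \<Longrightarrow> proj (chart w) \<in> orbit \<alpha>"
  using proj_chart_in_toric
  by (simp add: orbit_def unit_rep_proj_nonzero chart_nonzero chart_torus cmonom_nonzero)

text \<open>In the chart the complement of the orbit consists of coordinate hyperplanes.\<close>

lemma emeasure_affine_part_minus_orbit:
  assumes vol: "is_fs_volume \<alpha> V"
  shows "emeasure V (affine_part \<alpha> kv - orbit \<alpha>) = 0"
proof -
  let ?B = "affine_part \<alpha> kv - orbit \<alpha>"
  have "emeasure V ?B = (\<integral>\<^sup>+ w. ennreal (fs_density chart w) * indicator {w. proj (chart w) \<in> ?B} w \<partial>lborel)"
    by (rule emeasure_affine_part_chart[OF vol]) auto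
  also have "\<dots> = (\<integral>\<^sup>+ w. 0 \<partial>(lborel :: (complex^'m) measure))"
    by (rule nn_integral_cong_AE, rule AE_mp[OF AE_torus])
      (auto simp: indicator_def proj_chart_in_orbit)
  finally show ?thesis by simp
qed

lemma emeasure_orbit_pos:
  assumes vol: "is_fs_volume \<alpha> V"
  shows "0 < emeasure V (orbit \<alpha>)"
proof (rule ccontr)
  assume "\<not> ?thesis"
  then have 0: "emeasure V (orbit \<alpha>) = 0" by simp
  have "emeasure V (orbit \<alpha>) = (\<integral>\<^sup>+ w. ennreal (fs_density chart w) * indicator {w. proj (chart w) \<in> orbit \<alpha>} w \<partial>lborel)"
    by (rule emeasure_affine_part_chart[OF vol]) (auto simp: orbit_def affine_part_def orbit_borel[unfolded orbit_def])
  also have "\<dots> = (\<integral>\<^sup>+ w. ennreal (fs_density chart w) \<partial>lborel)"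
    by (rule nn_integral_cong_AE, rule AE_mp[OF AE_torus])
      (auto simp: indicator_def proj_chart_in_orbit)
  finally have "(\<integral>\<^sup>+ w. ennreal (fs_density chart w) \<partial>lborel) = 0" using 0 by simp
  then have "AE w in lborel. ennreal (fs_density chart w) = 0"
    by (subst (asm) nn_integral_0_iff_AE) auto
  then have ae: "AE w in lborel. w \<notin> {w. 0 < fs_density chart w}"
    by (rule AE_mp) (auto simp: ennreal_eq_0_iff)
  have op: "open {w. 0 < fs_density chart w}"
    by (intro open_Collect_less continuous_intros continuous_on_fs_density_chart)
  have "{w. 0 < fs_density chart w} \<in> null_sets lborel"
    using ae op by (subst AE_iff_null_sets) (auto simp: borel_open)
  then have "negligible {w. 0 < fs_density chart w}"
    using op by (simp add: negligible_iff_null_sets null_sets_completionI)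
  moreover have "0 \<in> {w. 0 < fs_density chart w}" by (simp add: fs_density_chart_zero)
  ultimately show False using open_not_negligible[OF op] by blast
qed

text \<open>In the chart this set lies in the closed unit polydisc, on which the density is bounded.\<close>

lemma emeasure_dominated_part_finite:
  assumes vol: "is_fs_volume \<alpha> V"
  defines "B \<equiv> {l \<in> toric_variety \<alpha>. \<forall>k. cmod (unit_rep l $ k) \<le> cmod (unit_rep l $ kv)}"
  shows "B \<in> sets borel" and "emeasure V B < \<infinity>"
proof -
  have cl: "closed {\<zeta> :: complex^'k. \<forall>k. cmod (\<zeta> $ k) \<le> cmod (\<zeta> $ kv)}"
    by (intro closed_Collect_all closed_Collect_le continuous_intros)
  have inv: "\<forall>k. cmod ((c *s \<zeta>) $ k) \<le> cmod ((c *s \<zeta>) $ kv)"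
    if "\<forall>k. cmod (\<zeta> $ k) \<le> cmod (\<zeta> $ kv)" for c and \<zeta> :: "complex^'k"
    using that by (simp add: norm_mult mult_left_mono)
  have "closed {l :: 'k cproj. \<forall>k. cmod (unit_rep l $ k) \<le> cmod (unit_rep l $ kv)}"
    by (rule closed_cproj(1)[where Q="\<lambda>\<zeta>. \<forall>k. cmod (\<zeta> $ k) \<le> cmod (\<zeta> $ kv)", OF cl inv])
  then have "closed B"
    unfolding B_def Collect_conj_eq by (intro closed_Int) (auto simp: toric_variety_def)
  then show Bb: "B \<in> sets borel" by (rule borel_closed)
  have "B \<subseteq> affine_part \<alpha> kv"
  proof
    fix l assume l: "l \<in> B"
    have "unit_rep l $ kv \<noteq> 0"
    proof
      assume "unit_rep l $ kv = 0"
      then have "unit_rep l = 0" using l by (simp add: B_def vec_eq_iff)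
      then show False using unit_rep(3) by blast
    qed
    then show "l \<in> affine_part \<alpha> kv" using l by (simp add: affine_part_def B_def)
  qed
  then have eq: "emeasure V B = (\<integral>\<^sup>+ w. ennreal (fs_density chart w) * indicator {w. proj (chart w) \<in> B} w \<partial>lborel)"
    using Bb by (intro emeasure_affine_part_chart[OF vol])
  define K where "K = {w :: complex^'m. \<forall>j. cmod (w $ j) \<le> 1}"
  have K: "compact K" unfolding K_def by (rule compact_polydisc)
  have "compact (fs_density chart ` K)"
    by (rule compact_continuous_image[OF continuous_on_fs_density_chart K])
  then obtain C where C: "\<And>w. w \<in> K \<Longrightarrow> \<bar>fs_density chart w\<bar> \<le> C"
    using compact_imp_bounded by (force simp: bounded_iff)
  have inK: "w \<in> K" if "proj (chart w) \<in> B" for w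
  proof -
    have "\<forall>k. cmod (unit_rep (proj (chart w)) $ k) \<le> cmod (unit_rep (proj (chart w)) $ kv)"
      using that by (simp add: B_def)
    then have "\<forall>k. cmod (chart w $ k) \<le> cmod (chart w $ kv)"
      using closed_cproj(2)[where Q="\<lambda>\<zeta>. \<forall>k. cmod (\<zeta> $ k) \<le> cmod (\<zeta> $ kv)", OF cl inv chart_nonzero] by blast
    then have "cmod (chart w $ nbr j) \<le> cmod (chart w $ kv)" for j by blast
    then show ?thesis by (simp add: K_def)
  qed
  have "emeasure V B \<le> (\<integral>\<^sup>+ w. ennreal C * indicator K w \<partial>lborel)"
    unfolding eq
  proof (rule nn_integral_mono)
    fix w
    show "ennreal (fs_density chart w) * indicator {w. proj (chart w) \<in> B} w \<le> ennreal C * indicator K w"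
    proof (cases "proj (chart w) \<in> B")
      case True
      then have "w \<in> K" by (rule inK)
      moreover have "fs_density chart w \<le> C" using C[OF \<open>w \<in> K\<close>] by simp
      ultimately show ?thesis by (simp add: indicator_def ennreal_leI)
    qed simp
  qed
  also have "\<dots> = ennreal C * emeasure lborel K"
    using K by (intro nn_integral_cmult_indicator) (simp add: borel_compact)
  also have "\<dots> < \<infinity>"
    using emeasure_compact_finite[OF K] by (simp add: ennreal_mult_less_top)
  finally show "emeasure V B < \<infinity>" .
qed

end

locale toric_data =
  fixes P :: "(real^'m) set" and \<alpha> :: "'k::finite \<Rightarrow> int^'m"
  assumes delzant: "delzant_polytope P"
    and enum: "bij_betw \<alpha> UNIV (lattice_points P)"
begin

lemma inj_\<alpha>: "inj \<alpha>" using enum by (simp add: bij_betw_def)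

lemma \<alpha>_in_P: "of_ivec (\<alpha> k) \<in> P"
proof -
  have "\<alpha> k \<in> lattice_points P" using enum by (metis bij_betw_def rangeI)
  then show ?thesis by (simp add: lattice_points_def)
qed

lemma polytope_P: "polytope P" and P_nonneg: "x \<in> P \<Longrightarrow> 0 \<le> x $ i"
  using delzant by (auto simp: delzant_polytope_def)

lemma P_nonempty: "P \<noteq> {}"
  using \<alpha>_in_P by auto

text \<open>Vertices are selected in this way: by a coordinate functional, by the logarithms of the moduli of
  a point of the torus, or by a separating functional.\<close>

lemma linear_max_frame:
  obtains kv u n where "vertex_frame \<alpha> kv u n" "\<And>x. x \<in> P \<Longrightarrow> c \<bullet> x \<le> c \<bullet> of_ivec (\<alpha> kv)"
proof -
  obtain v where v: "v extreme_point_of P" "\<And>x. x \<in> P \<Longrightarrow> c \<bullet> x \<le> c \<bullet> v"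
    using polytope_linear_max[OF polytope_P P_nonempty] by metis
  obtain kv u n where "v = of_ivec (\<alpha> kv)" "vertex_frame \<alpha> kv u n"
    using delzant_vertex_frame[OF delzant enum v(1)] by metis
  then show thesis using that v by simp
qed

definition vertices :: "'k set" where
  "vertices = {kv. \<exists>u n. vertex_frame \<alpha> kv u n}"

text \<open>The logarithms of the moduli of the monomials are the values of a linear functional at the lattice
  points, and this functional is maximal at a vertex.\<close>

lemma dominating_vertex:
  assumes "\<zeta> \<noteq> 0" "proj \<zeta> \<in> toric_variety \<alpha>"
  shows "\<exists>kv\<in>vertices. \<forall>k. cmod (\<zeta> $ k) \<le> cmod (\<zeta> $ kv)"
proof (rule toric_variety_closed_relation[OF _ _ _ assms])
  have "{\<zeta> :: complex^'k. \<exists>kv\<in>vertices. \<forall>k. cmod (\<zeta> $ k) \<le> cmod (\<zeta> $ kv)} =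
      (\<Union>kv\<in>vertices. {\<zeta>. \<forall>k. cmod (\<zeta> $ k) \<le> cmod (\<zeta> $ kv)})" by auto
  also have "closed \<dots>"
    by (rule closed_UN) (auto intro!: closed_Collect_all closed_Collect_le continuous_intros)
  finally show "closed {\<zeta> :: complex^'k. \<exists>kv\<in>vertices. \<forall>k. cmod (\<zeta> $ k) \<le> cmod (\<zeta> $ kv)}" .
  show "\<exists>kv\<in>vertices. \<forall>k. cmod ((c *s \<zeta>) $ k) \<le> cmod ((c *s \<zeta>) $ kv)"
    if "\<exists>kv\<in>vertices. \<forall>k. cmod (\<zeta> $ k) \<le> cmod (\<zeta> $ kv)" for c and \<zeta> :: "complex^'k"
    using that by (auto simp: norm_mult intro!: mult_left_mono)
  fix z :: "complex^'m" assume z: "z \<in> torus"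
  obtain kv u n where kv: "vertex_frame \<alpha> kv u n"
      "\<And>x. x \<in> P \<Longrightarrow> (\<chi> i. ln (cmod (z $ i))) \<bullet> x \<le> (\<chi> i. ln (cmod (z $ i))) \<bullet> of_ivec (\<alpha> kv)"
    using linear_max_frame[of "\<chi> i. ln (cmod (z $ i))"] by metis
  have "cmod (monomials \<alpha> z $ k) \<le> cmod (monomials \<alpha> z $ kv)" for k
    using kv(2)[OF \<alpha>_in_P] by (simp add: monomials_def cmod_cmonom[OF z])
  moreover have "kv \<in> vertices" using kv(1) by (auto simp: vertices_def)
  ultimately show "\<exists>kv\<in>vertices. \<forall>k. cmod (monomials \<alpha> z $ k) \<le> cmod (monomials \<alpha> z $ kv)" by blast
qed

end

locale toric_volume = toric_data P \<alpha>
  for P :: "(real^'m) set" and \<alpha> :: "'k::finite \<Rightarrow> int^'m" +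
  fixes V :: "'k cproj measure"
  assumes vol: "is_fs_volume \<alpha> V"
begin

lemmas sets_V = is_fs_volume_sets(1)[OF vol] and space_V = is_fs_volume_sets(2)[OF vol]

text \<open>The toric variety is covered by the sets on which the coordinate of a given vertex dominates.\<close>

lemma finite_measure_V: "finite_measure V"
proof
  let ?B = "\<lambda>kv. {l \<in> toric_variety \<alpha>. \<forall>k. cmod (unit_rep l $ k) \<le> cmod (unit_rep l $ kv)}"
  have B: "?B kv \<in> sets V" "emeasure V (?B kv) < \<infinity>" if "kv \<in> vertices" for kv
    using that vertex_frame.emeasure_dominated_part_finite[OF _ vol]
    by (auto simp: vertices_def sets_V_iff[OF vol])
  have "space V \<subseteq> (\<Union>kv\<in>vertices. ?B kv)"
  proof
    fix l assume "l \<in> space V"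
    then show "l \<in> (\<Union>kv\<in>vertices. ?B kv)"
      using dominating_vertex[of "unit_rep l"] by (auto simp: space_V unit_rep)
  qed
  then have "emeasure V (space V) \<le> emeasure V (\<Union>kv\<in>vertices. ?B kv)"
    using B(1) by (intro emeasure_mono) auto
  also have "\<dots> \<le> (\<Sum>kv\<in>vertices. emeasure V (?B kv))"
    using B(1) by (intro emeasure_subadditive_finite) auto
  also have "\<dots> < \<infinity>" using B(2) by (auto simp: less_top)
  finally show "emeasure V (space V) \<noteq> \<infinity>" by simp
qed

lemma AE_orbit: "AE l in V. l \<in> orbit \<alpha>"
proof -
  let ?D = "\<Union>kv\<in>vertices. affine_part \<alpha> kv - orbit \<alpha>"
  have "affine_part \<alpha> kv - orbit \<alpha> \<in> null_sets V" if "kv \<in> vertices" for kv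
    using that vertex_frame.emeasure_affine_part_minus_orbit[OF _ vol]
    by (auto simp: vertices_def null_sets_def sets_V_iff[OF vol]) (auto simp: affine_part_def)
  then have D: "?D \<in> null_sets V" by (intro null_sets_UN') auto
  have cover: "l \<in> orbit \<alpha> \<or> l \<in> ?D" if l: "l \<in> space V" for l
  proof -
    obtain kv where kv: "kv \<in> vertices" "\<forall>k. cmod (unit_rep l $ k) \<le> cmod (unit_rep l $ kv)"
      using dominating_vertex[of "unit_rep l"] l by (auto simp: space_V unit_rep)
    have "unit_rep l $ kv \<noteq> 0"
    proof
      assume "unit_rep l $ kv = 0"
      then have "unit_rep l = 0" using kv by (simp add: vec_eq_iff)
      then show False using unit_rep(3) by blast
    qed
    then show ?thesis using l kv by (auto simp: affine_part_def space_V)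
  qed
  show ?thesis
    by (rule AE_mp[OF AE_not_in[OF D]], rule AE_I2) (use cover in blast)
qed

lemma emeasure_orbit_pos: "0 < emeasure V (orbit \<alpha>)"
proof -
  obtain kv u n where "vertex_frame \<alpha> kv u n" using linear_max_frame by metis
  then show ?thesis using vertex_frame.emeasure_orbit_pos vol by blast
qed

text \<open>The density of the volume does not change under rotation of the chart coordinates, hence neither
  does the volume.\<close>

lemma V_eq_distr:
  assumes frame: "vertex_frame \<alpha> kv u n" and e: "\<And>j. cmod (e $ j) = 1"
  shows "V = distr (density lborel (\<lambda>w. ennreal (fs_density (vertex_frame.chart \<alpha> kv n) w))) V
    (\<lambda>w. proj (vertex_frame.dchart \<alpha> kv n e w))" (is "_ = distr ?D V ?f")
    and "(\<lambda>w. proj (vertex_frame.dchart \<alpha> kv n e w)) \<in> borel \<rightarrow>\<^sub>M V"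
proof -
  interpret vertex_frame \<alpha> kv u n by (rule frame)
  have "continuous_on UNIV ?f"
    unfolding dchart_def
    by (rule continuous_on_compose2[OF continuous_on_proj_chart[of UNIV]]) (auto intro!: continuous_intros)
  then have "?f \<in> borel_measurable borel" by (rule borel_measurable_continuous_onI)
  then show f: "?f \<in> borel \<rightarrow>\<^sub>M V"
    unfolding measurable_cong_sets[OF refl sets_V]
    by (intro measurable_restrict_space2) (auto simp: dchart_def proj_chart_in_toric)
  then have f': "?f \<in> ?D \<rightarrow>\<^sub>M V" by simp
  show "V = distr ?D V ?f"
  proof (rule measure_eqI)
    fix B assume B: "B \<in> sets V"
    then have Bb: "B \<in> sets borel" "B \<subseteq> toric_variety \<alpha>" by (auto simp: sets_V_iff[OF vol])
    have sub: "B \<inter> affine_part \<alpha> kv \<in> sets V"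
      using Bb by (auto simp: sets_V_iff[OF vol])
    have "emeasure V B = emeasure V (B \<inter> affine_part \<alpha> kv)"
      by (rule emeasure_eq_AE[OF AE_mp[OF AE_orbit]])
        (use B sub in \<open>auto simp: orbit_def affine_part_def\<close>)
    also have "\<dots> = (\<integral>\<^sup>+ w. ennreal (fs_density chart w) * indicator {w. ?f w \<in> B \<inter> affine_part \<alpha> kv} w \<partial>lborel)"
      using Bb by (intro emeasure_affine_part[OF vol e]) auto
    also have "\<dots> = (\<integral>\<^sup>+ w. ennreal (fs_density chart w) * indicator (?f -` B) w \<partial>lborel)"
    proof -
      have et: "e \<in> torus" using e by (auto simp: torus_def) (metis norm_zero zero_neq_one)
      have "?f w \<in> affine_part \<alpha> kv" for w
        using range_proj_dchart[OF et] unfolding affine_part_def by blast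
      then have "{w. ?f w \<in> B \<inter> affine_part \<alpha> kv} = ?f -` B" by auto
      then show ?thesis by simp
    qed
    also have "\<dots> = emeasure ?D (?f -` B)"
      using measurable_sets[OF f B] by (subst emeasure_density) auto
    also have "\<dots> = emeasure (distr ?D V ?f) B"
      using f' B by (simp add: emeasure_distr)
    finally show "emeasure V B = emeasure (distr ?D V ?f) B" .
  qed simp
qed

end

section \<open>The circle bundle and its volume\<close>

lemma emeasure_periodic_shift:
  fixes E :: "real set"
  assumes E: "E \<in> sets borel" and per: "\<And>t. t + 1 \<in> E \<longleftrightarrow> t \<in> E" and s: "0 \<le> s" "s < 1"
  shows "emeasure lborel {t \<in> {0..<1}. t + s \<in> E} = emeasure lborel {t \<in> {0..<1}. t \<in> E}"
proof -
  have shift: "emeasure lborel {t. c + t \<in> B} = emeasure lborel B" if "B \<in> sets borel" for B and c :: real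
  proof -
    have "emeasure lborel B = emeasure (distr lborel borel ((+) c)) B" by (simp add: lborel_distr_plus)
    also have "\<dots> = emeasure lborel ((+) c -` B \<inter> space lborel)"
      using that by (subst emeasure_distr) auto
    also have "(+) c -` B \<inter> space lborel = {t. c + t \<in> B}" by auto
    finally show ?thesis by simp
  qed
  have mE: "{t. t + c \<in> E} \<in> sets borel" for c
    using measurable_sets[of "\<lambda>t. t + c" borel borel E] E by (simp add: vimage_def)
  have per': "t - 1 \<in> E \<longleftrightarrow> t \<in> E" for t using per[of "t - 1"] by simp
  have "{t \<in> {0..<1}. t + s \<in> E} = {t. s + t \<in> E \<inter> {s..<1}} \<union> {t. (s - 1) + t \<in> E \<inter> {0..<s}}"
  proof (rule set_eqI, cases)
    fix t assume "t < 1 - s"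
    then show "t \<in> {t \<in> {0..<1}. t + s \<in> E} \<longleftrightarrow>
        t \<in> {t. s + t \<in> E \<inter> {s..<1}} \<union> {t. (s - 1) + t \<in> E \<inter> {0..<s}}"
      using s by (auto simp: add.commute)
  next
    fix t assume "\<not> t < 1 - s"
    moreover have "(s - 1) + t \<in> E \<longleftrightarrow> t + s \<in> E" using per'[of "t + s"] by (simp add: algebra_simps)
    ultimately show "t \<in> {t \<in> {0..<1}. t + s \<in> E} \<longleftrightarrow>
        t \<in> {t. s + t \<in> E \<inter> {s..<1}} \<union> {t. (s - 1) + t \<in> E \<inter> {0..<s}}"
      using s by auto
  qed
  then have "emeasure lborel {t \<in> {0..<1}. t + s \<in> E} =
      emeasure lborel ({t. s + t \<in> E \<inter> {s..<1}} \<union> {t. (s - 1) + t \<in> E \<inter> {0..<s}})" by simp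
  also have "\<dots> = emeasure lborel {t. s + t \<in> E \<inter> {s..<1}} + emeasure lborel {t. (s - 1) + t \<in> E \<inter> {0..<s}}"
  proof (rule plus_emeasure[symmetric])
    have m: "{t. c + t \<in> B} \<in> sets lborel" if "B \<in> sets borel" for B and c :: real
      using measurable_sets[of "\<lambda>t. c + t" borel borel B] that by (simp add: vimage_def)
    show "{t. s + t \<in> E \<inter> {s..<1}} \<in> sets lborel" "{t. (s - 1) + t \<in> E \<inter> {0..<s}} \<in> sets lborel"
      using E by (auto intro!: m)
  qed auto
  also have "\<dots> = emeasure lborel (E \<inter> {s..<1}) + emeasure lborel (E \<inter> {0..<s})"
  proof -
    have b: "E \<inter> {s..<1} \<in> sets borel" "E \<inter> {0..<s} \<in> sets borel" using E by auto
    show ?thesis unfolding shift[OF b(1)] shift[OF b(2)] ..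
  qed
  also have "\<dots> = emeasure lborel ((E \<inter> {s..<1}) \<union> (E \<inter> {0..<s}))"
    using E by (intro plus_emeasure) auto
  also have "(E \<inter> {s..<1}) \<union> (E \<inter> {0..<s}) = {t \<in> {0..<1}. t \<in> E}" using s by auto
  finally show ?thesis .
qed

text \<open>Changing the base point on the circle shifts the angle, and the integrand is periodic.\<close>

lemma fiber_measure_independent:
  fixes \<eta> :: "complex^'k::finite"
  assumes A: "A \<in> sets borel" and c: "cmod c = 1"
  shows "emeasure lborel {t \<in> {0..<1::real}. cis (2 * pi * t) *s (c *s \<eta>) \<in> A} =
         emeasure lborel {t \<in> {0..<1}. cis (2 * pi * t) *s \<eta> \<in> A}"
proof -
  define s where "s = Arg2pi c / (2 * pi)"
  have s: "0 \<le> s" "s < 1" using Arg2pi[of c] by (auto simp: s_def field_simps)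
  have cs: "c = cis (2 * pi * s)"
    using c complex_norm_eq_1_exp[of c] by (simp add: s_def cis_conv_exp)
  define E where "E = {t :: real. cis (2 * pi * t) *s \<eta> \<in> A}"
  have "continuous_on UNIV (\<lambda>t::real. cis (2 * pi * t) *s \<eta>)"
    unfolding cis_conv_exp vector_scalar_mult_def by (intro continuous_intros)
  then have "(\<lambda>t::real. cis (2 * pi * t) *s \<eta>) \<in> borel_measurable borel"
    by (rule borel_measurable_continuous_onI)
  from measurable_sets[OF this A] have E: "E \<in> sets borel" by (simp add: E_def vimage_def)
  have per: "t + 1 \<in> E \<longleftrightarrow> t \<in> E" for t
  proof -
    have "cis (2 * pi * (t + 1)) = cis (2 * pi * t)"
      by (simp add: distrib_left cis_mult[symmetric])
    then show ?thesis by (simp add: E_def)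
  qed
  have rot: "cis (2 * pi * t) *s (c *s \<eta>) = cis (2 * pi * (t + s)) *s \<eta>" for t
    by (simp add: cs cis_mult distrib_left)
  have "{t \<in> {0..<1::real}. cis (2 * pi * t) *s (c *s \<eta>) \<in> A} = {t \<in> {0..<1}. t + s \<in> E}"
    unfolding rot E_def by simp
  then show ?thesis using emeasure_periodic_shift[OF E per s] by (simp add: E_def)
qed

lemma circle_bundle_closed: "closed (circle_bundle \<alpha>)"
proof -
  have "open {v. v \<noteq> 0 \<and> proj v \<in> - toric_variety \<alpha>}"
    using open_cproj_def[of "- toric_variety \<alpha>"] by (simp add: toric_variety_def open_Compl)
  moreover have "circle_bundle \<alpha> = {\<zeta>. norm \<zeta> = 1} \<inter> - {v. v \<noteq> 0 \<and> proj v \<in> - toric_variety \<alpha>}"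
    by (auto simp: circle_bundle_def)
  ultimately show ?thesis
    by (auto intro!: closed_Int closed_Collect_eq continuous_intros simp: closed_Compl)
qed

lemma circle_bundle_borel [measurable]: "circle_bundle \<alpha> \<in> sets borel"
  by (rule borel_closed[OF circle_bundle_closed])

lemma sets_circle_iff:
  "A \<in> sets (restrict_space borel (circle_bundle \<alpha>)) \<longleftrightarrow> A \<in> sets borel \<and> A \<subseteq> circle_bundle \<alpha>"
  by (subst sets_restrict_space_iff) auto

lemma rotate_in_circle_bundle:
  assumes "\<zeta> \<in> circle_bundle \<alpha>" "cmod c = 1" shows "c *s \<zeta> \<in> circle_bundle \<alpha>"
proof -
  have "c \<noteq> 0" using assms(2) by auto
  then show ?thesis using assms by (simp add: circle_bundle_def norm_vec_scale proj_scale)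
qed

lemma unit_rep_in_circle_bundle: "l \<in> toric_variety \<alpha> \<Longrightarrow> unit_rep l \<in> circle_bundle \<alpha>"
  by (simp add: circle_bundle_def unit_rep)

text \<open>A Borel section of the circle bundle over the affine part where the \<open>k\<close>-th coordinate is
  nonzero: there it is the unit vector whose \<open>k\<close>-th coordinate is positive.\<close>

definition positive_section :: "'k::finite \<Rightarrow> complex^'k \<Rightarrow> 'k cproj \<Rightarrow> complex^'k" where
  "positive_section k \<zeta>0 l = (if l \<in> {l. unit_rep l $ k \<noteq> 0}
     then (cnj (unit_rep l $ k) / cmod (unit_rep l $ k)) *s unit_rep l else \<zeta>0)"

lemma positive_section_measurable: "positive_section k \<zeta>0 \<in> borel_measurable borel"
proof -
  have "continuous_on {l. unit_rep l $ k \<noteq> 0} (\<lambda>l. (cnj (unit_rep l $ k) / cmod (unit_rep l $ k)) *s unit_rep l)"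
  proof (rule continuous_on_cproj[OF open_coord_nonzero])
    let ?S = "{\<zeta>. \<zeta> \<noteq> 0 \<and> proj \<zeta> \<in> {l. unit_rep l $ k \<noteq> 0}}"
    have "continuous_on ?S (\<lambda>\<zeta>. (cnj (\<zeta> $ k) / cmod (\<zeta> $ k) / of_real (norm \<zeta>)) *s \<zeta>)"
      unfolding vector_scalar_mult_def
      by (intro continuous_intros) (auto simp: unit_rep_proj_nonzero)
    then show "continuous_on ?S (\<lambda>\<zeta>. (cnj (unit_rep (proj \<zeta>) $ k) / cmod (unit_rep (proj \<zeta>) $ k)) *s unit_rep (proj \<zeta>))"
    proof (rule continuous_on_eq)
      fix \<zeta> assume "\<zeta> \<in> ?S"
      then have nz: "\<zeta> \<noteq> 0" and k: "\<zeta> $ k \<noteq> 0" by (auto simp: unit_rep_proj_nonzero)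
      obtain c where c: "c \<noteq> 0" "\<zeta> = c *s unit_rep (proj \<zeta>)"
        using proj_same[OF nz unit_rep(3) unit_rep(2)[symmetric]] by blast
      define \<eta> where "\<eta> = unit_rep (proj \<zeta>)"
      have \<zeta>: "\<zeta> = c *s \<eta>" using c(2) by (simp only: \<eta>_def)
      have n\<eta>: "norm \<eta> = 1" by (simp add: \<eta>_def unit_rep)
      have \<eta>k: "\<eta> $ k \<noteq> 0" using k \<zeta> by auto
      have "cnj c * c = of_real ((cmod c)\<^sup>2)" by (simp only: complex_norm_square mult.commute)
      then have "cnj (c * \<eta> $ k) / cmod (c * \<eta> $ k) / of_real (cmod c) * c = cnj (\<eta> $ k) / cmod (\<eta> $ k)"
        using c(1) \<eta>k by (simp add: norm_mult field_simps power2_eq_square)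
      then have "(cnj (\<zeta> $ k) / cmod (\<zeta> $ k) / of_real (norm \<zeta>)) *s \<zeta> = (cnj (\<eta> $ k) / cmod (\<eta> $ k)) *s \<eta>"
        unfolding \<zeta> norm_vec_scale n\<eta> by simp
      then show "(cnj (\<zeta> $ k) / cmod (\<zeta> $ k) / of_real (norm \<zeta>)) *s \<zeta> =
          (cnj (unit_rep (proj \<zeta>) $ k) / cmod (unit_rep (proj \<zeta>) $ k)) *s unit_rep (proj \<zeta>)"
        by (simp only: \<eta>_def)
    qed
  qed
  then show ?thesis
    unfolding positive_section_def[abs_def]
    by (rule borel_measurable_continuous_on_if[OF coord_nonzero_borel]) (rule continuous_on_const)
qed

lemma positive_section:
  assumes "unit_rep l $ k \<noteq> 0"
  obtains c where "cmod c = 1" "positive_section k \<zeta>0 l = c *s unit_rep l"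
  using assms that[of "cnj (unit_rep l $ k) / cmod (unit_rep l $ k)"]
  by (simp add: positive_section_def norm_divide)

definition unit_interval :: "real measure" where
  "unit_interval = restrict_space lborel {0..<1}"

lemma finite_measure_unit_interval: "finite_measure unit_interval"
  by (rule finite_measureI)
    (simp add: unit_interval_def space_restrict_space emeasure_restrict_space)

context toric_volume
begin

text \<open>The set function defining the circle volume is a measure, and it can be integrated by Fubini. The
  base points in \<open>fiber_measure\<close> are chosen without any measurability; outside a null set they can
  be replaced by those of a Borel section, after which the set function is the image of a product
  measure.\<close>

lemma circle_volume_eq_distr:
  fixes k :: 'k
  assumes "\<zeta>0 \<in> circle_bundle \<alpha>"
  defines "\<psi> \<equiv> (\<lambda>(l, t). cis (2 * pi * t) *s positive_section k \<zeta>0 l)"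
  shows "circle_volume \<alpha> V = distr (V \<Otimes>\<^sub>M unit_interval) (restrict_space borel (circle_bundle \<alpha>)) \<psi>"
    and "\<psi> \<in> V \<Otimes>\<^sub>M unit_interval \<rightarrow>\<^sub>M restrict_space borel (circle_bundle \<alpha>)"
    and "\<And>A. A \<in> sets (restrict_space borel (circle_bundle \<alpha>)) \<Longrightarrow>
      emeasure (circle_volume \<alpha> V) A = (\<integral>\<^sup>+ l. fiber_measure l A \<partial>V)"
proof -
  interpret U: finite_measure unit_interval by (rule finite_measure_unit_interval)
  let ?X = "restrict_space borel (circle_bundle \<alpha>)"
  let ?M = "V \<Otimes>\<^sub>M unit_interval"
  let ?D = "distr ?M ?X \<psi>"
  have sec: "positive_section k \<zeta>0 l \<in> circle_bundle \<alpha>" if "l \<in> toric_variety \<alpha>" for l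
  proof (cases "unit_rep l $ k = 0")
    case False
    then obtain c where "cmod c = 1" "positive_section k \<zeta>0 l = c *s unit_rep l"
      using positive_section by blast
    then show ?thesis using rotate_in_circle_bundle[OF unit_rep_in_circle_bundle[OF \<open>l \<in> _\<close>]] by metis
  qed (simp add: positive_section_def assms)
  have idV: "(\<lambda>l. l) \<in> V \<rightarrow>\<^sub>M borel"
    unfolding measurable_cong_sets[OF sets_V refl] by (rule measurable_restrict_space1) simp
  have secV: "positive_section k \<zeta>0 \<in> V \<rightarrow>\<^sub>M borel"
    using measurable_compose[OF idV positive_section_measurable] by simp
  have "(\<lambda>x. positive_section k \<zeta>0 (fst x)) \<in> ?M \<rightarrow>\<^sub>M borel"
    by (rule measurable_compose[OF measurable_fst secV])
  moreover have "(\<lambda>x. snd x) \<in> ?M \<rightarrow>\<^sub>M (borel :: real measure)"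
  proof -
    have "(\<lambda>t. t) \<in> unit_interval \<rightarrow>\<^sub>M (borel :: real measure)"
      unfolding unit_interval_def by (rule measurable_restrict_space1) simp
    then show ?thesis using measurable_compose[OF measurable_snd] by blast
  qed
  moreover have "continuous_on UNIV (\<lambda>x :: (complex^'k) \<times> real. cis (2 * pi * snd x) *s fst x)"
    unfolding cis_conv_exp vector_scalar_mult_def by (intro continuous_intros)
  ultimately have "(\<lambda>x. cis (2 * pi * snd x) *s positive_section k \<zeta>0 (fst x)) \<in> ?M \<rightarrow>\<^sub>M borel"
    by (rule borel_measurable_continuous_Pair)
  then have "\<psi> \<in> ?M \<rightarrow>\<^sub>M borel" by (simp add: \<psi>_def case_prod_beta')
  moreover have "\<psi> \<in> space ?M \<rightarrow> circle_bundle \<alpha>"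
    using sec by (auto simp: \<psi>_def space_pair_measure space_V intro!: rotate_in_circle_bundle)
  ultimately show \<psi>: "\<psi> \<in> ?M \<rightarrow>\<^sub>M ?X" by (intro measurable_restrict_space2)
  have em: "emeasure ?D A = (\<integral>\<^sup>+ l. fiber_measure l A \<partial>V)" if A: "A \<in> sets ?X" for A
  proof -
    have Ab: "A \<in> sets borel" using A by (simp add: sets_circle_iff)
    have "emeasure ?D A = emeasure ?M (\<psi> -` A \<inter> space ?M)"
      using \<psi> A by (rule emeasure_distr)
    also have "\<dots> = (\<integral>\<^sup>+ l. emeasure unit_interval (Pair l -` (\<psi> -` A \<inter> space ?M)) \<partial>V)"
      by (rule U.emeasure_pair_measure_alt) (rule measurable_sets[OF \<psi> A])
    also have "\<dots> = (\<integral>\<^sup>+ l. fiber_measure l A \<partial>V)"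
    proof (rule nn_integral_cong_AE, rule AE_mp[OF AE_orbit], rule AE_I2, rule impI)
      fix l assume l: "l \<in> space V" "l \<in> orbit \<alpha>"
      then obtain c where c: "cmod c = 1" "positive_section k \<zeta>0 l = c *s unit_rep l"
        using positive_section[of l k] by (auto simp: orbit_def)
      have "Pair l -` (\<psi> -` A \<inter> space ?M) = {t \<in> {0..<1}. cis (2 * pi * t) *s (c *s unit_rep l) \<in> A}"
        using l by (auto simp: \<psi>_def c(2) space_pair_measure unit_interval_def space_restrict_space)
      then have "emeasure unit_interval (Pair l -` (\<psi> -` A \<inter> space ?M)) =
          emeasure lborel {t \<in> {0..<1}. cis (2 * pi * t) *s (c *s unit_rep l) \<in> A}"
        unfolding unit_interval_def by (simp only:) (subst emeasure_restrict_space, auto)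
      also have "\<dots> = fiber_measure l A"
        unfolding fiber_measure_independent[OF Ab c(1)] fiber_measure_def unit_rep_def ..
      finally show "emeasure unit_interval (Pair l -` (\<psi> -` A \<inter> space ?M)) = fiber_measure l A" .
    qed
    finally show ?thesis .
  qed
  have "circle_volume \<alpha> V = measure_of (circle_bundle \<alpha>) (sets ?X) (emeasure ?D)"
    unfolding circle_volume_def
  proof (rule measure_of_eq)
    show "sets ?X \<subseteq> Pow (circle_bundle \<alpha>)" by (auto simp: sets_circle_iff)
    fix A assume "A \<in> sigma_sets (circle_bundle \<alpha>) (sets ?X)"
    moreover have "sigma_sets (circle_bundle \<alpha>) (sets ?X) = sets ?X"
      using sets.sigma_sets_eq[of ?X] by (simp add: space_restrict_space)
    ultimately show "(\<integral>\<^sup>+ l. fiber_measure l A \<partial>V) = emeasure ?D A" by (simp add: em)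
  qed
  also have "\<dots> = ?D"
    using measure_of_of_measure[of ?D] by (simp add: space_restrict_space)
  finally show "circle_volume \<alpha> V = ?D" .
  then show "emeasure (circle_volume \<alpha> V) A = (\<integral>\<^sup>+ l. fiber_measure l A \<partial>V)" if "A \<in> sets ?X" for A
    using em[OF that] by simp
qed

lemma circle_bundle_nonempty: "\<exists>\<zeta>0. \<zeta>0 \<in> circle_bundle \<alpha>"
proof -
  have "proj (monomials \<alpha> (\<chi> i. 1)) \<in> toric_variety \<alpha>"
    by (rule proj_monomials_in_toric) (simp add: torus_def)
  then show ?thesis using unit_rep_in_circle_bundle by blast
qed

abbreviation "circ \<equiv> circle_volume \<alpha> V"

lemma sets_circ: "sets circ = sets (restrict_space borel (circle_bundle \<alpha>))"
  using circle_bundle_nonempty circle_volume_eq_distr(1) by (metis sets_distr)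

lemma space_circ: "space circ = circle_bundle \<alpha>"
  using sets_eq_imp_space_eq[OF sets_circ] by (simp add: space_restrict_space)

lemma proj_measurable: "proj \<in> circ \<rightarrow>\<^sub>M V"
proof -
  have "continuous_on (circle_bundle \<alpha>) proj"
    by (rule continuous_on_subset[OF continuous_on_proj]) (auto simp: circle_bundle_def)
  then have "proj \<in> restrict_space borel (circle_bundle \<alpha>) \<rightarrow>\<^sub>M borel"
    by (rule borel_measurable_continuous_on_restrict)
  then show ?thesis
    unfolding measurable_cong_sets[OF sets_circ sets_V]
    by (intro measurable_restrict_space2) (auto simp: space_restrict_space circle_bundle_def)
qed

lemma distr_circ_proj: "distr circ V proj = V"
proof (rule measure_eqI)
  fix B assume "B \<in> sets (distr circ V proj)"
  then have B: "B \<in> sets V" by simp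
  have "emeasure (distr circ V proj) B = emeasure circ (proj -` B \<inter> space circ)"
    by (rule emeasure_distr[OF proj_measurable B])
  also have "\<dots> = (\<integral>\<^sup>+ l. fiber_measure l (proj -` B \<inter> space circ) \<partial>V)"
    using circle_bundle_nonempty measurable_sets[OF proj_measurable B] sets_circ circle_volume_eq_distr(3) by metis
  also have "\<dots> = (\<integral>\<^sup>+ l. indicator B l \<partial>V)"
  proof (rule nn_integral_cong)
    fix l assume "l \<in> space V"
    then have l: "l \<in> toric_variety \<alpha>" by (simp add: space_V)
    have p: "proj (cis (2 * pi * t) *s unit_rep l) = l" for t
      by (simp add: proj_scale unit_rep)
    have "{t \<in> {0..<1::real}. cis (2 * pi * t) *s unit_rep l \<in> proj -` B \<inter> space circ} =
        (if l \<in> B then {0..<1} else {})"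
      using l by (auto simp: p space_circ intro!: rotate_in_circle_bundle unit_rep_in_circle_bundle)
    then show "fiber_measure l (proj -` B \<inter> space circ) = indicator B l"
      unfolding fiber_measure_def unit_rep_def[symmetric] by simp
  qed
  also have "\<dots> = emeasure V B" using B by simp
  finally show "emeasure (distr circ V proj) B = emeasure V B" .
qed simp

lemma finite_measure_circ: "finite_measure circ"
proof
  have "emeasure circ (space circ) = emeasure (distr circ V proj) (space V)"
    using proj_measurable by (subst emeasure_distr) (auto intro!: arg_cong[of _ _ "emeasure circ"] dest: measurable_space)
  also have "\<dots> = emeasure V (space V)" by (simp add: distr_circ_proj)
  finally show "emeasure circ (space circ) \<noteq> \<infinity>"
    using finite_measure.emeasure_finite[OF finite_measure_V] by simp
qed

text \<open>Integrals of circle-invariant functions are integrals over the toric variety.\<close>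

lemma integral_circ_proj:
  fixes h :: "'k cproj \<Rightarrow> 'b::{banach, second_countable_topology}"
  assumes "h \<in> borel_measurable V"
  shows "(\<integral>\<zeta>. h (proj \<zeta>) \<partial>circ) = (\<integral>l. h l \<partial>V)"
  using integral_distr[OF proj_measurable assms] by (simp add: distr_circ_proj)

end

section \<open>Separately polynomial functions on the torus\<close>

definition unity_root :: "nat \<Rightarrow> nat \<Rightarrow> complex" where
  "unity_root q i = cis (2 * pi * real i / real q)"

lemma unity_root_nonzero [simp]: "unity_root q i \<noteq> 0"
  by (simp add: unity_root_def)

lemma norm_unity_root [simp]: "cmod (unity_root q i) = 1"
  by (simp add: unity_root_def)

lemma sum_unity_roots:
  assumes "k < q" "l < q"
  shows "(\<Sum>i<q. unity_root q i ^ k * inverse (unity_root q i) ^ l) = (if k = l then of_nat q else 0)"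
proof (cases "k = l")
  case True
  have "unity_root q i ^ k * inverse (unity_root q i) ^ k = 1" for i
    by (simp add: power_mult_distrib[symmetric])
  then show ?thesis using True by simp
next
  case False
  define x where "x = unity_root q 1 ^ k * inverse (unity_root q 1) ^ l"
  have root: "unity_root q i = unity_root q 1 ^ i" for i
  proof -
    have "unity_root q 1 ^ i = cis (real i * (2 * pi * real 1 / real q))"
      unfolding unity_root_def by (rule Complex.DeMoivre)
    also have "real i * (2 * pi * real 1 / real q) = 2 * pi * real i / real q" by simp
    finally show ?thesis by (simp only: unity_root_def)
  qed
  have "unity_root q i ^ k * inverse (unity_root q i) ^ l = x ^ i" for i
    unfolding x_def root[of i]
    by (simp add: power_mult_distrib power_inverse power_mult[symmetric] mult.commute)
  then have sum: "(\<Sum>i<q. unity_root q i ^ k * inverse (unity_root q i) ^ l) = (\<Sum>i<q. x ^ i)" by simp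
  have "unity_root q 1 ^ q = 1"
    using assms by (simp add: unity_root_def Complex.DeMoivre)
  then have xq: "x ^ q = 1"
    unfolding x_def power_mult_distrib power_mult[symmetric]
    by (simp add: mult.commute[of _ q] power_mult power_inverse)
  have "x \<noteq> 1"
  proof
    assume "x = 1"
    then have "unity_root q k = unity_root q l"
      unfolding x_def root[of k] root[of l] by (simp add: power_inverse field_simps)
    moreover have "inj_on (\<lambda>i. cis (2 * pi * real i / real q)) {..<q}"
      using assms Complex.bij_betw_roots_unity[of q] by (auto simp: bij_betw_def)
    ultimately show False
      using assms False unfolding unity_root_def inj_on_def by blast
  qed
  then have "(\<Sum>i<q. x ^ i) = 0" using xq geometric_sum[of x q] by simp
  then show ?thesis using sum False by simp
qed

text \<open>The Lagrange polynomials for the nodes given by the \<open>q\<close>-th roots of unity.\<close>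

definition interpolation_poly :: "nat \<Rightarrow> nat \<Rightarrow> complex \<Rightarrow> complex" where
  "interpolation_poly q i t = (\<Sum>k<q. inverse (unity_root q i) ^ k / of_nat q * t ^ k)"

lemma interpolation_at_unity_roots:
  assumes "\<And>t. t \<noteq> 0 \<Longrightarrow> p t = (\<Sum>k<q. c k * t ^ k)" "t \<noteq> 0"
  shows "p t = (\<Sum>i<q. p (unity_root q i) * interpolation_poly q i t)"
proof -
  have "(\<Sum>i<q. p (unity_root q i) * interpolation_poly q i t) =
      (\<Sum>i<q. \<Sum>l<q. \<Sum>k<q. c l * unity_root q i ^ l * (inverse (unity_root q i) ^ k / of_nat q * t ^ k))"
    by (simp add: assms(1) interpolation_poly_def sum_product sum_distrib_right sum_distrib_left sum_divide_distrib mult.assoc)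
      (rule sum.cong[OF refl], rule sum.swap)
  also have "\<dots> = (\<Sum>l<q. \<Sum>k<q. \<Sum>i<q. c l * unity_root q i ^ l * (inverse (unity_root q i) ^ k / of_nat q * t ^ k))"
    by (subst sum.swap, rule sum.cong[OF refl], rule sum.swap)
  also have "\<dots> = (\<Sum>l<q. \<Sum>k<q. c l * t ^ k / of_nat q * (\<Sum>i<q. unity_root q i ^ l * inverse (unity_root q i) ^ k))"
    by (simp add: sum_distrib_left mult_ac)
  also have "\<dots> = (\<Sum>l<q. \<Sum>k<q. c l * t ^ k / of_nat q * (if l = k then of_nat q else 0))"
    by (intro sum.cong refl) (simp add: sum_unity_roots)
  also have "\<dots> = (\<Sum>l<q. c l * t ^ l)"
    by (intro sum.cong refl) (simp add: if_distrib[of "\<lambda>x. _ * x"] sum.delta cong: if_cong)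
  finally show ?thesis using assms by simp
qed

definition update :: "complex^'m \<Rightarrow> 'm \<Rightarrow> complex \<Rightarrow> complex^'m" where
  "update z j t = (\<chi> i. if i = j then t else z $ i)"

text \<open>Polynomial of degree less than \<open>q\<close> in each variable while the others are fixed, the coefficients
  being arbitrary functions of the other variables.\<close>

definition separately_polynomial :: "nat \<Rightarrow> (complex^'m \<Rightarrow> complex) \<Rightarrow> bool" where
  "separately_polynomial q f \<longleftrightarrow>
     (\<forall>z\<in>torus. \<forall>j. \<exists>c. \<forall>t. t \<noteq> 0 \<longrightarrow> f (update z j t) = (\<Sum>k<q. c k * t ^ k))"

lemma update_self: "update z j (z $ j) = z"
  by (simp add: update_def vec_eq_iff)

lemma update_torus: "z \<in> torus \<Longrightarrow> t \<noteq> 0 \<Longrightarrow> update z j t \<in> torus"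
  by (simp add: update_def torus_def)

lemma sum_PiE_insert:
  assumes "j \<notin> J"
  shows "(\<Sum>x\<in>PiE (insert j J) S. F x) = (\<Sum>x\<in>PiE J S. \<Sum>i\<in>S j. F (x(j := i)))"
proof -
  have "(\<Sum>x\<in>PiE (insert j J) S. F x) = (\<Sum>(i, x)\<in>S j \<times> PiE J S. F (x(j := i)))"
    unfolding PiE_insert_eq
    by (subst sum.reindex[OF inj_combinator[OF assms]]) (simp add: case_prod_beta' o_def)
  also have "\<dots> = (\<Sum>i\<in>S j. \<Sum>x\<in>PiE J S. F (x(j := i)))" by (rule sum.cartesian_product[symmetric])
  also have "\<dots> = (\<Sum>x\<in>PiE J S. \<Sum>i\<in>S j. F (x(j := i)))" by (rule sum.swap)
  finally show ?thesis .
qed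

text \<open>Interpolation at roots of unity in one variable after another expresses such a function by its
  values at finitely many points, and so shows that it is jointly polynomial.\<close>

lemma separately_polynomial_interpolation:
  assumes f: "separately_polynomial q f" and "finite J" and z: "z \<in> torus"
  shows "f z = (\<Sum>x\<in>PiE J (\<lambda>_. {..<q}). f (\<chi> j. if j \<in> J then unity_root q (x j) else z $ j) *
    (\<Prod>j\<in>J. interpolation_poly q (x j) (z $ j)))"
  using \<open>finite J\<close>
proof (induction J)
  case empty
  then show ?case by simp
next
  case (insert j J)
  let ?y = "\<lambda>x. \<chi> i. if i \<in> J then unity_root q (x i) else z $ i"
  let ?L = "\<lambda>x. \<Prod>i\<in>J. interpolation_poly q (x i) (z $ i)"
  have step: "f (?y x) = (\<Sum>i<q. f (update (?y x) j (unity_root q i)) * interpolation_poly q i (z $ j))" for x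
  proof -
    have y: "?y x \<in> torus" using z by (simp add: torus_def)
    then obtain c where "\<And>t. t \<noteq> 0 \<Longrightarrow> f (update (?y x) j t) = (\<Sum>k<q. c k * t ^ k)"
      using f unfolding separately_polynomial_def by metis
    then have "f (update (?y x) j (z $ j)) =
        (\<Sum>i<q. f (update (?y x) j (unity_root q i)) * interpolation_poly q i (z $ j))"
      by (rule interpolation_at_unity_roots) (use z in \<open>simp_all add: torus_def\<close>)
    moreover have "update (?y x) j (z $ j) = ?y x"
      using update_self[of "?y x" j] insert.hyps by simp
    ultimately show ?thesis by simp
  qed
  have upd: "update (?y x) j (unity_root q i) =
      (\<chi> i'. if i' \<in> insert j J then unity_root q ((x(j := i)) i') else z $ i')" for x i
    using insert.hyps by (auto simp: update_def vec_eq_iff)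
  have Lupd: "?L x * interpolation_poly q i (z $ j) =
      (\<Prod>i'\<in>insert j J. interpolation_poly q ((x(j := i)) i') (z $ i'))" for x i
  proof -
    have "(\<Prod>i'\<in>J. interpolation_poly q ((x(j := i)) i') (z $ i')) = ?L x"
      using insert.hyps by (intro prod.cong) auto
    then show ?thesis using insert.hyps by (simp add: mult.commute)
  qed
  have "f z = (\<Sum>x\<in>PiE J (\<lambda>_. {..<q}). f (?y x) * ?L x)" by (rule insert.IH)
  also have "\<dots> = (\<Sum>x\<in>PiE J (\<lambda>_. {..<q}). \<Sum>i<q.
      f (\<chi> i'. if i' \<in> insert j J then unity_root q ((x(j := i)) i') else z $ i') *
      (\<Prod>i'\<in>insert j J. interpolation_poly q ((x(j := i)) i') (z $ i')))"
  proof (rule sum.cong[OF refl])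
    fix x
    show "f (?y x) * ?L x = (\<Sum>i<q.
      f (\<chi> i'. if i' \<in> insert j J then unity_root q ((x(j := i)) i') else z $ i') *
      (\<Prod>i'\<in>insert j J. interpolation_poly q ((x(j := i)) i') (z $ i')))"
      unfolding step[of x] sum_distrib_right upd Lupd[symmetric]
      by (intro sum.cong refl) (simp only: mult_ac)
  qed
  finally show ?case
    unfolding sum_PiE_insert[OF insert.hyps(2)] .
qed

text \<open>Computed from the values at the \<open>q\<close>-th roots of unity alone; for a polynomial of degree less
  than \<open>q\<close> in each variable these are its coefficients.\<close>

abbreviation multi_indices :: "nat \<Rightarrow> ('m \<Rightarrow> nat) set" where
  "multi_indices q \<equiv> PiE UNIV (\<lambda>_. {..<q})"

definition fourier_coeff :: "nat \<Rightarrow> (complex^'m \<Rightarrow> complex) \<Rightarrow> ('m \<Rightarrow> nat) \<Rightarrow> complex" where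
  "fourier_coeff q f p = (\<Sum>x\<in>multi_indices q. f (\<chi> j. unity_root q (x j)) *
     (\<Prod>j\<in>UNIV. inverse (unity_root q (x j)) ^ p j / of_nat q))"

lemma separately_polynomial_expansion:
  assumes f: "separately_polynomial q f" and z: "z \<in> torus"
  shows "f z = (\<Sum>p\<in>multi_indices q. fourier_coeff q f p * (\<Prod>j\<in>UNIV. z $ j ^ p j))"
proof -
  have L: "(\<Prod>j\<in>UNIV. interpolation_poly q (x j) (z $ j)) = (\<Sum>p\<in>multi_indices q.
      (\<Prod>j\<in>UNIV. inverse (unity_root q (x j)) ^ p j / of_nat q) * (\<Prod>j\<in>UNIV. z $ j ^ p j))" for x
    unfolding interpolation_poly_def
    by (subst prod_sum_PiE) (simp_all only: prod.distrib finite finite_lessThan)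
  have "f z = (\<Sum>x\<in>multi_indices q. f (\<chi> j. unity_root q (x j)) *
      (\<Prod>j\<in>UNIV. interpolation_poly q (x j) (z $ j)))"
    using separately_polynomial_interpolation[OF f finite z, of UNIV] by simp
  also have "\<dots> = (\<Sum>x\<in>multi_indices q. \<Sum>p\<in>multi_indices q. f (\<chi> j. unity_root q (x j)) *
      (\<Prod>j\<in>UNIV. inverse (unity_root q (x j)) ^ p j / of_nat q) * (\<Prod>j\<in>UNIV. z $ j ^ p j))"
    unfolding L by (simp only: sum_distrib_left mult.assoc)
  also have "\<dots> = (\<Sum>p\<in>multi_indices q. \<Sum>x\<in>multi_indices q. f (\<chi> j. unity_root q (x j)) *
      (\<Prod>j\<in>UNIV. inverse (unity_root q (x j)) ^ p j / of_nat q) * (\<Prod>j\<in>UNIV. z $ j ^ p j))"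
    by (rule sum.swap)
  finally show ?thesis by (simp only: fourier_coeff_def sum_distrib_right)
qed

text \<open>Averaging over rotations by roots of unity isolates one monomial.\<close>

lemma fourier_coeff_isolates:
  assumes f: "separately_polynomial q f" and y: "y \<in> torus" and p: "p \<in> multi_indices q"
  shows "(\<Sum>x\<in>multi_indices q. f (\<chi> j. unity_root q (x j) * y $ j) *
     (\<Prod>j\<in>UNIV. inverse (unity_root q (x j)) ^ p j / of_nat q)) =
     fourier_coeff q f p * (\<Prod>j\<in>UNIV. y $ j ^ p j)"
proof -
  have q: "0 < q" using p by (auto simp: PiE_iff dest: spec[of _ undefined])
  have R: "(\<chi> j. unity_root q (x j) * y $ j) \<in> torus" for x using y by (simp add: torus_def)
  have ortho: "(\<Sum>x\<in>multi_indices q. \<Prod>j\<in>UNIV. unity_root q (x j) ^ r j * (inverse (unity_root q (x j)) ^ p j / of_nat q))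
      = (if r = p then 1 else 0)" if r: "r \<in> multi_indices q" for r
  proof -
    have "(\<Sum>x\<in>multi_indices q. \<Prod>j\<in>UNIV. unity_root q (x j) ^ r j * (inverse (unity_root q (x j)) ^ p j / of_nat q))
        = (\<Prod>j\<in>UNIV. \<Sum>i<q. unity_root q i ^ r j * (inverse (unity_root q i) ^ p j / of_nat q))"
      by (rule prod_sum_PiE[symmetric]) auto
    also have "\<dots> = (\<Prod>j\<in>UNIV. if r j = p j then 1 else 0)"
    proof (rule prod.cong[OF refl])
      fix j
      have "r j < q" "p j < q" using r p by (auto simp: PiE_iff)
      then show "(\<Sum>i<q. unity_root q i ^ r j * (inverse (unity_root q i) ^ p j / of_nat q)) = (if r j = p j then 1 else 0)"
        using q sum_unity_roots[of "r j" q "p j"]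
        by (simp add: sum_divide_distrib[symmetric] del: power_inverse)
    qed
    also have "\<dots> = (if r = p then 1 else 0)"
    proof (cases "r = p")
      case False
      then obtain j where "r j \<noteq> p j" by auto
      then show ?thesis using False by (auto intro!: prod_zero)
    qed simp
    finally show ?thesis .
  qed
  have "(\<Sum>x\<in>multi_indices q. f (\<chi> j. unity_root q (x j) * y $ j) *
      (\<Prod>j\<in>UNIV. inverse (unity_root q (x j)) ^ p j / of_nat q)) =
    (\<Sum>x\<in>multi_indices q. \<Sum>r\<in>multi_indices q. fourier_coeff q f r * (\<Prod>j\<in>UNIV. y $ j ^ r j) *
      (\<Prod>j\<in>UNIV. unity_root q (x j) ^ r j * (inverse (unity_root q (x j)) ^ p j / of_nat q)))"
    unfolding separately_polynomial_expansion[OF f R] sum_distrib_right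
    by (intro sum.cong refl) (simp only: power_mult_distrib prod.distrib mult_ac vec_lambda_beta)
  also have "\<dots> = (\<Sum>r\<in>multi_indices q. \<Sum>x\<in>multi_indices q. fourier_coeff q f r * (\<Prod>j\<in>UNIV. y $ j ^ r j) *
      (\<Prod>j\<in>UNIV. unity_root q (x j) ^ r j * (inverse (unity_root q (x j)) ^ p j / of_nat q)))"
    by (rule sum.swap)
  also have "\<dots> = (\<Sum>r\<in>multi_indices q. fourier_coeff q f r * (\<Prod>j\<in>UNIV. y $ j ^ r j) * (if r = p then 1 else 0))"
    by (intro sum.cong refl) (simp only: sum_distrib_left[symmetric] ortho)
  also have "\<dots> = fourier_coeff q f p * (\<Prod>j\<in>UNIV. y $ j ^ p j)"
    using p by (simp add: if_distrib[of "\<lambda>x. _ * x"] finite_PiE cong: if_cong)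
  finally show ?thesis .
qed

text \<open>Since a term of the expansion is an average of rotated copies of \<open>f\<close>, it obeys any bound that
  depends only on the moduli of the coordinates. This reads off from the growth of \<open>f\<close> which
  exponents can occur.\<close>

lemma fourier_coeff_bound:
  fixes f :: "complex^'m \<Rightarrow> complex"
  assumes f: "separately_polynomial q f" and y: "y \<in> torus" and p: "p \<in> multi_indices q"
    and B: "\<And>e. (\<And>j. cmod (e $ j) = 1) \<Longrightarrow> cmod (f (\<chi> j. e $ j * y $ j)) \<le> B"
  shows "cmod (fourier_coeff q f p * (\<Prod>j\<in>UNIV. y $ j ^ p j)) \<le>
    real (card (multi_indices q :: ('m \<Rightarrow> nat) set)) * (\<Prod>j\<in>(UNIV::'m set). 1 / real q) * B"
proof -
  have "cmod (fourier_coeff q f p * (\<Prod>j\<in>UNIV. y $ j ^ p j)) \<le>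
     (\<Sum>x\<in>multi_indices q. cmod (f (\<chi> j. unity_root q (x j) * y $ j) *
     (\<Prod>j\<in>UNIV. inverse (unity_root q (x j)) ^ p j / of_nat q)))"
    unfolding fourier_coeff_isolates[OF f y p, symmetric] by (rule norm_sum)
  also have "\<dots> \<le> (\<Sum>x\<in>(multi_indices q :: ('m \<Rightarrow> nat) set). B * (\<Prod>j\<in>(UNIV::'m set). 1 / real q))"
  proof (rule sum_mono)
    fix x :: "'m \<Rightarrow> nat"
    have "cmod (f (\<chi> j. unity_root q (x j) * y $ j)) \<le> B"
      using B[of "\<chi> j. unity_root q (x j)"] by simp
    then show "cmod (f (\<chi> j. unity_root q (x j) * y $ j) *
        (\<Prod>j\<in>UNIV. inverse (unity_root q (x j)) ^ p j / of_nat q)) \<le> B * (\<Prod>j\<in>(UNIV::'m set). 1 / real q)"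
      unfolding norm_mult prod_norm[symmetric] norm_divide norm_power norm_inverse
      using order_trans[OF norm_ge_zero] by (intro mult_mono) (auto intro!: prod_nonneg)
  qed
  finally show ?thesis by (simp add: mult_ac)
qed

section \<open>Holomorphic sections are combinations of monomials\<close>

lemma cmonom_axis:
  "cmonom (\<chi> i. if i = j then t else 1) a = t powi (a $ j)"
  by (simp add: cmonom_def if_distrib[of "\<lambda>x. x powi _"] cong: if_cong)

lemma cmonom_update:
  assumes "t \<noteq> 0"
  shows "cmonom (update z j t) a = cmonom (update z j 1) a * t powi (a $ j)"
proof -
  have "update z j t = (\<chi> i. update z j 1 $ i * (\<chi> i. if i = j then t else 1) $ i)"
    by (simp add: update_def vec_eq_iff)
  then show ?thesis using cmonom_mult cmonom_axis by metis
qed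

lemma cmonom_of_nat: "cmonom z (\<chi> j. int (p j)) = (\<Prod>j\<in>UNIV. z $ j ^ p j)"
  by (simp add: cmonom_def)

lemma norm_cmonom_unimodular: "(\<And>j. cmod (e $ j) = 1) \<Longrightarrow> cmod (cmonom e a) = 1"
  by (simp add: cmonom_def prod_norm[symmetric] norm_power_int)

lemma holomorphic_compose_vec:
  fixes G :: "complex^'m \<Rightarrow> complex"
  assumes G: "holo_on G UNIV" and g: "\<And>i. (\<lambda>t. g t $ i) holomorphic_on UNIV"
  shows "(\<lambda>t. G (g t)) holomorphic_on UNIV"
proof -
  have "\<exists>d. ((\<lambda>t. G (g t)) has_field_derivative d) (at t)" for t
  proof -
    obtain D where D: "(G has_derivative D) (at (g t))" "\<And>c v. D (c *s v) = c * D v"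
      using G unfolding holo_on_def by blast
    have "\<exists>d. ((\<lambda>t. g t $ i) has_field_derivative d) (at t)" for i
      using g[of i] unfolding holomorphic_on_def field_differentiable_def by auto
    then obtain d where d: "\<And>i. ((\<lambda>t. g t $ i) has_field_derivative d i) (at t)" by metis
    have "((\<lambda>t. \<chi> i. g t $ i) has_derivative (\<lambda>h. \<chi> i. d i * h)) (at t)"
      by (rule has_derivative_vec_lambda) (use d in \<open>simp add: has_field_derivative_def\<close>)
    then have "(g has_derivative (\<lambda>h. h *s (\<chi> i. d i))) (at t)"
      by (simp add: vector_scalar_mult_def mult.commute)
    from has_derivative_compose[OF this D(1)]
    have "((\<lambda>t. G (g t)) has_derivative (\<lambda>h. h * D (\<chi> i. d i))) (at t)" by (simp add: D(2))
    then have "((\<lambda>t. G (g t)) has_field_derivative D (\<chi> i. d i)) (at t)"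
      by (simp add: has_field_derivative_def mult.commute[of _ "D _"])
    then show ?thesis by blast
  qed
  then show ?thesis unfolding holomorphic_on_def field_differentiable_def by simp
qed

text \<open>The pairing of a section with the frame of \<open>O(-N)\<close> over the torus given by the monomials.\<close>

definition torus_value :: "('k::finite \<Rightarrow> int^'m) \<Rightarrow> ('k cproj \<Rightarrow> complex^'k \<Rightarrow> complex) \<Rightarrow> complex^'m \<Rightarrow> complex" where
  "torus_value \<alpha> s z = s (proj (monomials \<alpha> z)) (monomials \<alpha> z)"

lemma hol_sections_scale:
  assumes "s \<in> hol_sections \<alpha> N" "proj \<zeta> \<in> toric_variety \<alpha>" "\<zeta> \<noteq> 0" "c \<noteq> 0"
  shows "s (proj (c *s \<zeta>)) (c *s \<zeta>) = c ^ N * s (proj \<zeta>) \<zeta>"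
  using assms mem_line_proj[OF assms(3)] unfolding hol_sections_def by (simp add: proj_scale)

context vertex_frame
begin

definition chart_value :: "('k cproj \<Rightarrow> complex^'k \<Rightarrow> complex) \<Rightarrow> complex^'m \<Rightarrow> complex" where
  "chart_value s w = s (proj (chart w)) (chart w)"

lemma holo_on_chart_value:
  assumes "s \<in> hol_sections \<alpha> N" shows "holo_on (chart_value s) UNIV"
proof -
  have "hol_param \<alpha> UNIV chart"
    using hol_param_dchart[of "\<chi> j. 1"] by (simp add: torus_def dchart_one)
  then show ?thesis using assms unfolding hol_sections_def chart_value_def[abs_def] by blast
qed

lemma continuous_on_chart_value:
  assumes "s \<in> hol_sections \<alpha> N" shows "continuous_on S (chart_value s)"
  using holo_on_imp_continuous_on[OF holo_on_chart_value[OF assms]] continuous_on_subset by blast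

lemma torus_value_chart:
  assumes "s \<in> hol_sections \<alpha> N" "z \<in> torus"
  shows "torus_value \<alpha> s z = cmonom z (\<alpha> kv) ^ N * chart_value s (to_chart z)"
  unfolding torus_value_def chart_value_def monomials_chart[OF assms(2)]
  by (rule hol_sections_scale[OF assms(1) proj_chart_in_toric chart_nonzero cmonom_nonzero[OF assms(2)]])

text \<open>In the chart the section is a continuous function, which is bounded on a closed polydisc.\<close>

lemma torus_value_bound:
  assumes s: "s \<in> hol_sections \<alpha> N"
  obtains K where "0 \<le> K" "\<And>z. z \<in> torus \<Longrightarrow> (\<And>j. cmod (cmonom z (u j)) \<le> R) \<Longrightarrow>
    cmod (torus_value \<alpha> s z) \<le> K * cmod (cmonom z (\<alpha> kv)) ^ N"
proof -
  have "compact (chart_value s ` {w. \<forall>j. cmod (w $ j) \<le> R})"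
    by (rule compact_continuous_image[OF continuous_on_chart_value[OF s] compact_polydisc])
  then obtain K where K: "\<And>w. (\<forall>j. cmod (w $ j) \<le> R) \<Longrightarrow> cmod (chart_value s w) \<le> K"
    using compact_imp_bounded by (force simp: bounded_iff)
  show thesis
  proof (rule that[of "max 0 K"])
    fix z assume z: "z \<in> torus" "\<And>j. cmod (cmonom z (u j)) \<le> R"
    have "cmod (chart_value s (to_chart z)) \<le> K" using z(2) by (intro K) (simp add: to_chart_def)
    then have "cmod (cmonom z (\<alpha> kv)) ^ N * cmod (chart_value s (to_chart z)) \<le> cmod (cmonom z (\<alpha> kv)) ^ N * max 0 K"
      by (intro mult_left_mono) auto
    then show "cmod (torus_value \<alpha> s z) \<le> max 0 K * cmod (cmonom z (\<alpha> kv)) ^ N"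
      unfolding torus_value_chart[OF s z(1)] by (simp add: norm_mult norm_power mult.commute)
  qed simp
qed

end

context toric_data
begin

text \<open>Not less than \<open>N\<close> times any coordinate of any lattice point of the polytope.\<close>

definition degree_bound :: "nat \<Rightarrow> nat" where
  "degree_bound N = N * (\<Sum>k\<in>UNIV. \<Sum>j\<in>UNIV. nat (\<alpha> k $ j))"

lemma \<alpha>_nonneg: "0 \<le> \<alpha> k $ j"
  using P_nonneg[OF \<alpha>_in_P, of k j] by (simp add: of_ivec_def)

lemma degree_bound: "N * nat (\<alpha> k $ j) \<le> degree_bound N"
proof -
  have "nat (\<alpha> k $ j) \<le> (\<Sum>j\<in>UNIV. nat (\<alpha> k $ j))" by (rule member_le_sum) auto
  also have "\<dots> \<le> (\<Sum>k\<in>UNIV. \<Sum>j\<in>UNIV. nat (\<alpha> k $ j))" by (rule member_le_sum) auto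
  finally show ?thesis by (simp add: degree_bound_def)
qed

lemma inner_axis_ivec: "axis j 1 \<bullet> of_ivec a = real_of_int (a $ j)"
  by (simp add: inner_axis' of_ivec_def)

text \<open>In one variable \<open>t\<close> the function extends to an entire function of polynomial growth, because
  \<open>t = 0\<close> and \<open>t = \<infinity>\<close> are seen in the charts at the vertices with the least and the greatest
  \<open>j\<close>-th coordinate. Liouville's theorem applies.\<close>

lemma torus_value_separately_polynomial:
  assumes s: "s \<in> hol_sections \<alpha> N"
  shows "separately_polynomial (Suc (degree_bound N)) (torus_value \<alpha> s)"
  unfolding separately_polynomial_def
proof (intro ballI allI)
  fix z :: "complex^'m" and j assume z: "z \<in> torus"
  let ?z = "update z j"
  have zt: "?z t \<in> torus" if "t \<noteq> 0" for t using z that by (rule update_torus)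
  define b where "b a = cmonom (?z 1) a" for a
  have zb: "cmonom (?z t) a = b a * t powi (a $ j)" if "t \<noteq> 0" for t a
    unfolding b_def using that by (rule cmonom_update)
  \<comment> \<open>At a vertex minimizing the coordinate all edges point upwards, so that the value extends
    holomorphically to \<open>t = 0\<close>.\<close>
  obtain kv u n where F: "vertex_frame \<alpha> kv u n"
      and min: "\<And>x. x \<in> P \<Longrightarrow> (- axis j 1) \<bullet> x \<le> (- axis j 1) \<bullet> of_ivec (\<alpha> kv)"
    using linear_max_frame[of "- axis j 1"] by metis
  interpret A: vertex_frame \<alpha> kv u n by (rule F)
  have u_nonneg: "0 \<le> u i $ j" for i
    using min[OF \<alpha>_in_P[of "A.nbr i"]] by (simp add: inner_axis_ivec A.\<alpha>_nbr)
  define g where "g t = (\<chi> i. b (u i) * t ^ nat (u i $ j))" for t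
  define H where "H t = (b (\<alpha> kv) * t ^ nat (\<alpha> kv $ j)) ^ N * A.chart_value s (g t)" for t
  have FH: "torus_value \<alpha> s (?z t) = H t" if t: "t \<noteq> 0" for t
  proof -
    have "A.to_chart (?z t) = g t"
      using u_nonneg by (simp add: A.to_chart_def g_def zb[OF t] power_int_def vec_eq_iff)
    moreover have "cmonom (?z t) (\<alpha> kv) = b (\<alpha> kv) * t ^ nat (\<alpha> kv $ j)"
      using \<alpha>_nonneg by (simp add: zb[OF t] power_int_def)
    ultimately show ?thesis
      unfolding H_def A.torus_value_chart[OF s zt[OF t]] by simp
  qed
  have "(\<lambda>t. A.chart_value s (g t)) holomorphic_on UNIV"
    by (rule holomorphic_compose_vec[OF A.holo_on_chart_value[OF s]])
      (auto simp: g_def intro!: holomorphic_intros)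
  then have H: "H holomorphic_on UNIV"
    unfolding H_def[abs_def] by (intro holomorphic_intros)
  \<comment> \<open>At a vertex maximizing the coordinate all edges point downwards, which bounds the growth.\<close>
  obtain kv' u' n' where F': "vertex_frame \<alpha> kv' u' n'"
      and max: "\<And>x. x \<in> P \<Longrightarrow> axis j 1 \<bullet> x \<le> axis j 1 \<bullet> of_ivec (\<alpha> kv')"
    using linear_max_frame[of "axis j 1"] by metis
  interpret B: vertex_frame \<alpha> kv' u' n' by (rule F')
  have u_nonpos: "u' i $ j \<le> 0" for i
    using max[OF \<alpha>_in_P[of "B.nbr i"]] by (simp add: inner_axis_ivec B.\<alpha>_nbr)
  define R where "R = (\<Sum>i\<in>UNIV. cmod (b (u' i)))"
  obtain K where K: "0 \<le> K" "\<And>z. z \<in> torus \<Longrightarrow> (\<And>j. cmod (cmonom z (u' j)) \<le> R) \<Longrightarrow>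
      cmod (torus_value \<alpha> s z) \<le> K * cmod (cmonom z (\<alpha> kv')) ^ N"
    using B.torus_value_bound[OF s, of R] by metis
  have growth: "cmod (H t) \<le> K * cmod (b (\<alpha> kv')) ^ N * cmod t ^ degree_bound N" if t1: "1 \<le> cmod t" for t
  proof -
    have t: "t \<noteq> 0" using t1 by auto
    have "cmod (cmonom (?z t) (u' i)) \<le> R" for i
    proof -
      have "cmod t powi (u' i $ j) \<le> 1"
      proof -
        have "inverse (cmod t) \<le> 1" using t1 by (rule inverse_le_1_iff[THEN iffD2, OF disjI2])
        then have "inverse (cmod t) ^ nat (- (u' i $ j)) \<le> 1" by (intro power_le_one) auto
        then show ?thesis
          using u_nonpos[of i] by (cases "u' i $ j = 0") (auto simp: power_int_def)
      qed
      then have "cmod (cmonom (?z t) (u' i)) \<le> cmod (b (u' i)) * 1"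
        unfolding zb[OF t] norm_mult norm_power_int by (intro mult_left_mono) auto
      also have "\<dots> \<le> R"
        unfolding R_def using member_le_sum[of i UNIV "\<lambda>i. cmod (b (u' i))"] by simp
      finally show ?thesis .
    qed
    then have "cmod (H t) \<le> K * cmod (cmonom (?z t) (\<alpha> kv')) ^ N"
      using K(2)[OF zt[OF t]] FH[OF t] by simp
    also have "cmod (cmonom (?z t) (\<alpha> kv')) = cmod (b (\<alpha> kv')) * cmod t ^ nat (\<alpha> kv' $ j)"
      using \<alpha>_nonneg by (simp add: zb[OF t] power_int_def norm_mult norm_power)
    also have "K * (cmod (b (\<alpha> kv')) * cmod t ^ nat (\<alpha> kv' $ j)) ^ N =
        K * cmod (b (\<alpha> kv')) ^ N * cmod t ^ (N * nat (\<alpha> kv' $ j))"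
      by (simp add: power_mult_distrib power_mult[symmetric] mult.commute)
    also have "\<dots> \<le> K * cmod (b (\<alpha> kv')) ^ N * cmod t ^ degree_bound N"
      using K(1) t1 degree_bound by (intro mult_left_mono power_increasing) auto
    finally show ?thesis .
  qed
  define c where "c k = (deriv ^^ k) H 0 / fact k" for k
  have "H t = (\<Sum>k<Suc (degree_bound N). c k * t ^ k)" for t
    using Liouville_polynomial[OF H growth, where \<xi>=t] by (simp add: c_def lessThan_Suc_atMost)
  then show "\<exists>c. \<forall>t. t \<noteq> 0 \<longrightarrow> torus_value \<alpha> s (?z t) = (\<Sum>k<Suc (degree_bound N). c k * t ^ k)"
    using FH by (intro exI[of _ c]) auto
qed

text \<open>A point outside the dilated polytope is separated from it by a linear functional. At the vertex
  where the functional is extremal on the polytope, the edges point to one side of the separating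
  hyperplane, and the cone of this vertex cannot contain the point.\<close>

lemma lattice_point_dilate:
  assumes cones: "\<And>kv u n j. vertex_frame \<alpha> kv u n \<Longrightarrow> 0 \<le> n (a - int N *s \<alpha> kv) $ j"
  shows "a \<in> lattice_points (dilate N P)"
proof (rule ccontr)
  assume "a \<notin> lattice_points (dilate N P)"
  then have a: "of_ivec a \<notin> dilate N P" by (simp add: lattice_points_def)
  have "convex (dilate N P)" "compact (dilate N P)"
    unfolding dilate_def
    using polytope_imp_convex[OF polytope_P] polytope_imp_compact[OF polytope_P]
    by (auto intro: convex_scaling compact_scaling)
  then obtain c b where c: "c \<bullet> of_ivec a < b" "\<And>x. x \<in> dilate N P \<Longrightarrow> b < c \<bullet> x"
    using separating_hyperplane_closed_point[of "dilate N P" "of_ivec a"] a compact_imp_closed by metis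
  obtain kv u n where F: "vertex_frame \<alpha> kv u n"
      and max: "\<And>x. x \<in> P \<Longrightarrow> (- c) \<bullet> x \<le> (- c) \<bullet> of_ivec (\<alpha> kv)"
    using linear_max_frame[of "- c"] by metis
  interpret vertex_frame \<alpha> kv u n by (rule F)
  have cu: "0 \<le> c \<bullet> of_ivec (u j)" for j
    using max[OF \<alpha>_in_P[of "nbr j"]] by (simp add: \<alpha>_nbr of_ivec_add inner_add_right)
  have "a - int N *s \<alpha> kv = (\<Sum>j\<in>UNIV. n (a - int N *s \<alpha> kv) $ j *s u j)" by (rule n_coordinates)
  then have "of_ivec (a - int N *s \<alpha> kv) = (\<Sum>j\<in>UNIV. real_of_int (n (a - int N *s \<alpha> kv) $ j) *\<^sub>R of_ivec (u j))"
    by (metis (no_types, lifting) of_ivec_scale of_ivec_sum sum.cong)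
  then have "c \<bullet> of_ivec (a - int N *s \<alpha> kv) =
      (\<Sum>j\<in>UNIV. real_of_int (n (a - int N *s \<alpha> kv) $ j) * (c \<bullet> of_ivec (u j)))"
    by (simp add: inner_sum_right)
  also have "\<dots> \<ge> 0" using cones[OF F] cu by (intro sum_nonneg mult_nonneg_nonneg) auto
  finally have "real N * (c \<bullet> of_ivec (\<alpha> kv)) \<le> c \<bullet> of_ivec a"
    by (simp add: of_ivec_diff of_ivec_scale inner_diff_right)
  moreover have "real N *\<^sub>R of_ivec (\<alpha> kv) \<in> dilate N P"
    unfolding dilate_def by (intro imageI \<alpha>_in_P)
  ultimately show False using c(1) c(2)[of "real N *\<^sub>R of_ivec (\<alpha> kv)"] by simp
qed

text \<open>Near the vertex \<open>\<alpha> kv\<close> the section is bounded in its chart, so that a term \<open>c z\<^sup>a\<close> of its expansion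
  divided by \<open>z\<^sup>N\<^sup>v\<close> with \<open>v = \<alpha> kv\<close> stays bounded as a chart coordinate tends to zero. A nonzero
  term therefore has nonnegative exponents in this chart, that is, its exponent lies in the cone of
  the vertex.\<close>

lemma fourier_coeff_support:
  assumes s: "s \<in> hol_sections \<alpha> N" and p: "p \<in> multi_indices (Suc (degree_bound N))"
    and nz: "fourier_coeff (Suc (degree_bound N)) (torus_value \<alpha> s) p \<noteq> 0"
  shows "(\<chi> j. int (p j)) \<in> lattice_points (dilate N P)"
proof (rule lattice_point_dilate)
  let ?q = "Suc (degree_bound N)"
  let ?a = "\<chi> j. int (p j)"
  let ?c = "fourier_coeff ?q (torus_value \<alpha> s) p"
  fix kv u n i assume F: "vertex_frame \<alpha> kv u n"
  interpret vertex_frame \<alpha> kv u n by (rule F)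
  obtain K where K: "0 \<le> K" "\<And>z. z \<in> torus \<Longrightarrow> (\<And>j. cmod (cmonom z (u j)) \<le> 1) \<Longrightarrow>
      cmod (torus_value \<alpha> s z) \<le> K * cmod (cmonom z (\<alpha> kv)) ^ N"
    using torus_value_bound[OF s, of 1] by metis
  define C where "C = real (card (multi_indices ?q :: ('m \<Rightarrow> nat) set)) * (\<Prod>j\<in>(UNIV::'m set). 1 / real ?q)"
  have bound: "cmod (?c * cmonom y (?a - int N *s \<alpha> kv)) \<le> C * K"
    if y: "y \<in> torus" "\<And>j. cmod (cmonom y (u j)) \<le> 1" for y
  proof -
    have "cmod (?c * (\<Prod>j\<in>UNIV. y $ j ^ p j)) \<le> C * (K * cmod (cmonom y (\<alpha> kv)) ^ N)"
      unfolding C_def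
    proof (rule fourier_coeff_bound[OF torus_value_separately_polynomial[OF s] y(1) p])
      fix e :: "complex^'m" assume e: "\<And>j. cmod (e $ j) = 1"
      have ey: "(\<chi> j. e $ j * y $ j) \<in> torus" using y(1) e by (auto simp: torus_def) (metis norm_zero zero_neq_one)
      have m: "cmod (cmonom (\<chi> j. e $ j * y $ j) b) = cmod (cmonom y b)" for b
        by (simp add: cmonom_mult norm_mult norm_cmonom_unimodular[OF e])
      show "cmod (torus_value \<alpha> s (\<chi> j. e $ j * y $ j)) \<le> K * cmod (cmonom y (\<alpha> kv)) ^ N"
        using K(2)[OF ey] y(2) by (simp only: m)
    qed
    then have "cmod ?c * cmod (cmonom y ?a) \<le> C * K * cmod (cmonom y (int N *s \<alpha> kv))"
      using y(1) by (simp add: cmonom_of_nat cmonom_scale norm_mult norm_power mult.assoc)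
    then show ?thesis
      using y(1) cmonom_nonzero[OF y(1)]
      by (simp add: cmonom_diff norm_mult norm_divide divide_le_eq)
  qed
  let ?d = "n (?a - int N *s \<alpha> kv) $ i"
  show "0 \<le> ?d"
  proof (rule ccontr)
    assume "\<not> 0 \<le> ?d"
    then have neg: "?d \<le> -1" by simp
    have CK: "0 \<le> C * K" using K(1) by (auto simp: C_def intro!: mult_nonneg_nonneg prod_nonneg)
    \<comment> \<open>small enough for \<open>cmod c / \<epsilon>\<close> to exceed the bound \<open>C * K\<close>\<close>
    define \<epsilon> where "\<epsilon> = cmod ?c / (C * K + cmod ?c)"
    have cpos: "0 < cmod ?c" using nz by simp
    have "0 < C * K + cmod ?c" using CK cpos by (rule add_nonneg_pos)
    then have \<epsilon>: "0 < \<epsilon>" "\<epsilon> \<le> 1" using CK cpos unfolding \<epsilon>_def by (auto simp only: zero_less_divide_iff divide_le_eq_1 le_add_same_cancel2)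
    define w where "w = (\<chi> j. if j = i then complex_of_real \<epsilon> else 1)"
    have w: "w \<in> torus" using \<epsilon> by (simp add: w_def torus_def)
    have m: "cmonom w b = complex_of_real \<epsilon> powi (b $ i)" for b
      unfolding w_def by (rule cmonom_axis)
    have "cmod (cmonom (from_chart w) (u j)) \<le> 1" for j
      using \<epsilon> by (simp add: cmonom_from_chart[OF w] m n_basis axis_def)
    from bound[OF from_chart_torus[OF w] this]
    have "cmod ?c * \<epsilon> powi ?d \<le> C * K"
      using \<epsilon> by (simp add: cmonom_from_chart[OF w] m norm_mult norm_power_int)
    moreover have "1 / \<epsilon> \<le> \<epsilon> powi ?d"
      using power_int_decreasing[OF neg less_imp_le[OF \<epsilon>(1)] \<epsilon>(2)] \<epsilon>(1) by (simp add: power_int_minus divide_inverse)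
    ultimately have "cmod ?c * (1 / \<epsilon>) \<le> C * K"
      using cpos by (meson mult_left_mono norm_ge_zero order_trans)
    then show False using cpos CK by (simp add: \<epsilon>_def)
  qed
qed

lemma torus_value_expansion:
  assumes s: "s \<in> hol_sections \<alpha> N" and fin: "finite (lattice_points (dilate N P))"
  obtains c where "\<And>z. z \<in> torus \<Longrightarrow>
    torus_value \<alpha> s z = (\<Sum>a\<in>lattice_points (dilate N P). c a * cmonom z a)"
proof -
  let ?q = "Suc (degree_bound N)"
  let ?A = "lattice_points (dilate N P)"
  let ?f = "fourier_coeff ?q (torus_value \<alpha> s)"
  let ?v = "\<lambda>p. \<chi> j. int (p j)"
  define S where "S = {p \<in> multi_indices ?q. ?f p \<noteq> 0}"
  have inj: "inj_on ?v S" by (rule inj_onI) (auto simp: vec_eq_iff)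
  have SA: "?v ` S \<subseteq> ?A" using fourier_coeff_support[OF s] by (auto simp: S_def)
  define c where "c a = (if a \<in> ?v ` S then ?f (the_inv_into S ?v a) else 0)" for a
  show thesis
  proof (rule that[of c])
    fix z :: "complex^'m" assume z: "z \<in> torus"
    have "torus_value \<alpha> s z = (\<Sum>p\<in>multi_indices ?q. ?f p * cmonom z (?v p))"
      unfolding cmonom_of_nat
      by (rule separately_polynomial_expansion[OF torus_value_separately_polynomial[OF s] z])
    also have "\<dots> = (\<Sum>p\<in>S. ?f p * cmonom z (?v p))"
      by (rule sum.mono_neutral_right) (auto simp: S_def finite_PiE)
    also have "\<dots> = (\<Sum>a\<in>?v ` S. c a * cmonom z a)"
      by (subst sum.reindex[OF inj]) (auto simp: c_def the_inv_into_f_f[OF inj] intro!: sum.cong)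
    also have "\<dots> = (\<Sum>a\<in>?A. c a * cmonom z a)"
      by (rule sum.mono_neutral_left[OF fin SA]) (simp add: c_def)
    finally show "torus_value \<alpha> s z = (\<Sum>a\<in>?A. c a * cmonom z a)" .
  qed
qed

end

section \<open>The monomial sections\<close>

definition coord_prod :: "'k list \<Rightarrow> complex^'k::finite \<Rightarrow> complex" where
  "coord_prod ks \<zeta> = (\<Prod>k\<leftarrow>ks. \<zeta> $ k)"

lemma coord_prod_scale: "coord_prod ks (c *s \<zeta>) = c ^ length ks * coord_prod ks \<zeta>"
  by (induction ks) (auto simp: coord_prod_def mult_ac)

lemma continuous_on_coord_prod: "continuous_on S (coord_prod ks)"
proof -
  have "continuous_on S (\<lambda>\<zeta>. coord_prod ks \<zeta>)"
    by (induction ks) (auto simp: coord_prod_def intro!: continuous_intros)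
  then show ?thesis by simp
qed

lemma norm_coord_prod_le:
  assumes "norm \<zeta> = 1" shows "cmod (coord_prod ks \<zeta>) \<le> 1"
proof (induction ks)
  case (Cons k ks)
  have "cmod (\<zeta> $ k) \<le> 1" using Finite_Cartesian_Product.norm_nth_le[of \<zeta> k] assms by simp
  then show ?case using Cons by (auto simp: coord_prod_def norm_mult intro: mult_le_one)
qed (simp add: coord_prod_def)

lemma coord_prod_nonzero: "(\<And>k. \<zeta> $ k \<noteq> 0) \<Longrightarrow> coord_prod ks \<zeta> \<noteq> 0"
  by (induction ks) (auto simp: coord_prod_def)

lemma power_sum_lists:
  fixes f :: "'k::finite \<Rightarrow> complex"
  shows "(\<Sum>k\<in>UNIV. f k) ^ N = (\<Sum>ks | length ks = N. \<Prod>k\<leftarrow>ks. f k)"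
proof (induction N)
  case (Suc N)
  have eq: "{ks :: 'k list. length ks = Suc N} = (\<lambda>(k, ks). k # ks) ` (UNIV \<times> {ks. length ks = N})"
    by (auto simp: length_Suc_conv image_iff)
  have inj: "inj_on (\<lambda>(k :: 'k, ks). k # ks) (UNIV \<times> {ks. length ks = N})"
    by (auto simp: inj_on_def)
  have "(\<Sum>ks | length ks = Suc N. \<Prod>k\<leftarrow>ks. f k) = (\<Sum>(k, ks)\<in>UNIV \<times> {ks. length ks = N}. f k * (\<Prod>k\<leftarrow>ks. f k))"
    unfolding eq by (subst sum.reindex[OF inj]) (simp add: case_prod_beta' o_def)
  also have "\<dots> = (\<Sum>k\<in>UNIV. f k) * (\<Sum>ks | length ks = N. \<Prod>k\<leftarrow>ks. f k)"
    by (simp add: sum_product sum.cartesian_product)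
  finally show ?case using Suc by simp
qed simp

lemma coord_prod_monomials:
  "z \<in> torus \<Longrightarrow> coord_prod ks (monomials \<alpha> z) = cmonom z (sum_list (map \<alpha> ks))"
  by (simp add: coord_prod_def monomials_def cmonom_sum_list o_def)

lemma combination_in_hol_sections:
  assumes "\<And>a. a \<in> B \<Longrightarrow> length (f a) = N"
  shows "(\<lambda>l \<zeta>. \<Sum>a\<in>B. c a * coord_prod (f a) \<zeta>) \<in> hol_sections \<alpha> N"
  unfolding hol_sections_def
proof (intro CollectI conjI ballI allI impI)
  show "(\<Sum>a\<in>B. c a * coord_prod (f a) (d *s \<zeta>)) = d ^ N * (\<Sum>a\<in>B. c a * coord_prod (f a) \<zeta>)" for d \<zeta>
    using assms by (simp add: coord_prod_scale sum_distrib_left mult_ac)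
  fix U \<Phi> assume "hol_param \<alpha> U \<Phi>"
  then have "holo_on (\<lambda>w. \<Phi> w $ k) U" for k by (simp add: hol_param_def)
  then show "holo_on (\<lambda>w. \<Sum>a\<in>B. c a * coord_prod (f a) (\<Phi> w)) U"
    unfolding coord_prod_def
    by (intro holo_on_sum holo_on_mult holo_on_const holo_on_prod_list)
qed

context toric_data
begin

text \<open>In a vertex chart both sections are continuous functions, and the torus is dense in the chart.\<close>

lemma hol_sections_eqI:
  assumes s: "s \<in> hol_sections \<alpha> N" and s': "s' \<in> hol_sections \<alpha> N"
    and eq: "\<And>z. z \<in> torus \<Longrightarrow> torus_value \<alpha> s z = torus_value \<alpha> s' z"
    and \<zeta>: "\<zeta> \<noteq> 0" "proj \<zeta> \<in> toric_variety \<alpha>"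
  shows "s (proj \<zeta>) \<zeta> = s' (proj \<zeta>) \<zeta>"
proof -
  obtain kv u n where F: "vertex_frame \<alpha> kv u n" and le: "\<And>k. cmod (\<zeta> $ k) \<le> cmod (\<zeta> $ kv)"
    using dominating_vertex[OF \<zeta>] by (auto simp: vertices_def)
  interpret vertex_frame \<alpha> kv u n by (rule F)
  have nz: "\<zeta> $ kv \<noteq> 0"
  proof
    assume "\<zeta> $ kv = 0"
    then have "\<zeta> = 0" using le by (simp add: vec_eq_iff)
    then show False using \<zeta>(1) by simp
  qed
  have on_torus: "chart_value s w - chart_value s' w = 0" if w: "w \<in> torus" for w
  proof -
    have z: "from_chart w \<in> torus" using w by (rule from_chart_torus)
    then show ?thesis
      using eq[OF z] torus_value_chart[OF s z] torus_value_chart[OF s' z] cmonom_nonzero[OF z]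
      by (simp add: to_chart_from_chart[OF w])
  qed
  have "chart_value s w - chart_value s' w = 0" for w
  proof (rule continuous_constant_on_closure[where f="\<lambda>w. chart_value s w - chart_value s' w" and S=torus])
    show "continuous_on (closure torus) (\<lambda>w. chart_value s w - chart_value s' w)"
      by (intro continuous_intros continuous_on_chart_value[OF s] continuous_on_chart_value[OF s'])
  qed (auto simp: on_torus closure_torus)
  then have G: "chart_value s w = chart_value s' w" for w by simp
  define w where "w = (\<chi> j. \<zeta> $ nbr j / \<zeta> $ kv)"
  have "\<zeta> = \<zeta> $ kv *s chart w" unfolding w_def by (rule toric_eq_chart[OF \<zeta> nz])
  then obtain c where c: "c \<noteq> 0" "\<zeta> = c *s chart w" using nz by blast
  show ?thesis
    unfolding c(2) hol_sections_scale[OF s proj_chart_in_toric chart_nonzero c(1)]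
      hol_sections_scale[OF s' proj_chart_in_toric chart_nonzero c(1)]
    using G by (simp add: chart_value_def)
qed

text \<open>By homogeneity the lift formula that characterizes \<open>chi_section\<close> only prescribes the values over
  the torus.\<close>

lemma chi_condition_iff:
  fixes s :: "'k cproj \<Rightarrow> complex^'k \<Rightarrow> complex"
  assumes s: "s \<in> hol_sections \<alpha> N"
  shows "(\<forall>z\<in>torus. \<forall>\<theta>.
      lift \<alpha> s (cis \<theta> *s ((1 / norm (monomials \<alpha> z)) *\<^sub>R monomials \<alpha> z)) =
        cis (real N * \<theta>) * cmonom z a *
          of_real ((\<Sum>k\<in>UNIV. (cmod (cmonom z (\<alpha> k)))\<^sup>2) powr (- real N / 2)))
    \<longleftrightarrow> (\<forall>z\<in>torus. torus_value \<alpha> s z = cmonom z a)"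
proof -
  have "lift \<alpha> s (cis \<theta> *s ((1 / norm (monomials \<alpha> z)) *\<^sub>R monomials \<alpha> z)) =
        cis (real N * \<theta>) * of_real ((\<Sum>k\<in>UNIV. (cmod (cmonom z (\<alpha> k)))\<^sup>2) powr (- real N / 2)) *
        torus_value \<alpha> s z" (is "?l = ?c * _")
    and "cis (real N * \<theta>) * complex_of_real ((\<Sum>k\<in>UNIV. (cmod (cmonom z (\<alpha> k)))\<^sup>2) powr (- real N / 2)) \<noteq> 0"
    if z: "z \<in> torus" for z \<theta>
  proof -
    let ?\<mu> = "monomials \<alpha> z"
    have nz: "?\<mu> \<noteq> 0" by (rule monomials_nonzero[OF z])
    define c where "c = cis \<theta> * of_real (1 / norm ?\<mu>)"
    have c0: "c \<noteq> 0" using nz by (simp add: c_def)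
    have vec: "cis \<theta> *s ((1 / norm ?\<mu>) *\<^sub>R ?\<mu>) = c *s ?\<mu>"
      unfolding c_def vec_eq_iff vector_smult_component vector_scaleR_component
      by (simp add: scaleR_conv_of_real)
    have "norm (c *s ?\<mu>) = 1" using nz by (simp add: norm_vec_scale c_def norm_mult norm_divide)
    then have mem: "c *s ?\<mu> \<in> circle_bundle \<alpha>"
      using proj_monomials_in_toric[OF z] by (simp add: circle_bundle_def proj_scale[OF c0])
    have sq: "(\<Sum>k\<in>UNIV. (cmod (cmonom z (\<alpha> k)))\<^sup>2) = (norm ?\<mu>)\<^sup>2"
      by (simp add: norm_vec_def L2_set_def sum_nonneg monomials_def)
    have "(norm ?\<mu>)\<^sup>2 powr (- real N / 2) = norm ?\<mu> powr (- real N)"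
      using nz by (simp add: powr_power[symmetric] powr_powr flip: powr_numeral)
    also have "\<dots> = (1 / norm ?\<mu>) ^ N"
      using nz by (simp add: powr_minus powr_realpow power_one_over divide_inverse power_inverse)
    finally have pw: "(\<Sum>k\<in>UNIV. (cmod (cmonom z (\<alpha> k)))\<^sup>2) powr (- real N / 2) = (1 / norm ?\<mu>) ^ N"
      by (simp only: sq)
    have "c ^ N = ?c"
      by (simp only: pw c_def power_mult_distrib Complex.DeMoivre of_real_power)
    moreover have "lift \<alpha> s (c *s ?\<mu>) = c ^ N * torus_value \<alpha> s z"
      using mem hol_sections_scale[OF s proj_monomials_in_toric[OF z] nz c0]
      by (simp add: lift_def torus_value_def)
    ultimately show "?l = ?c * torus_value \<alpha> s z" by (simp add: vec)
    show "?c \<noteq> 0" using nz unfolding pw by simp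
  qed
  then show ?thesis by (auto simp: mult_ac) 
qed

end

section \<open>The Hardy space and the factorization\<close>

locale toric_szego = toric_volume P \<alpha> V
  for P :: "(real^'m) set" and \<alpha> :: "'k::finite \<Rightarrow> int^'m" and V :: "'k cproj measure" +
  fixes N :: nat
  assumes N: "1 \<le> N"
    and counts: "\<forall>a\<in>lattice_points (dilate N P). 1 \<le> partition_count P N a"
begin

abbreviation "A \<equiv> lattice_points (dilate N P)"

definition weight :: "'k list \<Rightarrow> int^'m" where
  "weight ks = sum_list (map \<alpha> ks)"

lemma weight_in_A:
  assumes "length ks = N" shows "weight ks \<in> A"
proof -
  have "(\<Sum>i<N. (1 / real N) *\<^sub>R of_ivec (\<alpha> (ks ! i))) \<in> P"
    using N polytope_imp_convex[OF polytope_P] \<alpha>_in_P by (intro convex_sum) auto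
  moreover have "real N *\<^sub>R (\<Sum>i<N. (1 / real N) *\<^sub>R of_ivec (\<alpha> (ks ! i))) = of_ivec (weight ks)"
    using N assms
    by (simp add: weight_def sum_list_sum_nth of_ivec_sum scaleR_sum_right atLeast0LessThan)
  ultimately have "of_ivec (weight ks) \<in> dilate N P" unfolding dilate_def by force
  then show ?thesis by (simp add: lattice_points_def)
qed

lemma partition_count_eq: "partition_count P N a = card {ks. length ks = N \<and> weight ks = a}"
proof -
  have "bij_betw (map \<alpha>) {ks. length ks = N \<and> weight ks = a}
      {bs. length bs = N \<and> set bs \<subseteq> lattice_points P \<and> sum_list bs = a}"
  proof (rule bij_betw_imageI)
    show "inj_on (map \<alpha>) {ks. length ks = N \<and> weight ks = a}"
      using inj_\<alpha> by (auto intro: inj_on_subset[OF inj_mapI])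
    have "bs \<in> map \<alpha> ` {ks. length ks = N \<and> weight ks = a}"
      if "length bs = N" "set bs \<subseteq> lattice_points P" "sum_list bs = a" for bs
    proof -
      have "bs \<in> lists (range \<alpha>)" using that(2) enum by (auto simp: bij_betw_def)
      then obtain ks where "bs = map \<alpha> ks" by (auto simp: lists_image)
      then show ?thesis using that by (auto simp: weight_def)
    qed
    then show "map \<alpha> ` {ks. length ks = N \<and> weight ks = a} =
        {bs. length bs = N \<and> set bs \<subseteq> lattice_points P \<and> sum_list bs = a}"
      using \<alpha>_in_P by (auto simp: weight_def lattice_points_def)
  qed
  then show ?thesis unfolding partition_count_def by (rule bij_betw_same_card[symmetric])
qed

text \<open>By the hypothesis on the partition counts every exponent \<open>a\<close> is the weight of a list of
  lattice points; the product of the corresponding coordinates is a globally defined polynomial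
  representing the monomial section of exponent \<open>a\<close>.\<close>

definition tuple :: "int^'m \<Rightarrow> 'k list" where
  "tuple a = (SOME ks. length ks = N \<and> weight ks = a)"

lemma tuple:
  assumes "a \<in> A" shows "length (tuple a) = N" "weight (tuple a) = a"
proof -
  have "{ks. length ks = N \<and> weight ks = a} \<noteq> {}"
    using counts assms partition_count_eq[of a] by (metis card.empty not_one_le_zero)
  then have "\<exists>ks. length ks = N \<and> weight ks = a" by blast
  then show "length (tuple a) = N" "weight (tuple a) = a"
    unfolding tuple_def by (metis (mono_tags, lifting) someI_ex)+
qed

lemma finite_tuples: "finite {ks :: 'k list. length ks = N}"
  using finite_lists_length_eq[of "UNIV :: 'k set" N] by simp

lemma finite_A: "finite A"
proof -
  have "A \<subseteq> weight ` {ks. length ks = N}"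
  proof
    fix a assume "a \<in> A"
    then show "a \<in> weight ` {ks. length ks = N}" using tuple[of a] by (intro image_eqI[of _ _ "tuple a"]) auto
  qed
  then show ?thesis using finite_tuples finite_surj by blast
qed

definition chi :: "int^'m \<Rightarrow> complex^'k \<Rightarrow> complex" where
  "chi a \<zeta> = (if \<zeta> \<in> circle_bundle \<alpha> then coord_prod (tuple a) \<zeta> else 0)"

lemma coord_prod_in_hol_sections: "length ks = N \<Longrightarrow> (\<lambda>l. coord_prod ks) \<in> hol_sections \<alpha> N"
  using combination_in_hol_sections[of "{()}" "\<lambda>_. ks" N "\<lambda>_. 1"] by simp

lemma torus_value_coord_prod: "z \<in> torus \<Longrightarrow> torus_value \<alpha> (\<lambda>l. coord_prod ks) z = cmonom z (weight ks)"
  by (simp add: torus_value_def coord_prod_monomials weight_def)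

lemma section_eq_combination:
  assumes s: "s \<in> hol_sections \<alpha> N"
    and c: "\<And>z. z \<in> torus \<Longrightarrow> torus_value \<alpha> s z = (\<Sum>a\<in>A. c a * cmonom z a)"
    and \<zeta>: "\<zeta> \<noteq> 0" "proj \<zeta> \<in> toric_variety \<alpha>"
  shows "s (proj \<zeta>) \<zeta> = (\<Sum>a\<in>A. c a * coord_prod (tuple a) \<zeta>)"
proof -
  let ?s' = "\<lambda>l \<zeta>. \<Sum>a\<in>A. c a * coord_prod (tuple a) \<zeta>"
  have "?s' \<in> hol_sections \<alpha> N" by (rule combination_in_hol_sections) (rule tuple)
  moreover have "torus_value \<alpha> s z = torus_value \<alpha> ?s' z" if "z \<in> torus" for z
    unfolding c[OF that] unfolding torus_value_def
    by (rule sum.cong) (simp_all add: coord_prod_monomials[OF that] tuple weight_def[symmetric])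
  ultimately show ?thesis using hol_sections_eqI[OF s _ _ \<zeta>] by blast
qed

text \<open>On the toric variety a product of coordinates depends only on the sum of the exponents. This makes
  the multinomial expansion of the kernel collapse to the monomial sections.\<close>

lemma coord_prod_eq_chi:
  assumes "length ks = N" "\<zeta> \<in> circle_bundle \<alpha>"
  shows "coord_prod ks \<zeta> = chi (weight ks) \<zeta>"
proof -
  have \<zeta>: "\<zeta> \<noteq> 0" "proj \<zeta> \<in> toric_variety \<alpha>" using assms(2) by (auto simp: circle_bundle_def)
  have "coord_prod ks \<zeta> = coord_prod (tuple (weight ks)) \<zeta>"
    by (rule hol_sections_eqI[OF coord_prod_in_hol_sections coord_prod_in_hol_sections _ \<zeta>])
      (use assms(1) tuple[OF weight_in_A[OF assms(1)]] in \<open>simp_all add: torus_value_coord_prod\<close>)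
  then show ?thesis using assms(2) by (simp add: chi_def)
qed

lemma chi_section:
  assumes "a \<in> A"
  shows "chi_section \<alpha> N a \<in> hol_sections \<alpha> N"
    and "\<zeta> \<noteq> 0 \<Longrightarrow> proj \<zeta> \<in> toric_variety \<alpha> \<Longrightarrow>
      chi_section \<alpha> N a (proj \<zeta>) \<zeta> = coord_prod (tuple a) \<zeta>"
proof -
  let ?cond = "\<lambda>s. \<forall>z\<in>torus. \<forall>\<theta>.
      lift \<alpha> s (cis \<theta> *s ((1 / norm (monomials \<alpha> z)) *\<^sub>R monomials \<alpha> z)) =
        cis (real N * \<theta>) * cmonom z a *
          of_real ((\<Sum>k\<in>UNIV. (cmod (cmonom z (\<alpha> k)))\<^sup>2) powr (- real N / 2))"
  have s0: "(\<lambda>l. coord_prod (tuple a)) \<in> hol_sections \<alpha> N"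
    by (rule coord_prod_in_hol_sections[OF tuple(1)[OF assms]])
  have "?cond (\<lambda>l. coord_prod (tuple a))"
    by (subst chi_condition_iff[OF s0]) (simp add: torus_value_coord_prod tuple(2)[OF assms])
  with s0 have "\<exists>s. s \<in> hol_sections \<alpha> N \<and> ?cond s" by blast
  then have *: "chi_section \<alpha> N a \<in> hol_sections \<alpha> N \<and> ?cond (chi_section \<alpha> N a)"
    unfolding chi_section_def by (rule someI_ex)
  then show h: "chi_section \<alpha> N a \<in> hol_sections \<alpha> N" by simp
  have "\<forall>z\<in>torus. torus_value \<alpha> (chi_section \<alpha> N a) z = cmonom z a"
    using * chi_condition_iff[OF h] by blast
  then show "chi_section \<alpha> N a (proj \<zeta>) \<zeta> = coord_prod (tuple a) \<zeta>"
    if "\<zeta> \<noteq> 0" "proj \<zeta> \<in> toric_variety \<alpha>"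
    by (intro hol_sections_eqI[OF h s0 _ that]) (simp add: torus_value_coord_prod tuple(2)[OF assms])
qed

lemma chi_hat_eq: "a \<in> A \<Longrightarrow> chi_hat \<alpha> N a = chi a"
  by (rule ext) (auto simp: chi_hat_def lift_def chi_def circle_bundle_def intro!: chi_section(2))

text \<open>The monomial sections span the Hardy space: a section is a combination of monomials over the torus
  and hence everywhere.\<close>

lemma hardy_space_eq: "hardy_space \<alpha> N = {f. \<exists>c. f = (\<lambda>\<zeta>. \<Sum>a\<in>A. c a * chi a \<zeta>)}"
proof (intro set_eqI iffI)
  fix f assume "f \<in> hardy_space \<alpha> N"
  then obtain s where s: "s \<in> hol_sections \<alpha> N" "f = lift \<alpha> s" by (auto simp: hardy_space_def)
  obtain c where c: "\<And>z. z \<in> torus \<Longrightarrow> torus_value \<alpha> s z = (\<Sum>a\<in>A. c a * cmonom z a)"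
    using torus_value_expansion[OF s(1) finite_A] by metis
  have "f \<zeta> = (\<Sum>a\<in>A. c a * chi a \<zeta>)" for \<zeta>
  proof (cases "\<zeta> \<in> circle_bundle \<alpha>")
    case True
    then have "\<zeta> \<noteq> 0" "proj \<zeta> \<in> toric_variety \<alpha>" by (auto simp: circle_bundle_def)
    from section_eq_combination[OF s(1) c this] True show ?thesis
      by (simp add: s(2) lift_def chi_def)
  qed (simp add: s(2) lift_def chi_def)
  then show "f \<in> {f. \<exists>c. f = (\<lambda>\<zeta>. \<Sum>a\<in>A. c a * chi a \<zeta>)}" by blast
next
  fix f assume "f \<in> {f. \<exists>c. f = (\<lambda>\<zeta>. \<Sum>a\<in>A. c a * chi a \<zeta>)}"
  then obtain c where f: "f = (\<lambda>\<zeta>. \<Sum>a\<in>A. c a * chi a \<zeta>)" by blast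
  let ?s = "\<lambda>l \<zeta>. \<Sum>a\<in>A. c a * coord_prod (tuple a) \<zeta>"
  have "?s \<in> hol_sections \<alpha> N" by (rule combination_in_hol_sections) (rule tuple)
  moreover have "f = lift \<alpha> ?s" by (rule ext) (simp add: f lift_def chi_def)
  ultimately show "f \<in> hardy_space \<alpha> N" unfolding hardy_space_def by blast
qed

lemma hardy_spaceI: "(\<lambda>\<zeta>. \<Sum>a\<in>A. c a * chi a \<zeta>) \<in> hardy_space \<alpha> N"
  unfolding hardy_space_eq by blast

lemma chi_in_hardy: "a \<in> A \<Longrightarrow> chi a \<in> hardy_space \<alpha> N"
proof -
  assume "a \<in> A"
  then have "chi a = (\<lambda>\<zeta>. \<Sum>b\<in>A. (if b = a then 1 else 0) * chi b \<zeta>)"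
    by (simp add: fun_eq_iff if_distrib[of "\<lambda>x. x * _"] finite_A cong: if_cong)
  then show ?thesis using hardy_spaceI[of "\<lambda>b. if b = a then 1 else 0"] by simp
qed

subsection \<open>Inner products of the monomial sections\<close>

lemma chi_measurable: "chi a \<in> borel_measurable circ"
proof -
  have "coord_prod (tuple a) \<in> borel_measurable (restrict_space borel (circle_bundle \<alpha>))"
    by (rule borel_measurable_continuous_on_restrict[OF continuous_on_coord_prod])
  then have "coord_prod (tuple a) \<in> borel_measurable circ"
    unfolding measurable_cong_sets[OF sets_circ refl] .
  then show ?thesis
    by (rule measurable_cong[THEN iffD2, rotated]) (simp add: chi_def space_circ)
qed

lemma norm_chi_le: "cmod (chi a \<zeta>) \<le> 1"
  using norm_coord_prod_le[of \<zeta>] by (simp add: chi_def circle_bundle_def)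

text \<open>The function on the toric variety whose pullback to the circle bundle is the product of
  \<open>chi a\<close> with the conjugate of \<open>chi b\<close>.\<close>

definition pairing :: "int^'m \<Rightarrow> int^'m \<Rightarrow> 'k cproj \<Rightarrow> complex" where
  "pairing a b l = coord_prod (tuple a) (unit_rep l) * cnj (coord_prod (tuple b) (unit_rep l))"

lemma pairing_proj:
  assumes "a \<in> A" "b \<in> A" "\<zeta> \<noteq> 0"
  shows "pairing a b (proj \<zeta>) =
    coord_prod (tuple a) \<zeta> * cnj (coord_prod (tuple b) \<zeta>) / of_real ((norm \<zeta>)\<^sup>2 ^ N)"
proof -
  obtain c where c: "c \<noteq> 0" "\<zeta> = c *s unit_rep (proj \<zeta>)"
    using proj_same[OF assms(3) unit_rep(3) unit_rep(2)[symmetric]] by blast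
  define \<eta> where "\<eta> = unit_rep (proj \<zeta>)"
  have \<zeta>: "\<zeta> = c *s \<eta>" using c(2) by (simp only: \<eta>_def)
  have n: "norm \<zeta> = cmod c" unfolding \<zeta> norm_vec_scale by (simp add: \<eta>_def unit_rep)
  have "c ^ N * cnj c ^ N = of_real ((cmod c)\<^sup>2 ^ N)"
    by (simp add: power_mult_distrib[symmetric] complex_norm_square[symmetric])
  then have "coord_prod (tuple a) \<zeta> * cnj (coord_prod (tuple b) \<zeta>) =
      of_real ((cmod c)\<^sup>2 ^ N) * (coord_prod (tuple a) \<eta> * cnj (coord_prod (tuple b) \<eta>))"
    unfolding \<zeta> by (simp add: coord_prod_scale tuple assms mult_ac)
  then show ?thesis
    unfolding pairing_def n \<eta>_def[symmetric] using c(1) by simp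
qed

lemma pairing_measurable:
  assumes "a \<in> A" "b \<in> A" shows "pairing a b \<in> borel_measurable V"
proof -
  have "continuous_on UNIV (pairing a b)"
  proof (rule continuous_on_cproj)
    have "continuous_on {\<zeta>. \<zeta> \<noteq> 0 \<and> proj \<zeta> \<in> UNIV}
        (\<lambda>\<zeta>. coord_prod (tuple a) \<zeta> * cnj (coord_prod (tuple b) \<zeta>) / of_real ((norm \<zeta>)\<^sup>2 ^ N))"
      by (intro continuous_intros continuous_on_coord_prod) auto
    then show "continuous_on {\<zeta>. \<zeta> \<noteq> 0 \<and> proj \<zeta> \<in> UNIV} (\<lambda>\<zeta>. pairing a b (proj \<zeta>))"
      by (rule continuous_on_eq) (simp add: pairing_proj assms)
  qed simp
  then have "pairing a b \<in> borel_measurable borel" by (rule borel_measurable_continuous_onI)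
  then show ?thesis
    unfolding measurable_cong_sets[OF sets_V refl] by (rule measurable_restrict_space1)
qed

lemma inner_chi:
  assumes "a \<in> A" "b \<in> A"
  shows "l2_inner circ (chi a) (chi b) = (\<integral>l. pairing a b l \<partial>V)"
proof -
  have "l2_inner circ (chi a) (chi b) = (\<integral>\<zeta>. pairing a b (proj \<zeta>) \<partial>circ)"
    unfolding l2_inner_def
  proof (rule Bochner_Integration.integral_cong[OF refl])
    fix \<zeta> assume "\<zeta> \<in> space circ"
    then have X: "\<zeta> \<in> circle_bundle \<alpha>" by (simp add: space_circ)
    then have "\<zeta> \<noteq> 0" "norm \<zeta> = 1" by (auto simp: circle_bundle_def)
    then show "chi a \<zeta> * cnj (chi b \<zeta>) = pairing a b (proj \<zeta>)"
      using X by (simp add: pairing_proj assms chi_def)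
  qed
  also have "\<dots> = (\<integral>l. pairing a b l \<partial>V)" by (rule integral_circ_proj[OF pairing_measurable[OF assms]])
  finally show ?thesis .
qed

text \<open>Rotating one chart coordinate by a suitable angle preserves the volume and multiplies the
  integrand by \<open>-1\<close>.\<close>

lemma inner_chi_orthogonal:
  assumes a: "a \<in> A" and b: "b \<in> A" and "a \<noteq> b"
  shows "l2_inner circ (chi a) (chi b) = 0"
proof -
  obtain kv u n where F: "vertex_frame \<alpha> kv u n" using linear_max_frame by metis
  interpret vertex_frame \<alpha> kv u n by (rule F)
  have "n a \<noteq> n b" using \<open>a \<noteq> b\<close> by (simp add: n_inject)
  then obtain j where j: "n a $ j \<noteq> n b $ j" by (auto simp: vec_eq_iff)
  define d where "d = real_of_int (n a $ j - n b $ j)"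
  have d: "d \<noteq> 0" using j by (simp add: d_def)
  define e where "e = (\<chi> i. if i = j then cis (pi / d) else 1)"
  have e: "cmod (e $ i) = 1" for i by (simp add: e_def)
  have et: "e \<in> torus" by (auto simp: torus_def e_def)
  have ce: "cmonom e v = cis (real_of_int (v $ j) * (pi / d))" for v
    unfolding e_def cmonom_axis by (simp add: cis_power_int)
  have dchart: "dchart e w $ k = cmonom e (n (\<alpha> k - \<alpha> kv)) * chart w $ k" for w k
    by (simp add: dchart_def chart_def cmonom_def expo_int[symmetric] power_mult_distrib prod.distrib)
  have cp: "coord_prod ks (dchart e w) = cmonom e (n (weight ks - int (length ks) *s \<alpha> kv)) * coord_prod ks (chart w)" for ks w
  proof (induction ks)
    case (Cons k ks)
    have "weight (k # ks) - int (length (k # ks)) *s \<alpha> kv =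
        (\<alpha> k - \<alpha> kv) + (weight ks - int (length ks) *s \<alpha> kv)"
      by (simp add: weight_def vec_eq_iff algebra_simps)
    then have "cmonom e (n (weight (k # ks) - int (length (k # ks)) *s \<alpha> kv)) =
        cmonom e (n (\<alpha> k - \<alpha> kv)) * cmonom e (n (weight ks - int (length ks) *s \<alpha> kv))"
      by (simp only: n_add cmonom_add[OF et])
    then show ?case using Cons by (simp add: coord_prod_def dchart mult_ac)
  qed (simp add: coord_prod_def weight_def)
  have rot: "pairing a b (proj (dchart e w)) = - pairing a b (proj (chart w))" for w
  proof -
    let ?p = "n (a - int N *s \<alpha> kv)" and ?r = "n (b - int N *s \<alpha> kv)"
    have "cmonom e ?p * cnj (cmonom e ?r) = cis (real_of_int (?p $ j) * (pi / d) - real_of_int (?r $ j) * (pi / d))"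
      unfolding ce by (simp add: cis_cnj cis_mult)
    also have "real_of_int (?p $ j) * (pi / d) - real_of_int (?r $ j) * (pi / d) = d * (pi / d)"
    proof -
      have "real_of_int (?p $ j) - real_of_int (?r $ j) = d" by (simp add: n_diff d_def)
      then show ?thesis by (simp only: left_diff_distrib[symmetric])
    qed
    also have "d * (pi / d) = pi" using d by simp
    finally have ph: "cmonom e ?p * cnj (cmonom e ?r) = -1" by simp
    have "coord_prod (tuple a) (dchart e w) * cnj (coord_prod (tuple b) (dchart e w)) =
        (cmonom e ?p * cnj (cmonom e ?r)) * (coord_prod (tuple a) (chart w) * cnj (coord_prod (tuple b) (chart w)))"
      by (simp add: cp tuple a b)
    then show ?thesis
      unfolding ph by (simp add: pairing_proj a b dchart_nonzero chart_nonzero norm_dchart[OF e])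
  qed
  let ?D = "density lborel (\<lambda>w. ennreal (fs_density chart w))"
  have int: "(\<integral>l. pairing a b l \<partial>V) = (\<integral>w. pairing a b (proj (dchart e' w)) \<partial>?D)"
    if e': "\<And>i. cmod (e' $ i) = 1" for e'
  proof -
    have f: "(\<lambda>w. proj (dchart e' w)) \<in> ?D \<rightarrow>\<^sub>M V" using V_eq_distr(2)[OF F e'] by simp
    have "(\<integral>l. pairing a b l \<partial>V) = (\<integral>l. pairing a b l \<partial>(distr ?D V (\<lambda>w. proj (dchart e' w))))"
      using V_eq_distr(1)[OF F e'] by simp
    also have "\<dots> = (\<integral>w. pairing a b (proj (dchart e' w)) \<partial>?D)"
      by (rule integral_distr[OF f pairing_measurable[OF a b]])
    finally show ?thesis .
  qed
  have "(\<integral>l. pairing a b l \<partial>V) = - (\<integral>l. pairing a b l \<partial>V)"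
    using int[OF e] int[of "\<chi> j. 1"] by (simp add: rot dchart_one)
  then show ?thesis unfolding inner_chi[OF a b] by simp
qed

abbreviation "Q \<equiv> chi_norm_sq \<alpha> V N"

lemma pairing_self: "pairing a a l = of_real ((cmod (coord_prod (tuple a) (unit_rep l)))\<^sup>2)"
  by (simp add: pairing_def complex_norm_square[symmetric] del: of_real_power)

lemma fs_norm_chi_section:
  assumes a: "a \<in> A" and l: "l \<in> toric_variety \<alpha>"
  shows "fs_norm N (chi_section \<alpha> N a) l = cmod (coord_prod (tuple a) (unit_rep l))"
  unfolding fs_norm_def
proof (rule the_equality)
  let ?s = "chi_section \<alpha> N a"
  have val: "cmod (?s l \<zeta>) / norm \<zeta> ^ N = cmod (coord_prod (tuple a) (unit_rep l))" if \<zeta>: "\<zeta> \<in> line l - {0}" for \<zeta>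
  proof -
    have p: "proj \<zeta> = l" using \<zeta> proj_of_mem_line by blast
    have "?s l \<zeta> = coord_prod (tuple a) \<zeta>" using chi_section(2)[OF a, of \<zeta>] \<zeta> l by (simp add: p)
    moreover obtain c where c: "c \<noteq> 0" "\<zeta> = c *s unit_rep l"
      using proj_same[of \<zeta> "unit_rep l"] \<zeta> by (auto simp: p unit_rep)
    ultimately show ?thesis
      by (simp add: coord_prod_scale tuple[OF a] norm_vec_scale unit_rep norm_mult norm_power)
  qed
  then show "\<forall>\<zeta>\<in>line l - {0}. cmod (coord_prod (tuple a) (unit_rep l)) = cmod (?s l \<zeta>) / norm \<zeta> ^ N" by simp
  fix r assume "\<forall>\<zeta>\<in>line l - {0}. r = cmod (?s l \<zeta>) / norm \<zeta> ^ N"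
  moreover have "unit_rep l \<in> line l - {0}"
    using unit_rep mem_line_proj[of "unit_rep l"] by (simp add: unit_rep)
  ultimately show "r = cmod (coord_prod (tuple a) (unit_rep l))" using val by metis
qed

text \<open>The norms do not vanish, as a monomial section has no zeros on the open orbit, which has positive
  volume.\<close>

lemma
  assumes a: "a \<in> A"
  shows inner_chi_self: "l2_inner circ (chi a) (chi a) = of_real (Q a)" and Q_pos: "0 < Q a"
proof -
  let ?f = "\<lambda>l. (cmod (coord_prod (tuple a) (unit_rep l)))\<^sup>2"
  have Q: "Q a = (\<integral>l. ?f l \<partial>V)"
    unfolding chi_norm_sq_def
    by (rule Bochner_Integration.integral_cong[OF refl]) (simp add: fs_norm_chi_section[OF a] space_V)
  have "?f = (\<lambda>l. Re (pairing a a l))" by (simp add: pairing_self fun_eq_iff)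
  then have m: "?f \<in> borel_measurable V" using pairing_measurable[OF a a] by simp
  have int: "integrable V ?f"
    by (rule finite_measure.integrable_const_bound[OF finite_measure_V _ m, where B=1])
      (auto intro!: AE_I2 power_le_one norm_coord_prod_le simp: unit_rep)
  show "l2_inner circ (chi a) (chi a) = of_real (Q a)"
  proof -
    have "pairing a a = (\<lambda>l. of_real (?f l))" by (rule ext) (rule pairing_self)
    then show ?thesis unfolding inner_chi[OF a a] Q by (simp only: integral_complex_of_real)
  qed
  have "Q a \<noteq> 0"
  proof
    assume "Q a = 0"
    then have ae: "AE l in V. ?f l = 0"
      unfolding Q using int by (subst (asm) integral_nonneg_eq_0_iff_AE) auto
    have "AE l in V. False"
      by (rule AE_mp[OF AE_orbit], rule AE_mp[OF ae], rule AE_I2)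
        (use coord_prod_nonzero in \<open>auto simp: orbit_def\<close>)
    then have "emeasure V (space V) = 0" using AE_iff_measurable[of "space V" V "\<lambda>l. False"] by simp
    moreover have "emeasure V (orbit \<alpha>) \<le> emeasure V (space V)" by (rule emeasure_space)
    ultimately show False using emeasure_orbit_pos by simp
  qed
  moreover have "0 \<le> Q a" unfolding Q by simp
  ultimately show "0 < Q a" by simp
qed

lemma integrable_bounded_product:
  assumes "square_integrable circ f" shows "integrable circ (\<lambda>\<zeta>. f \<zeta> * cnj (chi a \<zeta>))"
proof -
  interpret finite_measure circ by (rule finite_measure_circ)
  have f: "f \<in> borel_measurable circ" "integrable circ (\<lambda>x. (cmod (f x))\<^sup>2)"
    using assms by (auto simp: square_integrable_def)
  have "integrable circ (\<lambda>x. 1 + (cmod (f x))\<^sup>2)" using f(2) by simp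
  then show ?thesis
  proof (rule Bochner_Integration.integrable_bound)
    show "(\<lambda>\<zeta>. f \<zeta> * cnj (chi a \<zeta>)) \<in> borel_measurable circ"
    proof (rule borel_measurable_times[OF f(1)])
      show "(\<lambda>\<zeta>. cnj (chi a \<zeta>)) \<in> borel_measurable circ"
        by (rule borel_measurable_continuous_on[OF _ chi_measurable]) (intro continuous_intros)
    qed
    have "cmod (f \<zeta>) * cmod (chi a \<zeta>) \<le> 1 + (cmod (f \<zeta>))\<^sup>2" for \<zeta>
    proof -
      have "cmod (f \<zeta>) * cmod (chi a \<zeta>) \<le> cmod (f \<zeta>) * 1" by (intro mult_left_mono norm_chi_le) auto
      moreover have "0 \<le> (cmod (f \<zeta>) - 1)\<^sup>2 + (cmod (f \<zeta>))\<^sup>2 + 1" by simp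
      ultimately show ?thesis by (simp add: power2_eq_square algebra_simps)
    qed
    then show "AE \<zeta> in circ. norm (f \<zeta> * cnj (chi a \<zeta>)) \<le> norm (1 + (cmod (f \<zeta>))\<^sup>2)"
      by (intro AE_I2) (simp add: norm_mult)
  qed
qed

lemma square_integrable_chi: "square_integrable circ (chi a)"
proof -
  have "(\<lambda>x. (cmod (chi a x))\<^sup>2) \<in> borel_measurable circ" using chi_measurable by measurable
  then have "integrable circ (\<lambda>x. (cmod (chi a x))\<^sup>2)"
    by (intro finite_measure.integrable_const_bound[OF finite_measure_circ, where B=1])
      (auto intro!: AE_I2 power_le_one norm_chi_le)
  then show ?thesis using chi_measurable by (simp add: square_integrable_def)
qed

lemma inner_combination_left:
  assumes f: "square_integrable circ f" and b: "b \<in> A"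
  shows "l2_inner circ (\<lambda>\<zeta>. f \<zeta> - (\<Sum>a\<in>A. c a * chi a \<zeta>)) (chi b) = l2_inner circ f (chi b) - c b * of_real (Q b)"
proof -
  have "l2_inner circ (\<lambda>\<zeta>. f \<zeta> - (\<Sum>a\<in>A. c a * chi a \<zeta>)) (chi b) =
      (\<integral>\<zeta>. f \<zeta> * cnj (chi b \<zeta>) - (\<Sum>a\<in>A. c a * (chi a \<zeta> * cnj (chi b \<zeta>))) \<partial>circ)"
    unfolding l2_inner_def
    by (rule arg_cong[of _ _ "integral\<^sup>L circ"]) (simp add: fun_eq_iff left_diff_distrib sum_distrib_right mult.assoc)
  also have "\<dots> = l2_inner circ f (chi b) - (\<Sum>a\<in>A. c a * l2_inner circ (chi a) (chi b))"
    unfolding l2_inner_def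
    using integrable_bounded_product[OF f, of b] integrable_bounded_product[OF square_integrable_chi, of _ b]
    by (simp add: Bochner_Integration.integral_sum Bochner_Integration.integrable_sum)
  also have "(\<Sum>a\<in>A. c a * l2_inner circ (chi a) (chi b)) = (\<Sum>a\<in>A. if a = b then c b * of_real (Q b) else 0)"
    by (rule sum.cong) (auto simp: inner_chi_orthogonal inner_chi_self b)
  finally show ?thesis using b by (simp add: finite_A)
qed

lemma coefficient_of_combination:
  assumes "b \<in> A"
  shows "l2_inner circ (\<lambda>\<zeta>. \<Sum>a\<in>A. c a * chi a \<zeta>) (chi b) = c b * of_real (Q b)"
proof -
  have "square_integrable circ (\<lambda>_. 0)" by (simp add: square_integrable_def)
  from inner_combination_left[OF this assms, of "\<lambda>a. - c a"]
  show ?thesis by (simp add: sum_negf l2_inner_def)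
qed

lemma inner_combination_right:
  assumes "\<And>a. a \<in> A \<Longrightarrow> integrable circ (\<lambda>\<zeta>. g \<zeta> * cnj (chi a \<zeta>))"
  shows "l2_inner circ g (\<lambda>\<zeta>. \<Sum>a\<in>A. c a * chi a \<zeta>) = (\<Sum>a\<in>A. cnj (c a) * l2_inner circ g (chi a))"
proof -
  have "l2_inner circ g (\<lambda>\<zeta>. \<Sum>a\<in>A. c a * chi a \<zeta>) =
      (\<integral>\<zeta>. (\<Sum>a\<in>A. cnj (c a) * (g \<zeta> * cnj (chi a \<zeta>))) \<partial>circ)"
    unfolding l2_inner_def
    by (rule arg_cong[of _ _ "integral\<^sup>L circ"]) (simp add: fun_eq_iff sum_distrib_left mult_ac)
  also have "\<dots> = (\<Sum>a\<in>A. cnj (c a) * l2_inner circ g (chi a))"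
    unfolding l2_inner_def using assms by (simp add: Bochner_Integration.integral_sum)
  finally show ?thesis .
qed

text \<open>The expansion of an orthogonal projection in an orthogonal basis.\<close>

lemma szego_projection_eq:
  assumes f: "square_integrable circ f"
  shows "szego_projection \<alpha> V N f = (\<lambda>\<zeta>. \<Sum>a\<in>A. (l2_inner circ f (chi a) / of_real (Q a)) * chi a \<zeta>)"
    (is "_ = ?h")
  unfolding szego_projection_def
proof (rule the_equality)
  have int: "integrable circ (\<lambda>\<zeta>. (f \<zeta> - (\<Sum>a\<in>A. c a * chi a \<zeta>)) * cnj (chi b \<zeta>))" for b c
  proof -
    have "integrable circ (\<lambda>\<zeta>. f \<zeta> * cnj (chi b \<zeta>) - (\<Sum>a\<in>A. c a * (chi a \<zeta> * cnj (chi b \<zeta>))))"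
      using integrable_bounded_product[OF f, of b] integrable_bounded_product[OF square_integrable_chi, of _ b]
      by (intro Bochner_Integration.integrable_diff Bochner_Integration.integrable_sum) auto
    then show ?thesis by (simp add: left_diff_distrib sum_distrib_right mult.assoc)
  qed
  have orth: "l2_inner circ (\<lambda>x. f x - ?h x) g = 0" if g': "g \<in> hardy_space \<alpha> N" for g
  proof -
    obtain c where g: "g = (\<lambda>\<zeta>. \<Sum>a\<in>A. c a * chi a \<zeta>)" using g' by (auto simp: hardy_space_eq)
    have "l2_inner circ (\<lambda>x. f x - ?h x) (chi a) = 0" if a: "a \<in> A" for a
      unfolding inner_combination_left[OF f a] using Q_pos[OF a] by simp
    then show ?thesis unfolding g inner_combination_right[OF int] by simp
  qed
  show "?h \<in> hardy_space \<alpha> N \<and> (\<forall>g\<in>hardy_space \<alpha> N. l2_inner circ (\<lambda>x. f x - ?h x) g = 0)"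
    by (intro conjI ballI hardy_spaceI orth)
  fix h assume h: "h \<in> hardy_space \<alpha> N \<and> (\<forall>g\<in>hardy_space \<alpha> N. l2_inner circ (\<lambda>x. f x - h x) g = 0)"
  then obtain c where c: "h = (\<lambda>\<zeta>. \<Sum>a\<in>A. c a * chi a \<zeta>)" by (auto simp: hardy_space_eq)
  have "c a = l2_inner circ f (chi a) / of_real (Q a)" if a: "a \<in> A" for a
  proof -
    have "l2_inner circ (\<lambda>x. f x - h x) (chi a) = 0" using h chi_in_hardy[OF a] by blast
    then have "l2_inner circ f (chi a) = c a * of_real (Q a)"
      unfolding c inner_combination_left[OF f a] by simp
    then show ?thesis using Q_pos[OF a] by simp
  qed
  then show "h = ?h" unfolding c by (intro ext sum.cong) auto
qed

text \<open>The power of the scalar product is a sum over lists of \<open>N\<close> coordinates. Grouping the lists by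
  their weights, each group contributes equal terms, and the group of \<open>a\<close> has
  \<open>partition_count P N a\<close> elements.\<close>

lemma kernel_power_expansion:
  assumes "x \<in> circle_bundle \<alpha>" "y \<in> circle_bundle \<alpha>"
  shows "kernel_power N x y = (\<Sum>a\<in>A. of_nat (partition_count P N a) * chi a x * cnj (chi a y))"
proof -
  have "kernel_power N x y = (\<Sum>ks | length ks = N. coord_prod ks x * cnj (coord_prod ks y))"
  proof -
    have "(\<Prod>k\<leftarrow>ks. x $ k * cnj (y $ k)) = coord_prod ks x * cnj (coord_prod ks y)" for ks
      by (induction ks) (auto simp: coord_prod_def)
    then show ?thesis unfolding kernel_power_def power_sum_lists by simp
  qed
  also have "\<dots> = (\<Sum>ks | length ks = N. chi (weight ks) x * cnj (chi (weight ks) y))"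
    using assms by (intro sum.cong) (auto simp: coord_prod_eq_chi)
  also have "\<dots> = (\<Sum>a\<in>A. \<Sum>ks\<in>{ks \<in> {ks. length ks = N}. weight ks = a}. chi (weight ks) x * cnj (chi (weight ks) y))"
    by (rule sum.group[symmetric]) (use finite_tuples finite_A weight_in_A in auto)
  also have "\<dots> = (\<Sum>a\<in>A. of_nat (partition_count P N a) * chi a x * cnj (chi a y))"
  proof (rule sum.cong[OF refl])
    fix a
    have "(\<Sum>ks\<in>{ks \<in> {ks. length ks = N}. weight ks = a}. chi (weight ks) x * cnj (chi (weight ks) y)) =
        (\<Sum>ks\<in>{ks \<in> {ks. length ks = N}. weight ks = a}. chi a x * cnj (chi a y))"
      by (rule sum.cong) auto
    then show "(\<Sum>ks\<in>{ks \<in> {ks. length ks = N}. weight ks = a}. chi (weight ks) x * cnj (chi (weight ks) y)) =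
        of_nat (partition_count P N a) * chi a x * cnj (chi a y)"
      by (simp add: partition_count_eq mult.assoc)
  qed
  finally show ?thesis .
qed

lemma kernel_power_op_eq:
  assumes f: "square_integrable circ f"
  shows "kernel_power_op \<alpha> V N f =
    (\<lambda>\<zeta>. \<Sum>a\<in>A. (of_nat (partition_count P N a) * l2_inner circ f (chi a)) * chi a \<zeta>)"
proof
  fix x
  show "kernel_power_op \<alpha> V N f x =
    (\<Sum>a\<in>A. (of_nat (partition_count P N a) * l2_inner circ f (chi a)) * chi a x)"
  proof (cases "x \<in> circle_bundle \<alpha>")
    case True
    have "kernel_power_op \<alpha> V N f x =
        (\<integral>y. (\<Sum>a\<in>A. (of_nat (partition_count P N a) * chi a x) * (f y * cnj (chi a y))) \<partial>circ)"
      unfolding kernel_power_op_def using True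
      by (auto simp: kernel_power_expansion space_circ sum_distrib_right sum_distrib_left mult_ac
          intro!: Bochner_Integration.integral_cong sum.cong)
    also have "\<dots> = (\<Sum>a\<in>A. (of_nat (partition_count P N a) * chi a x) * l2_inner circ f (chi a))"
      unfolding l2_inner_def using integrable_bounded_product[OF f]
      by (simp add: Bochner_Integration.integral_sum)
    finally show ?thesis by (simp add: mult_ac)
  qed (simp add: kernel_power_op_def chi_def)
qed

text \<open>Linearity on the Hardy space and the prescribed eigenvalues determine a multiplier there.\<close>

lemma multiplier_on_combination:
  assumes M: "is_multiplier P \<alpha> V N M"
  shows "M (\<lambda>\<zeta>. \<Sum>a\<in>A. c a * chi a \<zeta>) =
    (\<lambda>\<zeta>. \<Sum>a\<in>A. c a * (of_real (inverse (real (partition_count P N a)) * inverse (Q a)) * chi a \<zeta>))"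
proof -
  have add: "\<And>f g. f \<in> hardy_space \<alpha> N \<Longrightarrow> g \<in> hardy_space \<alpha> N \<Longrightarrow> M (\<lambda>x. f x + g x) = (\<lambda>x. M f x + M g x)"
    and scale: "\<And>f c. f \<in> hardy_space \<alpha> N \<Longrightarrow> M (\<lambda>x. c * f x) = (\<lambda>x. c * M f x)"
    and eig: "\<And>a. a \<in> A \<Longrightarrow> M (chi a) =
      (\<lambda>x. of_real (inverse (real (partition_count P N a)) * inverse (Q a)) * chi a x)"
    using M by (auto simp: is_multiplier_def chi_hat_eq)
  have partial: "(\<lambda>\<zeta>. \<Sum>a\<in>B. c a * chi a \<zeta>) \<in> hardy_space \<alpha> N" if "B \<subseteq> A" for B c
  proof -
    have "(\<lambda>\<zeta>. \<Sum>a\<in>B. c a * chi a \<zeta>) = (\<lambda>\<zeta>. \<Sum>a\<in>A. (if a \<in> B then c a else 0) * chi a \<zeta>)"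
      using that finite_A by (intro ext sum.mono_neutral_cong_left) auto
    then show ?thesis by (simp only: hardy_spaceI)
  qed
  have "M (\<lambda>\<zeta>. \<Sum>a\<in>B. c a * chi a \<zeta>) =
    (\<lambda>\<zeta>. \<Sum>a\<in>B. c a * (of_real (inverse (real (partition_count P N a)) * inverse (Q a)) * chi a \<zeta>))"
    if "B \<subseteq> A" for B
    using finite_subset[OF that finite_A] that
  proof (induction B rule: finite_induct)
    case empty
    have "M (\<lambda>x. 0 * 0) = (\<lambda>x. 0 * M (\<lambda>x. 0) x)"
      using scale[OF partial[of "{}"], of 0] by simp
    then show ?case by simp
  next
    case (insert b B)
    then have b: "b \<in> A" and B: "B \<subseteq> A" by auto
    have cb: "(\<lambda>\<zeta>. c b * chi b \<zeta>) \<in> hardy_space \<alpha> N" using partial[of "{b}" c] b by simp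
    have "M (\<lambda>\<zeta>. \<Sum>a\<in>insert b B. c a * chi a \<zeta>) = M (\<lambda>\<zeta>. c b * chi b \<zeta> + (\<Sum>a\<in>B. c a * chi a \<zeta>))"
      using insert.hyps by simp
    also have "\<dots> = (\<lambda>\<zeta>. M (\<lambda>\<zeta>. c b * chi b \<zeta>) \<zeta> + M (\<lambda>\<zeta>. \<Sum>a\<in>B. c a * chi a \<zeta>) \<zeta>)"
      by (rule add[OF cb partial[OF B]])
    also have "\<dots> = (\<lambda>\<zeta>. c b * M (chi b) \<zeta> + M (\<lambda>\<zeta>. \<Sum>a\<in>B. c a * chi a \<zeta>) \<zeta>)"
      unfolding scale[OF chi_in_hardy[OF b]] ..
    finally show ?case using insert.hyps by (simp add: eig[OF b] insert.IH[OF B])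
  qed
  then show ?thesis by blast
qed

text \<open>The coefficient of \<open>chi a\<close> is a linear function of the section, namely its inner product with
  \<open>chi a\<close> divided by the norm squared.\<close>

lemma multiplier_exists: "\<exists>M. is_multiplier P \<alpha> V N M"
proof -
  define r where "r a = complex_of_real (inverse (real (partition_count P N a)) * inverse (Q a))" for a
  define M where "M f = (\<lambda>\<zeta>. \<Sum>a\<in>A. (r a * (l2_inner circ f (chi a) / of_real (Q a))) * chi a \<zeta>)" for f
  have M: "M (\<lambda>\<zeta>. \<Sum>a\<in>A. c a * chi a \<zeta>) = (\<lambda>\<zeta>. \<Sum>a\<in>A. (r a * c a) * chi a \<zeta>)" for c
    unfolding M_def
    by (intro ext sum.cong refl) (use Q_pos in \<open>simp add: coefficient_of_combination less_le\<close>)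
  have Mc: "M f = (\<lambda>\<zeta>. \<Sum>a\<in>A. (r a * c a) * chi a \<zeta>)" if "f = (\<lambda>\<zeta>. \<Sum>a\<in>A. c a * chi a \<zeta>)" for f c
    unfolding that by (rule M)
  have "is_multiplier P \<alpha> V N M"
    unfolding is_multiplier_def
  proof (intro conjI ballI allI)
    show "M f \<in> hardy_space \<alpha> N" for f unfolding M_def by (rule hardy_spaceI)
    fix f assume "f \<in> hardy_space \<alpha> N"
    then obtain c where f: "f = (\<lambda>\<zeta>. \<Sum>a\<in>A. c a * chi a \<zeta>)" by (auto simp: hardy_space_eq)
    show "M (\<lambda>x. f x + g x) = (\<lambda>x. M f x + M g x)" if g': "g \<in> hardy_space \<alpha> N" for g
    proof -
      obtain d where g: "g = (\<lambda>\<zeta>. \<Sum>a\<in>A. d a * chi a \<zeta>)" using g' by (auto simp: hardy_space_eq)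
      have "(\<lambda>x. f x + g x) = (\<lambda>\<zeta>. \<Sum>a\<in>A. (c a + d a) * chi a \<zeta>)"
        unfolding f g by (simp add: sum.distrib distrib_right)
      from Mc[OF this] show ?thesis
        unfolding Mc[OF f] Mc[OF g] by (simp add: sum.distrib distrib_right distrib_left)
    qed
    show "M (\<lambda>x. c' * f x) = (\<lambda>x. c' * M f x)" for c'
    proof -
      have "(\<lambda>x. c' * f x) = (\<lambda>\<zeta>. \<Sum>a\<in>A. (c' * c a) * chi a \<zeta>)"
        unfolding f by (simp add: sum_distrib_left mult.assoc)
      from Mc[OF this] show ?thesis
        unfolding Mc[OF f] by (simp add: sum_distrib_left mult_ac)
    qed
  next
    fix a assume a: "a \<in> A"
    have "chi a = (\<lambda>\<zeta>. \<Sum>b\<in>A. (if b = a then 1 else 0) * chi b \<zeta>)"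
      using a by (simp add: fun_eq_iff if_distrib[of "\<lambda>x. x * _"] finite_A cong: if_cong)
    from Mc[OF this] have "M (chi a) = (\<lambda>\<zeta>. r a * chi a \<zeta>)"
      using a by (simp add: if_distrib[of "\<lambda>x. x * _"] if_distrib[of "\<lambda>x. _ * x"] finite_A cong: if_cong)
    then show "M (chi_hat \<alpha> N a) =
        (\<lambda>x. of_real (inverse (real (partition_count P N a)) * inverse (Q a)) * chi_hat \<alpha> N a x)"
      unfolding chi_hat_eq[OF a] r_def .
  qed
  then show ?thesis by blast
qed

lemma szego_factorization:
  assumes M: "is_multiplier P \<alpha> V N M" and f: "square_integrable circ f"
  shows "kernel_power_op \<alpha> V N f \<in> hardy_space \<alpha> N"
    and "szego_projection \<alpha> V N f = M (kernel_power_op \<alpha> V N f)"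
proof -
  show "kernel_power_op \<alpha> V N f \<in> hardy_space \<alpha> N"
    unfolding kernel_power_op_eq[OF f] by (rule hardy_spaceI)
  have "l2_inner circ f (chi a) / of_real (Q a) * chi a \<zeta> =
      of_nat (partition_count P N a) * l2_inner circ f (chi a) *
      (of_real (inverse (real (partition_count P N a)) * inverse (Q a)) * chi a \<zeta>)" if "a \<in> A" for a \<zeta>
  proof -
    have "real (partition_count P N a) \<noteq> 0" using counts that by fastforce
    then have "complex_of_nat (partition_count P N a) * of_real (inverse (real (partition_count P N a))) = 1"
      by simp
    then show ?thesis by (simp add: divide_inverse mult_ac)
  qed
  then show "szego_projection \<alpha> V N f = M (kernel_power_op \<alpha> V N f)"
    unfolding kernel_power_op_eq[OF f] multiplier_on_combination[OF M] szego_projection_eq[OF f]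
    by (intro ext sum.cong refl)
qed

end

theorem lemma5p1:
  fixes P :: "(real^'m::finite) set"
    and \<alpha> :: "'k::finite \<Rightarrow> int^'m"
    and V :: "'k cproj measure"
    and N :: nat
  assumes delzant: "delzant_polytope P"
    and enum: "bij_betw \<alpha> UNIV (lattice_points P)"
    and vol: "is_fs_volume \<alpha> V"
    and N: "1 \<le> N"
    and counts: "\<forall>a\<in>lattice_points (dilate N P). 1 \<le> partition_count P N a"
  shows "(\<exists>M. is_multiplier P \<alpha> V N M) \<and>
    (\<forall>M. is_multiplier P \<alpha> V N M \<longrightarrow>
      (\<forall>f. square_integrable (circle_volume \<alpha> V) f \<longrightarrow>
        kernel_power_op \<alpha> V N f \<in> hardy_space \<alpha> N \<and>
        szego_projection \<alpha> V N f = M (kernel_power_op \<alpha> V N f)))"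
proof -
  interpret toric_szego P \<alpha> V N
    by unfold_locales (fact assms)+
  show ?thesis using multiplier_exists szego_factorization by blast
qed

end
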